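(* The mapping $$S(u)\mapsto\frac{u+F-N/4}{u-F+N/4}=1+2\sum_{r=1}^{\infty}\Big(F-\frac{N}{4}\Big)^{r}u^{-r}$$ defines an algebra homomorphism $\mathrm{B}(\mathfrak{g}_N)\to\mathrm{U}(\mathfrak{g}_N)$ from the reflection algebra to the universal enveloping algebra.
   Context: Let $G=[g_{ij}]$ be a nonsingular symmetric or skew-symmetric complex $N\times N$ matrix ($N$ even in the skew-symmetric case), and $G^{-1}=[\overline g_{ij}]$. In double signs the upper sign refers to the symmetric case and the lower one to the skew-symmetric case. Let $E_{ij}$ be the standard basis of $\mathfrak{gl}_N$ and $$F_{ij}=E_{ij}-\sum_{k,l=1}^N g_{ik}\,\overline g_{lj}\,E_{lk}.$$ $\mathfrak{g}_N$ denotes the Lie subalgebra of $\mathfrak{gl}_N$ spanned by the $F_{ij}$; it is isomorphic to the orthogonal Lie algebra $\mathfrak{o}_N$ (symmetric case) or the symplectic Lie algebra $\mathfrak{sp}_N$ (skew-symmetric case). Let $F=[F_{ij}]=\sum_{i,j}e_{ij}\otimes F_{ij}\in\mathrm{End}\,\mathbb{C}^N\otimes\mathrm{U}(\mathfrak{g}_N)$, where $e_{ij}$ are the matrix units. Let $P=\sum_{i,j}e_{ij}\otimes e_{ji}$, $P^t=\sum_{i,j}e_{ij}\otimes e_{ij}$ and $Q=G_1P^tG_1^{-1}$ in $\mathrm{End}\,\mathbb{C}^N\otimes\mathrm{End}\,\mathbb{C}^N$, where $G_1=G\otimes1$. Set $\kappa=N/2\mp1$ and $$R(u)=1-\frac{P}{u}+\frac{Q}{u-\kappa}.$$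 The reflection algebra $\mathrm{B}(\mathfrak{g}_N)$ is the unital associative algebra generated by elements $s_{ij}^{(r)}$, $1\leqslant i,j\leqslant N$, $r\geqslant1$, subject to the relations (of formal series in $u^{-1},v^{-1}$) $$R(u-v)\,S_1(u)\,R(u+v)\,S_2(v)=S_2(v)\,R(u+v)\,S_1(u)\,R(u-v),\qquad S(u)\,S(-u)=1,$$ where $s_{ij}(u)=\delta_{ij}+\sum_{r\geqslant1}s_{ij}^{(r)}u^{-r}$, $S(u)=\sum_{i,j}e_{ij}\otimes s_{ij}(u)$, $S_1(u)=\sum e_{ij}\otimes1\otimes s_{ij}(u)$, $S_2(u)=\sum1\otimes e_{ij}\otimes s_{ij}(u)$. A mapping $S(u)\mapsto A(u)$ is understood entrywise, coefficient by coefficient in $u^{-1}$. *)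

theory Defs
  imports
    "HOL-Analysis.Analysis"
    "HOL-Library.Poly_Mapping"
    "HOL-Computational_Algebra.Formal_Laurent_Series"
    "HOL-Algebra.QuotRing"
    "HOL-Algebra.Module"
begin

unbundle no fps_syntax

section \<open>Unital associative complex algebras\<close>

text \<open>
  An algebra over the complex numbers is represented by the record of HOL-Algebra that carries a
  ring together with a scalar multiplication. (The locales built on this record in HOL-Algebra
  assume commutativity and are not used.)
\<close>

type_synonym 'b calg = "(complex, 'b) module"

definition alg_hom :: "'a calg \<Rightarrow> 'b calg \<Rightarrow> ('a \<Rightarrow> 'b) set" where
  "alg_hom A B = {h \<in> ring_hom A B.
     \<forall>c. \<forall>x \<in> carrier A. h (c \<odot>\<^bsub>A\<^esub> x) = c \<odot>\<^bsub>B\<^esub> h x}"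

definition quot_alg :: "'a calg \<Rightarrow> 'a set \<Rightarrow> 'a set calg" where
  "quot_alg A I =
    \<lparr>carrier = carrier (A Quot I), mult = mult (A Quot I), one = one (A Quot I),
     zero = zero (A Quot I), add = add (A Quot I),
     smult = (\<lambda>c X. \<Union>x\<in>X. I +>\<^bsub>A\<^esub> (c \<odot>\<^bsub>A\<^esub> x))\<rparr>"

text \<open>
  The algebra of matrices over \<open>A\<close> with rows and columns indexed by a finite type; it is
  \<open>End \<complex>\<^sup>N \<otimes> A\<close>.
\<close>

definition mat_alg :: "'a calg \<Rightarrow> ('n::finite \<Rightarrow> 'n \<Rightarrow> 'a) calg" where
  "mat_alg A =
    \<lparr>carrier = {X. \<forall>i j. X i j \<in> carrier A},
     mult = (\<lambda>X Y i j. \<Oplus>\<^bsub>A\<^esub>k\<in>UNIV. X i k \<otimes>\<^bsub>A\<^esub> Y k j),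
     one = (\<lambda>i j. if i = j then \<one>\<^bsub>A\<^esub> else \<zero>\<^bsub>A\<^esub>),
     zero = (\<lambda>i j. \<zero>\<^bsub>A\<^esub>),
     add = (\<lambda>X Y i j. X i j \<oplus>\<^bsub>A\<^esub> Y i j),
     smult = (\<lambda>c X i j. c \<odot>\<^bsub>A\<^esub> X i j)\<rparr>"

text \<open>
  The algebra \<open>A[[u\<inverse>]]\<close>; a series is the sequence of its coefficients.
\<close>

definition series_alg :: "'a calg \<Rightarrow> (nat \<Rightarrow> 'a) calg" where
  "series_alg A =
    \<lparr>carrier = {f. \<forall>r. f r \<in> carrier A},
     mult = (\<lambda>f g r. \<Oplus>\<^bsub>A\<^esub>k\<in>{..r}. f k \<otimes>\<^bsub>A\<^esub> g (r - k)),
     one = (\<lambda>r. if r = 0 then \<one>\<^bsub>A\<^esub> else \<zero>\<^bsub>A\<^esub>),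
     zero = (\<lambda>r. \<zero>\<^bsub>A\<^esub>),
     add = (\<lambda>f g r. f r \<oplus>\<^bsub>A\<^esub> g r),
     smult = (\<lambda>c f r. c \<odot>\<^bsub>A\<^esub> f r)\<rparr>"


section \<open>Free algebras and presentations\<close>

instantiation list :: (type) monoid_add
begin
definition zero_list :: "'a list" where "zero_list = []"
definition plus_list :: "'a list \<Rightarrow> 'a list \<Rightarrow> 'a list" where "plus_list xs ys = xs @ ys"
instance by standard (simp_all add: zero_list_def plus_list_def)
end

text \<open>
  Words form a monoid under concatenation, written additively as \<^theory>\<open>HOL-Library.Poly_Mapping\<close>
  expects, so the type below, with its ring structure from that theory, is the free unital
  associative algebra on the set of all elements of \<open>'x\<close>.
\<close>

type_synonym 'x free = "'x list \<Rightarrow>\<^sub>0 complex"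

definition fconst :: "complex \<Rightarrow> 'x free" where
  "fconst c = Poly_Mapping.single [] c"

definition fgen :: "'x \<Rightarrow> 'x free" where
  "fgen x = Poly_Mapping.single [x] 1"

definition free_alg :: "'x set \<Rightarrow> 'x free calg" where
  "free_alg X =
    \<lparr>carrier = {p. \<forall>w \<in> Poly_Mapping.keys p. set w \<subseteq> X},
     mult = (*), one = 1, zero = 0, add = (+), smult = (\<lambda>c p. fconst c * p)\<rparr>"

definition presented_alg :: "'x set \<Rightarrow> 'x free set \<Rightarrow> 'x free set calg" where
  "presented_alg X rels = quot_alg (free_alg X) (Idl\<^bsub>free_alg X\<^esub> rels)"

definition presented_gen :: "'x set \<Rightarrow> 'x free set \<Rightarrow> 'x \<Rightarrow> 'x free set" where
  "presented_gen X rels x = (Idl\<^bsub>free_alg X\<^esub> rels) +>\<^bsub>free_alg X\<^esub> fgen x"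


section \<open>The Lie algebra and its universal enveloping algebra\<close>

definition mscale :: "complex \<Rightarrow> complex^'n^'n \<Rightarrow> complex^'n^'n" where
  "mscale c X = map_matrix ((*) c) X"

definition E_unit :: "'n \<Rightarrow> 'n \<Rightarrow> complex^'n::finite^'n" where
  "E_unit i j = axis i (axis j 1)"

definition F_elem :: "complex^'n^'n \<Rightarrow> 'n \<Rightarrow> 'n \<Rightarrow> complex^'n::finite^'n" where
  "F_elem G i j = E_unit i j -
     (\<Sum>k\<in>UNIV. \<Sum>l\<in>UNIV. mscale (G $ i $ k * matrix_inv G $ l $ j) (E_unit l k))"

definition g_lie :: "complex^'n::finite^'n \<Rightarrow> (complex^'n^'n) set" where
  "g_lie G = Modules.module.span mscale {F_elem G i j | i j. True}"

text \<open>
  The universal enveloping algebra of a Lie subalgebra \<open>L\<close> of the general linear Lie algebra. The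
  linearity relations turn the free algebra on the set \<open>L\<close> into the tensor algebra of the vector
  space \<open>L\<close>; the last relations are the defining ones of the enveloping algebra.
\<close>

definition uea_rels :: "(complex^'n::finite^'n) set \<Rightarrow> (complex^'n^'n) free set" where
  "uea_rels L =
     {fgen (x + y) - (fgen x + fgen y) | x y. x \<in> L \<and> y \<in> L} \<union>
     {fgen (mscale c x) - fconst c * fgen x | c x. x \<in> L} \<union>
     {fgen x * fgen y - fgen y * fgen x - fgen (x ** y - y ** x) | x y. x \<in> L \<and> y \<in> L}"

definition uea :: "(complex^'n::finite^'n) set \<Rightarrow> (complex^'n^'n) free set calg" where
  "uea L = presented_alg L (uea_rels L)"

definition uea_incl ::
  "(complex^'n::finite^'n) set \<Rightarrow> complex^'n^'n \<Rightarrow> (complex^'n^'n) free set" where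
  "uea_incl L x = presented_gen L (uea_rels L) x"

abbreviation Ug :: "complex^'n::finite^'n \<Rightarrow> (complex^'n^'n) free set calg" where
  "Ug G \<equiv> uea (g_lie G)"

definition F_mat :: "complex^'n::finite^'n \<Rightarrow> 'n \<Rightarrow> 'n \<Rightarrow> (complex^'n^'n) free set" where
  "F_mat G i j = uea_incl (g_lie G) (F_elem G i j)"

text \<open>The matrix \<open>F - N/4\<close> over the enveloping algebra.\<close>

definition F_shift :: "complex^'n::finite^'n \<Rightarrow> 'n \<Rightarrow> 'n \<Rightarrow> (complex^'n^'n) free set" where
  "F_shift G = F_mat G \<ominus>\<^bsub>mat_alg (Ug G)\<^esub>
     (of_nat CARD('n) / 4 \<odot>\<^bsub>mat_alg (Ug G)\<^esub> \<one>\<^bsub>mat_alg (Ug G)\<^esub>)"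

text \<open>
  The series \<open>1 + X u\<inverse>\<close> for \<open>X\<close> in \<open>A\<close>. Numerator and denominator of \<open>(u + X)/(u - X)\<close> are
  multiplied by \<open>u\<inverse>\<close>, so that the quotient is formed in the algebra of power series in \<open>u\<inverse>\<close>.
\<close>

definition one_plus :: "'a calg \<Rightarrow> 'a \<Rightarrow> nat \<Rightarrow> 'a" where
  "one_plus A X r = (if r = 0 then \<one>\<^bsub>A\<^esub> else if r = 1 then X else \<zero>\<^bsub>A\<^esub>)"

definition cayley :: "'a calg \<Rightarrow> 'a \<Rightarrow> nat \<Rightarrow> 'a" where
  "cayley A X = one_plus A X \<otimes>\<^bsub>series_alg A\<^esub> inv\<^bsub>series_alg A\<^esub> (one_plus A (\<ominus>\<^bsub>A\<^esub> X))"


section \<open>The \<open>R\<close>-matrix and the reflection algebra\<close>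

text \<open>
  \<open>X \<otimes> Y\<close> as a matrix whose rows and columns are indexed by pairs, so that
  \<open>e\<^sub>i\<^sub>j \<otimes> e\<^sub>k\<^sub>l\<close> has its entry in row \<open>(i, k)\<close> and column \<open>(j, l)\<close>.
\<close>

definition tensor :: "'a::times^'n^'n \<Rightarrow> 'a^'n^'n \<Rightarrow> 'a^('n::finite \<times> 'n)^('n \<times> 'n)" where
  "tensor X Y = (\<chi> a b. X $ fst a $ fst b * Y $ snd a $ snd b)"

definition P_mat :: "complex^('n::finite \<times> 'n)^('n \<times> 'n)" where
  "P_mat = (\<Sum>i\<in>UNIV. \<Sum>j\<in>UNIV. tensor (E_unit i j) (E_unit j i))"

definition Pt_mat :: "complex^('n::finite \<times> 'n)^('n \<times> 'n)" where
  "Pt_mat = (\<Sum>i\<in>UNIV. \<Sum>j\<in>UNIV. tensor (E_unit i j) (E_unit i j))"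

definition Q_mat :: "complex^'n::finite^'n \<Rightarrow> complex^('n \<times> 'n)^('n \<times> 'n)" where
  "Q_mat G = tensor G (mat 1) ** Pt_mat ** matrix_inv (tensor G (mat 1))"

text \<open>
  The relations are read in \<open>A((v\<inverse>))((u\<inverse>))\<close>, i.e. rational functions of \<open>u\<close> and \<open>v\<close> are
  expanded in the region \<open>|u| > |v|\<close>: the outer Laurent series variable is \<open>u\<inverse>\<close> and the inner one
  is \<open>v\<inverse>\<close>. For complex coefficients this is a field, where \<open>1/(u - v)\<close> and the like make sense.
  Expanding in \<open>|v| > |u|\<close>, or clearing denominators, gives relations with the same linear span.
\<close>

type_synonym 'a laurent2 = "'a fls fls"

definition u_var :: "complex laurent2" where
  "u_var = fls_X_inv"

definition v_var :: "complex laurent2" where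
  "v_var = fls_const fls_X_inv"

definition lconst :: "complex \<Rightarrow> complex laurent2" where
  "lconst c = fls_const (fls_const c)"

definition R_mat ::
  "complex^'n::finite^'n \<Rightarrow> complex \<Rightarrow> complex laurent2 \<Rightarrow>
     complex laurent2^('n \<times> 'n)^('n \<times> 'n)" where
  "R_mat G \<kappa> w = (\<chi> a b. mat 1 $ a $ b - lconst (P_mat $ a $ b) / w
                          + lconst (Q_mat G $ a $ b) / (w - lconst \<kappa>))"

text \<open>
  \<open>s\<^sub>i\<^sub>j\<^sup>(\<^sup>r\<^sup>)\<close> is the generator with the symbol \<open>(r, i, j)\<close>.
\<close>

type_synonym 'n sfree = "(nat \<times> 'n \<times> 'n) free"

definition s_symbols :: "(nat \<times> 'n \<times> 'n) set" where
  "s_symbols = {(r, i, j). r \<ge> 1}"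

definition s_coeff :: "'n \<Rightarrow> 'n \<Rightarrow> nat \<Rightarrow> 'n sfree" where
  "s_coeff i j r = (if r = 0 then (if i = j then 1 else 0) else fgen (r, i, j))"

definition S_series :: "'n::finite sfree fps^'n^'n" where
  "S_series = (\<chi> i j. Abs_fps (s_coeff i j))"

definition S_series_neg :: "'n::finite sfree fps^'n^'n" where
  "S_series_neg = (\<chi> i j. Abs_fps (\<lambda>r. (- 1) ^ r * s_coeff i j r))"

definition in_u :: "'a::zero fps \<Rightarrow> 'a laurent2" where
  "in_u f = fps_to_fls (Abs_fps (\<lambda>r. fls_const (fps_nth f r)))"

definition in_v :: "'a::zero fps \<Rightarrow> 'a laurent2" where
  "in_v f = fls_const (fps_to_fls f)"

definition scalar_series :: "complex laurent2 \<Rightarrow> 'x free laurent2" where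
  "scalar_series f = Abs_fls (\<lambda>m. Abs_fls (\<lambda>n. fconst (fls_nth (fls_nth f m) n)))"

definition S1 :: "'n::finite sfree laurent2^('n \<times> 'n)^('n \<times> 'n)" where
  "S1 = tensor (map_matrix in_u S_series) (mat 1)"

definition S2 :: "'n::finite sfree laurent2^('n \<times> 'n)^('n \<times> 'n)" where
  "S2 = tensor (mat 1) (map_matrix in_v S_series)"

definition R_free ::
  "complex^'n::finite^'n \<Rightarrow> complex \<Rightarrow> complex laurent2 \<Rightarrow>
     'n sfree laurent2^('n \<times> 'n)^('n \<times> 'n)" where
  "R_free G \<kappa> w = map_matrix scalar_series (R_mat G \<kappa> w)"

definition reflection_defect ::
  "complex^'n::finite^'n \<Rightarrow> complex \<Rightarrow> 'n sfree laurent2^('n \<times> 'n)^('n \<times> 'n)" where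
  "reflection_defect G \<kappa> =
     R_free G \<kappa> (u_var - v_var) ** S1 ** R_free G \<kappa> (u_var + v_var) ** S2
     - S2 ** R_free G \<kappa> (u_var + v_var) ** S1 ** R_free G \<kappa> (u_var - v_var)"

definition unitarity_defect :: "'n::finite sfree fps^'n^'n" where
  "unitarity_defect = S_series ** S_series_neg - mat 1"

definition refl_rels :: "complex^'n::finite^'n \<Rightarrow> complex \<Rightarrow> 'n sfree set" where
  "refl_rels G \<kappa> =
     {fls_nth (fls_nth (reflection_defect G \<kappa> $ a $ b) m) n | a b m n. True} \<union>
     {fps_nth (unitarity_defect $ i $ j) r | i j r. True}"

definition refl_alg :: "complex^'n::finite^'n \<Rightarrow> complex \<Rightarrow> 'n sfree set calg" where
  "refl_alg G \<kappa> = presented_alg s_symbols (refl_rels G \<kappa>)"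

definition refl_gen ::
  "complex^'n::finite^'n \<Rightarrow> complex \<Rightarrow> nat \<Rightarrow> 'n \<Rightarrow> 'n \<Rightarrow> 'n sfree set" where
  "refl_gen G \<kappa> r i j = presented_gen s_symbols (refl_rels G \<kappa>) (r, i, j)"

end

theory Submission
  imports Defs
begin

text \<open>
  Put \<open>X = F - N/4\<close> and write \<open>s = P\<close>, \<open>e = Q\<close>, \<open>y = X\<^sub>2\<close>; let \<open>\<epsilon>\<close> be \<open>1\<close> for symmetric \<open>G\<close> and
  \<open>- 1\<close> for skew-symmetric \<open>G\<close>, so that \<open>\<kappa> = N/2 - \<epsilon>\<close>. The homomorphism exists because these three
  elements of \<open>End \<complex>\<^sup>N \<otimes> End \<complex>\<^sup>N \<otimes> U(g)\<close> satisfy the relations of the degenerate affine Brauer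
  (Nazarov--Wenzl) algebra on two strands, and in such an algebra \<open>S(u) = (u + y)/(u - y)\<close> solves
  the reflection equation.

  The relations are as follows. For matrices, \<open>s\<^sup>2 = 1\<close>, \<open>s e = e s = \<epsilon> e\<close> and \<open>e\<^sup>2 = N e\<close>. The
  Lie bracket of the \<open>F\<^sub>i\<^sub>j\<close> is \<open>[F\<^sub>1, F\<^sub>2] = [P - Q, F\<^sub>2]\<close>, which says that \<open>z = s y s - s + e\<close>
  commutes with \<open>y\<close>. The symmetry of the \<open>F\<^sub>i\<^sub>j\<close> under the transposition defined by \<open>G\<close> is
  \<open>Q (F\<^sub>1 + F\<^sub>2) = 0 = (F\<^sub>1 + F\<^sub>2) Q\<close>. After the shift by \<open>N/4\<close> it becomes
  \<open>e (s y s + y + N/2) = 0 = (s y s + y + N/2) e\<close>, that is, \<open>e (y + z - \<kappa>) = 0 = (y + z - \<kappa>) e\<close>,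
  which is where the value of \<open>\<kappa>\<close> enters.

  With \<open>S\<^sub>1 = s S\<^sub>2 s\<close> and \<open>R' = s R\<close> the reflection equation reads
  \<open>R'(u - v) S(u) R'(u + v) S(v) = S(v) R'(u + v) S(u) R'(u - v)\<close>, where \<open>S(u)\<close> is now a function
  of \<open>y\<close> alone. Multiplying by \<open>v - y\<close> on both sides removes \<open>S(v)\<close>, and \<open>S(u) = 2 u D - 1\<close> with
  \<open>D = 1/d\<close>, \<open>d = u - y\<close>, makes what is left linear in \<open>D\<close>. Everything then reduces to two rules:
  \<open>y - s + e\<close> commutes with the resolvent \<open>s D s\<close> of \<open>s y s\<close> (lemma \<open>resolvent_commutator\<close>), and
  \<open>d (s D e) = (2 u - \<kappa>) s D e - \<epsilon> e - D e + \<epsilon> e D e\<close> with its mirror image (lemmas \<open>resolvent_e\<close>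
  and \<open>e_resolvent\<close>). They cancel all terms containing \<open>D\<close>, and the remaining multiple of \<open>[d, e]\<close>
  has the coefficient \<open>N - 2 \<kappa> - 2 \<epsilon> = 0\<close> (lemma \<open>cleared_reflection_in_ideal\<close>).

  The reflection algebra is a quotient of a free algebra, so the point to prove is that its
  relations lie in the kernel of the substitution of \<open>2 X\<^sup>r\<close> for \<open>s\<^sup>(\<^sup>r\<^sup>)\<close>. This kernel is a
  two-sided ideal \<open>K\<close> of the free algebra on the \<open>s\<^sub>i\<^sub>j\<^sup>(\<^sup>r\<^sup>)\<close>. Hence the argument above is
  carried out in the ring of matrices over Laurent series over that free algebra, with all
  equations between noncommuting elements read modulo the ideal of matrices whose coefficients lie
  in \<open>K\<close>. Unitarity is the identity \<open>(u + X)(u - X)\<inverse> (- u + X)(- u - X)\<inverse> = 1\<close>, compared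
  coefficientwise.
\<close>

no_notation fps_nth (infixl "$" 75)

section \<open>The reflection equation modulo an ideal\<close>

text \<open>
  The results of this section are placed in the class context, and not stated for types of that
  class, because they are applied to square matrices with the product \<open>**\<close>, which is not the
  multiplication of a type class.
\<close>

context ring_1 begin

definition two_sided_ideal :: "'a set \<Rightarrow> bool" where
  "two_sided_ideal J \<longleftrightarrow> 0 \<in> J \<and> (\<forall>x\<in>J. \<forall>y\<in>J. x + y \<in> J) \<and> (\<forall>x\<in>J. \<forall>r. r * x \<in> J \<and> x * r \<in> J)"

lemma
  assumes "two_sided_ideal J"
  shows two_sided_ideal_0: "0 \<in> J"
    and two_sided_ideal_add: "x \<in> J \<Longrightarrow> y \<in> J \<Longrightarrow> x + y \<in> J"
    and two_sided_ideal_mult_left: "x \<in> J \<Longrightarrow> r * x \<in> J"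
    and two_sided_ideal_mult_right: "x \<in> J \<Longrightarrow> x * r \<in> J"
  using assms unfolding two_sided_ideal_def by auto

lemma
  assumes J: "two_sided_ideal J"
  shows two_sided_ideal_uminus: "x \<in> J \<Longrightarrow> - x \<in> J"
    and two_sided_ideal_diff: "x \<in> J \<Longrightarrow> y \<in> J \<Longrightarrow> x - y \<in> J"
proof -
  show n: "- x \<in> J" if "x \<in> J" for x
    using two_sided_ideal_mult_left[OF J that, of "- 1"] by simp
  show "x - y \<in> J" if "x \<in> J" "y \<in> J" for x y
    using two_sided_ideal_add[OF J that(1) n[OF that(2)]] by simp
qed

definition central :: "'a \<Rightarrow> bool" where
  "central c \<longleftrightarrow> (\<forall>x. x * c = c * x)"

text \<open>
  Conjugating \<open>[C, d]\<close> by an inverse of \<open>d\<close> gives \<open>- [C, 1/d]\<close>. This takes the place of an argument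
  with power series in \<open>y\<close>: whatever commutes with \<open>y\<close> commutes with the resolvent of \<open>y\<close>.
\<close>

lemma commutator_inverse_in_ideal:
  assumes J: "two_sided_ideal J"
    and "C * d - d * C \<in> J" "d * D - 1 \<in> J" "D * d - 1 \<in> J"
  shows "C * D - D * C \<in> J"
proof -
  have "C * D - D * C = - (D * (C * d - d * C) * D) - (D * d - 1) * (C * D) + (D * C) * (d * D - 1)"
    by (simp add: algebra_simps)
  thus ?thesis
    using assms by (simp add: two_sided_ideal_add[OF J] two_sided_ideal_diff[OF J] two_sided_ideal_uminus[OF J]
      two_sided_ideal_mult_left[OF J] two_sided_ideal_mult_right[OF J] del: mult_minus_left minus_mult_left)
qed

text \<open>
  With \<open>g = \<epsilon>\<close> and \<open>k = \<kappa>\<close> this is \<open>w (w - \<kappa>) P R(w)\<close>, the braid form of the \<open>R\<close>-matrix with its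
  denominators cleared.
\<close>

definition R_check :: "'a \<Rightarrow> 'a \<Rightarrow> 'a \<Rightarrow> 'a \<Rightarrow> 'a \<Rightarrow> 'a" where
  "R_check s e k g w = w * (w - k) * s - (w - k) + g * w * e"

text \<open>
  The relations of \<open>s\<close> and \<open>e\<close> are those of the Brauer algebra on two strands with the parameter
  \<open>N = 2 \<kappa> + 2 \<epsilon>\<close>; written in this way, no fractions occur.
\<close>

context
  fixes J and s e k g :: 'a
  assumes J: "two_sided_ideal J"
   and k: "central k" and g: "central g"
   and ss: "s * s = 1" and se: "s * e = g * e" and es: "e * s = g * e" and gg: "g * g = 1"
   and ee: "e * e = (k + k + g + g) * e"
begin

lemmas in_ideal = two_sided_ideal_0[OF J] two_sided_ideal_add[OF J] two_sided_ideal_diff[OF J]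
  two_sided_ideal_uminus[OF J]
  two_sided_ideal_mult_left[OF J] two_sided_ideal_mult_right[OF J]

lemma mult_left_extend: "x * y = z \<Longrightarrow> x * (y * w) = z * w"
  by (simp add: mult.assoc[symmetric])

lemmas brauer_simps = ss mult_left_extend[OF ss] se mult_left_extend[OF se] es mult_left_extend[OF es] gg
  mult_left_extend[OF gg] ee mult_left_extend[OF ee]

text \<open>
  An instance for a fixed letter \<open>x\<close> is a terminating rewrite rule; such instances bring all
  scalars to the front of a word and so decide identities between noncommutative polynomials with
  central coefficients.
\<close>

lemma central_comm: "central c \<Longrightarrow> x * c = c * x" "central c \<Longrightarrow> x * (c * y) = c * (x * y)"
  unfolding central_def apply simp using mult_left_extend mult.assoc by metis

lemmas central_kg = central_comm[OF k, of s]  central_comm[OF k, of e]  central_comm[OF g, of s]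
  central_comm[OF g, of e] central_comm[OF g, of k]

text \<open>
  The heart of the proof. Here \<open>a = u - v\<close>, \<open>b = u + v\<close>, \<open>d = u - y\<close>, so \<open>d - a = v - y\<close> and
  \<open>b - d = v + y\<close>: this is the reflection equation for \<open>S(u) = 2 u D - 1\<close>, multiplied by \<open>v - y\<close>
  on the left and on the right. The hypotheses \<open>rs\<close>, \<open>rm\<close>, \<open>rm'\<close> rewrite \<open>[d, s D s]\<close>, \<open>d s D e\<close>
  and \<open>e D s d\<close>.

  Let \<open>A\<close> be the product of the three middle factors with \<open>D\<close> in place of \<open>S(u)\<close>, and \<open>B\<close> the
  reversed product. The combinations \<open>A - B\<close>, \<open>b A - a B\<close> and \<open>a A - b B\<close> that occur are all
  divisible by \<open>b - a\<close>. After division by \<open>(a + b) (b - a)\<close> the claim is that \<open>T\<close> below vanishes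
  modulo the ideal, and \<open>T\<close> is a combination of the residues of the five rules in the hypotheses,
  with factors on both sides.
\<close>

lemma cleared_reflection_in_ideal:
  assumes a: "central a" and b: "central b"
   and r1: "d * D - 1 \<in> J" and r2: "D * d - 1 \<in> J"
   and rs: "d * (s * D * s) - s * D * s * d - (s * D - D * s + g * (e * D * s) - g * (s * D * e)) \<in> J"
   and rm: "d * (s * D * e) - ((a + b - k) * (s * D * e) - g * e - D * e + g * (e * D * e)) \<in> J"
   and rm': "e * D * s * d - ((a + b - k) * (e * D * s) - g * e - e * D + g * (e * D * e)) \<in> J"
  shows "(d - a) * R_check s e k g a * ((a + b) * D - 1) * R_check s e k g b * (b - d)
       - (b - d) * R_check s e k g b * ((a + b) * D - 1) * R_check s e k g a * (d - a) \<in> J"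
proof -
  note c = central_kg central_comm[OF k, of d] central_comm[OF g, of d] central_comm[OF k, of D]
    central_comm[OF g, of D]
    central_comm[OF a, of s]  central_comm[OF a, of e]  central_comm[OF b, of s]  central_comm[OF b, of e]
      central_comm[OF a, of d]  central_comm[OF a, of D]
    central_comm[OF b, of d]  central_comm[OF b, of D] central_comm[OF a, of k]  central_comm[OF a, of g]
      central_comm[OF b, of k]  central_comm[OF b, of g] central_comm[OF b, of a]
  define A where "A = R_check s e k g a * D * R_check s e k g b"
  define B where "B = R_check s e k g b * D * R_check s e k g a"
  define A0 where "A0 = R_check s e k g a * R_check s e k g b"
  have A0': "R_check s e k g b * R_check s e k g a = A0"
    unfolding A0_def R_check_def by (simp add: algebra_simps c brauer_simps)
  let ?W = "(a - k) * (b - k)"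
  (* X, Y and Z are the quotients of A - B, b A - a B and a A - b B by b - a. *)
  define X where "X = ?W * (s * D - D * s) - g * a * b * (s * D * e - e * D * s) + g * k * (D * e - e * D)"
  define Y where "Y = ?W * (a * b * (s * D * s) + D - (a + b) * (D * s)) - g * a * b * k * (s * D * e)
     + g * a * b * (a + b - k) * (e * D * s) - g * (a * b - k * (a + b)) * (D * e) - g * a * b * (e * D)
       + a * b * (e * D * e)"
  define Z where "Z = - (?W * (a * b * (s * D * s) + D - (a + b) * (s * D)) - g * a * b * k * (e * D * s)
     + g * a * b * (a + b - k) * (s * D * e) - g * (a * b - k * (a + b)) * (e * D) - g * a * b * (D * e)
       + a * b * (e * D * e))"
  have X: "A - B = (b - a) * X"
    unfolding A_def B_def X_def R_check_def by (simp add: algebra_simps c brauer_simps)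
  have Y: "b * A - a * B = (b - a) * Y"
    unfolding A_def B_def Y_def R_check_def by (simp add: algebra_simps c brauer_simps)
  have Z: "a * A - b * B = (b - a) * Z"
    unfolding A_def B_def Z_def R_check_def by (simp add: algebra_simps c brauer_simps)
  have A0: "d * A0 - A0 * d = (a + b) * (- (?W * (d * s - s * d)) + (a * b + g * k) * (d * e - e * d))"
    unfolding A0_def R_check_def by (simp add: algebra_simps c brauer_simps)
  define T where "T = - (d * X * d) + d * Y + Z * d - a * b * X + ?W * (d * s - s * d)
    - (a * b + g * k) * (d * e - e * d)"
  (* In this identity the parameter N of e * e = N * e has already been used up, in A0. Every summand
     is a multiple of one of the five hypotheses. *)
  have "T = - (?W * (d * s * (D * d - 1) - (d * D - 1) * s * d))
    + g * a * b * ((d * (s * D * e) - ((a + b - k) * (s * D * e) - g * e - D * e + g * (e * D * e))) * d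
                   - d * (e * D * s * d - ((a + b - k) * (e * D * s) - g * e - e * D + g * (e * D * e))))
    - g * k * ((d * D - 1) * e * d - d * e * (D * d - 1))
    + ?W * (a * b * (d * (s * D * s) - s * D * s * d - (s * D - D * s + g * (e * D * s) - g * (s * D * e)))
            + (d * D - 1) - (a + b) * (d * D - 1) * s - (D * d - 1) + (a + b) * (s * (D * d - 1)))
    - g * a * b * k * (d * (s * D * e) - ((a + b - k) * (s * D * e) - g * e - D * e + g * (e * D * e)))
    + g * a * b * k * (e * D * s * d - ((a + b - k) * (e * D * s) - g * e - e * D + g * (e * D * e)))
    - g * (a * b - k * (a + b)) * ((d * D - 1) * e - e * (D * d - 1))"
    unfolding T_def X_def Y_def Z_def by (simp add: algebra_simps c brauer_simps)
  moreover have "\<dots> \<in> J"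
    by (simp only: in_ideal r1 r2 rs rm rm')
  ultimately have T: "T \<in> J" by simp
  have "(d - a) * R_check s e k g a * ((a + b) * D - 1) * R_check s e k g b * (b - d)
       - (b - d) * R_check s e k g b * ((a + b) * D - 1) * R_check s e k g a * (d - a)
     = (a + b) * (- (d * (A - B) * d) + d * (b * A - a * B) + (a * A - b * B) * d - a * b * (A - B))
       - (b - a) * (d * A0 - A0 * d)"
  proof -
    have "(d - a) * R_check s e k g a * ((a + b) * D - 1) * R_check s e k g b * (b - d) =
      (d - a) * ((a + b) * A - A0) * (b - d)"
    proof -
      have "R_check s e k g a * ((a + b) * D - 1) * R_check s e k g b = (a + b) * A - A0"
        unfolding A_def A0_def by (simp add: algebra_simps central_comm[OF a, of "R_check s e k g a"]
          central_comm[OF b, of "R_check s e k g a"])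
      thus ?thesis by (simp only: mult.assoc)
    qed
    moreover have "(b - d) * R_check s e k g b * ((a + b) * D - 1) * R_check s e k g a * (d - a)
     = (b - d) * ((a + b) * B - A0) * (d - a)"
    proof -
      have "R_check s e k g b * ((a + b) * D - 1) * R_check s e k g a = (a + b) * B - A0"
        unfolding B_def A0'[symmetric] by (simp add: algebra_simps central_comm[OF a, of "R_check s e k g
          b"] central_comm[OF b, of "R_check s e k g b"])
      thus ?thesis by (simp only: mult.assoc)
    qed
    moreover have "(d - a) * ((a + b) * A - A0) * (b - d) - (b - d) * ((a + b) * B - A0) * (d - a)
     = (a + b) * (- (d * (A - B) * d) + d * (b * A - a * B) + (a * A - b * B) * d - a * b * (A - B))
       - (b - a) * (d * A0 - A0 * d)"
      by (simp add: algebra_simps c central_comm[OF a, of A] central_comm[OF b, of A]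
        central_comm[OF a, of B] central_comm[OF b, of B] central_comm[OF a, of A0] central_comm[OF b, of A0])
    ultimately show ?thesis by simp
  qed
  also have "\<dots> = (a + b) * ((b - a) * T)"
    unfolding X Y Z A0 T_def by (simp add: algebra_simps c)
  also have "\<dots> \<in> J" by (simp only: in_ideal T)
  finally show ?thesis .
qed

text \<open>
  The element \<open>y\<close> completes \<open>s\<close> and \<open>e\<close> to a representation of the degenerate affine Brauer
  algebra. The first relation says that \<open>s y s - s + e\<close> commutes with \<open>y\<close>.
\<close>

context
  fixes y
  assumes H: "(s * y * s) * y - y * (s * y * s) - ((s - e) * y - y * (s - e)) \<in> J"
    and He: "e * (s * y * s + y + k + g) \<in> J" and He': "(s * y * s + y + k + g) * e \<in> J"
begin

text \<open>
  Both kinds of rule come from commuting elements. Conjugated by \<open>s\<close>, the first relation says that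
  \<open>y - s + e\<close> commutes with \<open>s y s\<close>, hence with its resolvent \<open>s D s\<close>. Next,
  \<open>y + s y s - s + e - \<kappa>\<close> commutes with \<open>s\<close>, commutes with \<open>y\<close> and hence with \<open>D\<close>, and is
  annihilated by \<open>e\<close>; therefore it annihilates \<open>s D e\<close>, and this is the second rule.
\<close>

lemma
  assumes u: "central u" and d: "d = u - y" and r1: "d * D - 1 \<in> J" and r2: "D * d - 1 \<in> J"
  shows resolvent_commutator:
      "d * (s * D * s) - s * D * s * d - (s * D - D * s + g * (e * D * s) - g * (s * D * e)) \<in> J"
    and resolvent_e: "d * (s * D * e) - ((u + u - k) * (s * D * e) - g * e - D * e + g * (e * D * e)) \<in> J"
    and e_resolvent: "e * D * s * d - ((u + u - k) * (e * D * s) - g * e - e * D + g * (e * D * e)) \<in> J"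
proof -
  note c = central_kg central_comm[OF k, of y] central_comm[OF g, of y] central_comm[OF k, of D]
    central_comm[OF g, of D]
    central_comm[OF u, of s]  central_comm[OF u, of e]  central_comm[OF u, of y] central_comm[OF u, of D]
      central_comm[OF u, of k] central_comm[OF u, of g]
  let ?C = "y - s + e"
  have "(s * D * s) * (s * d * s) - 1 = s * (D * d - 1) * s" by (simp add: algebra_simps brauer_simps)
  also have "\<dots> \<in> J" by (simp only: in_ideal r2)
  finally have r2': "(s * D * s) * (s * d * s) - 1 \<in> J" .
  have "(s * d * s) * (s * D * s) - 1 = s * (d * D - 1) * s" by (simp add: algebra_simps brauer_simps)
  also have "\<dots> \<in> J" by (simp only: in_ideal r1)
  finally have r1': "(s * d * s) * (s * D * s) - 1 \<in> J" .
  have "?C * (s * d * s) - (s * d * s) * ?C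
    = - (s * ((s * y * s) * y - y * (s * y * s) - ((s - e) * y - y * (s - e))) * s)"
    unfolding d by (simp add: algebra_simps brauer_simps c)
  also have "\<dots> \<in> J" by (simp only: in_ideal H)
  finally have 1: "?C * (s * D * s) - (s * D * s) * ?C \<in> J"
    using commutator_inverse_in_ideal[OF J _ r1' r2'] by blast
  have "d * (s * D * s) - s * D * s * d - (s * D - D * s + g * (e * D * s) - g * (s * D * e))
     = - (?C * (s * D * s) - (s * D * s) * ?C)"
    unfolding d by (simp add: algebra_simps brauer_simps c)
  also have "\<dots> \<in> J" by (simp only: in_ideal 1)
  finally show "d * (s * D * s) - s * D * s * d - (s * D - D * s + g * (e * D * s) - g * (s * D * e)) \<in> J" .
  let ?c = "y + s * y * s - s + e - k"
  have "?c * d - d * ?c = - ((s * y * s) * y - y * (s * y * s) - ((s - e) * y - y * (s - e)))"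
    unfolding d by (simp add: algebra_simps brauer_simps c)
  also have "\<dots> \<in> J" by (simp only: in_ideal H)
  finally have 2: "?c * D - D * ?c \<in> J"
    using commutator_inverse_in_ideal[OF J _ r1 r2] by blast
  have "d * (s * D * e) - ((u + u - k) * (s * D * e) - g * e - D * e + g * (e * D * e))
    = - (s * (?c * D - D * ?c) * e + s * D * ((s * y * s + y + k + g) * e)) - s * (d * D - 1) * e"
    unfolding d by (simp add: algebra_simps brauer_simps c)
  also have "\<dots> \<in> J" by (simp only: in_ideal 2 r1 He')
  finally show "d * (s * D * e) - ((u + u - k) * (s * D * e) - g * e - D * e + g * (e * D * e)) \<in> J" .
  have "e * D * s * d - ((u + u - k) * (e * D * s) - g * e - e * D + g * (e * D * e))
    = e * (?c * D - D * ?c) * s - (e * (s * y * s + y + k + g)) * D * s - e * (D * d - 1) * s"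
    unfolding d by (simp add: algebra_simps brauer_simps c)
  also have "\<dots> \<in> J" by (simp only: in_ideal 2 r2 He)
  finally show "e * D * s * d - ((u + u - k) * (e * D * s) - g * e - e * D + g * (e * D * e)) \<in> J" .
qed

text \<open>
  If \<open>\<alpha> = (u + y)/(u - y)\<close> then \<open>(\<alpha> + 1)/(2 u)\<close> is the resolvent \<open>1/(u - y)\<close>.
\<close>

lemma cayley_resolvent:
  assumes u: "central u" and iu: "central iu" "iu * (u + u) = 1"
    and "(u - y) * \<alpha> - (u + y) \<in> J" and "\<alpha> * (u - y) - (u + y) \<in> J"
  shows "(u - y) * (iu * (\<alpha> + 1)) - 1 \<in> J" and "(iu * (\<alpha> + 1)) * (u - y) - 1 \<in> J"
    and "(u + u) * (iu * (\<alpha> + 1)) - 1 = \<alpha>"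
proof -
  have "(u - y) * (iu * (\<alpha> + 1)) - 1 = (u - y) * (iu * (\<alpha> + 1)) - iu * (u + u)"
    by (simp only: iu)
  also have "\<dots> = iu * ((u - y) * \<alpha> - (u + y))"
    by (simp add: algebra_simps central_comm[OF iu(1)])
  also have "\<dots> \<in> J" by (simp only: assms in_ideal)
  finally show "(u - y) * (iu * (\<alpha> + 1)) - 1 \<in> J" .
  have "(iu * (\<alpha> + 1)) * (u - y) - 1 = (iu * (\<alpha> + 1)) * (u - y) - iu * (u + u)"
    by (simp only: iu)
  also have "\<dots> = iu * (\<alpha> * (u - y) - (u + y))"
    by (simp add: algebra_simps)
  also have "\<dots> \<in> J" by (simp only: assms in_ideal)
  finally show "(iu * (\<alpha> + 1)) * (u - y) - 1 \<in> J" .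
  have "(u + u) * (iu * (\<alpha> + 1)) = (iu * (u + u)) * (\<alpha> + 1)"
    by (simp only: central_comm(1)[OF iu(1), of "u + u"] mult.assoc[symmetric])
  thus "(u + u) * (iu * (\<alpha> + 1)) - 1 = \<alpha>" by (simp add: iu)
qed

lemma reflection_in_ideal:
  assumes u: "central u" and iu: "central iu" "iu * (u + u) = 1"
    and v: "central v" and iv: "central iv" "iv * (v + v) = 1"
    and \<alpha>: "(u - y) * \<alpha> - (u + y) \<in> J" "\<alpha> * (u - y) - (u + y) \<in> J"
    and \<beta>: "(v - y) * \<beta> - (v + y) \<in> J" "\<beta> * (v - y) - (v + y) \<in> J"
  shows "R_check s e k g (u - v) * \<alpha> * R_check s e k g (u + v) * \<beta>
    - \<beta> * R_check s e k g (u + v) * \<alpha> * R_check s e k g (u - v) \<in> J" (is "?W \<in> J")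
proof -
  note D = cayley_resolvent[OF u iu \<alpha>] and E = cayley_resolvent[OF v iv \<beta>]
  let ?D = "iu * (\<alpha> + 1)" and ?E = "iv * (\<beta> + 1)" and ?Ra = "R_check s e k g (u - v)" and ?Rb = "R_check s
    e k g (u + v)"
  have a: "central (u - v)" and b: "central (u + v)"
    using u v by (auto simp: central_def algebra_simps)
  have s: "(u - v) + (u + v) = u + u" by (simp add: algebra_simps)
  have T: "(u - y - (u - v)) * ?Ra * \<alpha> * ?Rb * (u + v - (u - y)) - (u + v - (u - y)) * ?Rb * \<alpha> * ?Ra * (u
    - y - (u - v)) \<in> J"
    using cleared_reflection_in_ideal[OF a b D(1,2), unfolded s D(3), OF resolvent_commutator[OF u refl
      D(1,2)] resolvent_e[OF u refl D(1,2)] e_resolvent[OF u refl D(1,2)]] .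
  have T: "(v - y) * ?Ra * \<alpha> * ?Rb * (v + y) - (v + y) * ?Rb * \<alpha> * ?Ra * (v - y) \<in> J"
  proof -
    have "u - y - (u - v) = v - y" "u + v - (u - y) = v + y" by (simp_all add: algebra_simps)
    thus ?thesis using T by simp
  qed
  have "(v - y) * ?W * (v - y) = (v - y) * ?Ra * \<alpha> * ?Rb * (\<beta> * (v - y) - (v + y))
     - ((v - y) * \<beta> - (v + y)) * ?Rb * \<alpha> * ?Ra * (v - y)
     + ((v - y) * ?Ra * \<alpha> * ?Rb * (v + y) - (v + y) * ?Rb * \<alpha> * ?Ra * (v - y))"
    by (simp add: algebra_simps)
  also have "\<dots> \<in> J" by (simp only: in_ideal T \<beta>)
  finally have 1: "(v - y) * ?W * (v - y) \<in> J" .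
  (* E is an inverse of v - y modulo the ideal, so the factors v - y may be cancelled. *)
  have gen: "W = E * (d * W * d) * E - (E * d - 1) * (W * d * E) - W * (d * E - 1)" for W E d
    by (simp add: algebra_simps)
  show ?thesis
    by (subst gen[of _ ?E "v - y"], simp only: in_ideal 1 E(1,2))
qed

lemma R_check_swap:
  assumes w: "central w"
  shows "(w * (w - k) - (w - k) * s + w * e) * s = R_check s e k g w"
    and "s * (w * (w - k) - (w - k) * s + w * e) = R_check s e k g w"
  unfolding R_check_def
  by (simp_all add: algebra_simps brauer_simps central_kg central_comm[OF w, of s]
    central_comm[OF w, of k] central_comm[OF w, of g])

text \<open>
  The reflection equation for \<open>R\<close>-matrices \<open>A = R(u - v)\<close> and \<open>B = R(u + v)\<close>, of which only the
  multiples by the scalars \<open>c\<close> and \<open>c'\<close> are polynomial; \<open>s \<alpha> s\<close> and \<open>\<beta>\<close> are \<open>S\<^sub>1(u)\<close> and \<open>S\<^sub>2(v)\<close>.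
  Each of the two products contains \<open>s\<close> twice, and these letters turn \<open>A\<close> and \<open>B\<close> into the braid
  form.
\<close>

lemma reflection_equation_in_ideal:
  assumes u: "central u" and iu: "central iu" "iu * (u + u) = 1"
    and v: "central v" and iv: "central iv" "iv * (v + v) = 1"
    and \<alpha>: "(u - y) * \<alpha> - (u + y) \<in> J" "\<alpha> * (u - y) - (u + y) \<in> J"
    and \<beta>: "(v - y) * \<beta> - (v + y) \<in> J" "\<beta> * (v - y) - (v + y) \<in> J"
    and A: "central c" "ic * c = 1" "c * A = (u - v) * (u - v - k) - (u - v - k) * s + (u - v) * e"
    and B: "central c'" "ic' * c' = 1" "c' * B = (u + v) * (u + v - k) - (u + v - k) * s + (u + v) * e"
  shows "A * (s * \<alpha> * s) * B * \<beta> - \<beta> * B * (s * \<alpha> * s) * A \<in> J" (is "?W \<in> J")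
proof -
  have ab: "central (u - v)" "central (u + v)"
    using u v by (auto simp: central_def algebra_simps)
  have "c * (c' * ?W) = c * A * s * \<alpha> * (s * (c' * B)) * \<beta> - \<beta> * (c' * B * s) * \<alpha> * (s * (c * A))"
    by (simp add: algebra_simps central_comm[OF B(1), of A] central_comm[OF B(1), of s]
      central_comm[OF B(1), of \<alpha>] central_comm[OF B(1), of \<beta>]
      central_comm[OF A(1), of s] central_comm[OF A(1), of \<alpha>] central_comm[OF A(1), of \<beta>]
        central_comm[OF A(1), of B] central_comm[OF A(1), of c'])
  also have "\<dots> = R_check s e k g (u - v) * \<alpha> * R_check s e k g (u + v) * \<beta>
    - \<beta> * R_check s e k g (u + v) * \<alpha> * R_check s e k g (u - v)"
    unfolding A(3) B(3) R_check_swap[OF ab(1)] R_check_swap[OF ab(2)] ..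
  also have "\<dots> \<in> J"
    by (rule reflection_in_ideal[OF u iu v iv \<alpha> \<beta>])
  finally have "ic' * (ic * (c * (c' * ?W))) \<in> J" by (simp only: in_ideal)
  also have "ic' * (ic * (c * (c' * ?W))) = ?W"
    by (simp only: mult_left_extend[OF A(2)] mult_left_extend[OF B(2)] mult_1_left)
  finally show ?thesis .
qed

end

end

end

section \<open>Matrices and Laurent series over a ring\<close>

text \<open>
  Injectivity matters for series: a coefficientwise map is multiplicative on Laurent series as
  soon as it preserves the order of vanishing.
\<close>

locale ring_embedding =
  fixes \<phi> :: "'a::ring_1 \<Rightarrow> 'b::ring_1"
  assumes add: "\<phi> (x + y) = \<phi> x + \<phi> y"
    and mult: "\<phi> (x * y) = \<phi> x * \<phi> y"
    and one: "\<phi> 1 = 1"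
    and eq_0: "\<phi> x = 0 \<longleftrightarrow> x = 0"
begin

lemma zero: "\<phi> 0 = 0" by (simp add: eq_0)

lemma uminus: "\<phi> (- x) = - \<phi> x"
proof -
  have "\<phi> (- x) + \<phi> x = \<phi> (- x + x)" by (simp only: add)
  thus ?thesis by (simp add: zero eq_neg_iff_add_eq_0)
qed

lemma diff: "\<phi> (x - y) = \<phi> x - \<phi> y"
  using add[of x "- y"] by (simp add: uminus)

lemma sum: "\<phi> (sum f A) = (\<Sum>x\<in>A. \<phi> (f x))"
  by (induction A rule: infinite_finite_induct) (auto simp: zero add)

end

lemma ring_embedding_comp:
  assumes "ring_embedding \<phi>" "ring_embedding \<psi>"
  shows "ring_embedding (\<lambda>x. \<psi> (\<phi> x))"
  using assms unfolding ring_embedding_def by simp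

definition fls_map :: "('a::zero \<Rightarrow> 'b::zero) \<Rightarrow> 'a fls \<Rightarrow> 'b fls" where
  "fls_map \<phi> f = Abs_fls (\<lambda>n. \<phi> (fls_nth f n))"

lemma fls_map_nth: "\<phi> 0 = 0 \<Longrightarrow> fls_nth (fls_map \<phi> f) n = \<phi> (fls_nth f n)"
  unfolding fls_map_def
  by (rule nth_Abs_fls_lower_bound[of "fls_subdegree f"]) simp

lemma fls_map_const: "\<phi> 0 = 0 \<Longrightarrow> fls_map \<phi> (fls_const c) = fls_const (\<phi> c)"
  by (rule fls_eqI) (simp add: fls_map_nth)

lemma fls_map_X_inv: "\<phi> 0 = 0 \<Longrightarrow> \<phi> 1 = 1 \<Longrightarrow> fls_map \<phi> fls_X_inv = fls_X_inv"
  by (rule fls_eqI) (simp add: fls_map_nth)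

lemma fls_map_embedding:
  assumes "ring_embedding \<phi>"
  shows "ring_embedding (fls_map \<phi>)"
proof -
  interpret ring_embedding \<phi> by fact
  have nth: "fls_nth (fls_map \<phi> f) n = \<phi> (fls_nth f n)" for f n
    by (simp add: fls_map_nth zero)
  have eq0: "fls_map \<phi> f = 0 \<longleftrightarrow> f = 0" for f
    by (simp add: fls_eq_iff nth eq_0)
  have sd: "fls_subdegree (fls_map \<phi> f) = fls_subdegree f" for f
  proof (cases "f = 0")
    case True
    thus ?thesis using eq0[of 0] by simp
  next
    case False
    thus ?thesis by (intro fls_subdegree_eqI) (auto simp: nth eq_0)
  qed
  show ?thesis
  proof
    show "fls_map \<phi> (x + y) = fls_map \<phi> x + fls_map \<phi> y" for x y
      by (rule fls_eqI) (simp add: nth add)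
    show "fls_map \<phi> (x * y) = fls_map \<phi> x * fls_map \<phi> y" for x y
      by (rule fls_eqI) (simp add: nth fls_times_nth(2) sd sum mult)
    show "fls_map \<phi> 1 = 1"
      by (rule fls_eqI) (simp add: nth one zero)
  qed (fact eq0)
qed

text \<open>
  A series with central coefficients is central. The bounds of summation of the two products
  differ, which the reindexing \<open>i \<mapsto> n - i\<close> reflects.
\<close>

lemma fls_map_central:
  assumes "\<phi> 0 = 0" and "\<And>c. central (\<phi> c)"
  shows "central (fls_map \<phi> f)"
  unfolding central_def
proof (intro allI fls_eqI)
  fix g n
  let ?c = "fls_map \<phi> f"
  have "(\<Sum>i = fls_subdegree g..n - fls_subdegree ?c. fls_nth g i * fls_nth ?c (n - i)) =
        (\<Sum>i = fls_subdegree ?c..n - fls_subdegree g. fls_nth ?c i * fls_nth g (n - i))"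
    by (rule sum.reindex_bij_witness[of _ "\<lambda>i. n - i" "\<lambda>i. n - i"])
       (use assms in \<open>auto simp: fls_map_nth central_def\<close>)
  thus "fls_nth (g * ?c) n = fls_nth (?c * g) n"
    by (simp only: fls_times_nth(2))
qed

definition fls_over :: "'a::zero set \<Rightarrow> 'a fls set" where
  "fls_over A = {f. \<forall>n. fls_nth f n \<in> A}"

lemma sum_in:
  assumes "0 \<in> C" and "\<And>x y. x \<in> C \<Longrightarrow> y \<in> C \<Longrightarrow> x + y \<in> C" and "\<And>i. i \<in> I \<Longrightarrow> f i \<in> C"
  shows "sum f I \<in> C"
  using assms(3) by (induction I rule: infinite_finite_induct) (auto intro: assms)

text \<open>
  Each coefficient of a product is a finite sum of products of coefficients. The three sets allow
  for both uses: ideals, where one factor is arbitrary, and subrings.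
\<close>

lemma fls_over_times:
  assumes "0 \<in> C" and "\<And>x y. x \<in> C \<Longrightarrow> y \<in> C \<Longrightarrow> x + y \<in> C"
    and "\<And>x y. x \<in> A \<Longrightarrow> y \<in> B \<Longrightarrow> x * y \<in> C"
    and "f \<in> fls_over A" "g \<in> fls_over B"
  shows "f * g \<in> fls_over C"
  using assms(3-5) unfolding fls_over_def
  by (auto simp: fls_times_nth(2) intro!: sum_in[OF assms(1,2)])

lemma two_sided_ideal_fls_over:
  fixes I :: "'a::ring_1 set"
  assumes I: "two_sided_ideal I"
  shows "two_sided_ideal (fls_over I)"
  unfolding two_sided_ideal_def
proof (intro conjI ballI allI)
  note in_I = two_sided_ideal_0[OF I] two_sided_ideal_add[OF I]
    two_sided_ideal_mult_left[OF I] two_sided_ideal_mult_right[OF I]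
  show "0 \<in> fls_over I" and "\<And>f g. f \<in> fls_over I \<Longrightarrow> g \<in> fls_over I \<Longrightarrow> f + g \<in> fls_over I"
    by (auto simp: fls_over_def in_I)
  have U: "g \<in> fls_over UNIV" for g :: "'a fls" by (simp add: fls_over_def)
  show "g * f \<in> fls_over I" if "f \<in> fls_over I" for f g
    by (rule fls_over_times[OF _ _ _ U that]) (auto intro: in_I)
  show "f * g \<in> fls_over I" if "f \<in> fls_over I" for f g
    by (rule fls_over_times[OF _ _ _ that U]) (auto intro: in_I)
qed

definition subring_set :: "'a::ring_1 set \<Rightarrow> bool" where
  "subring_set C \<longleftrightarrow> 1 \<in> C \<and> (\<forall>x\<in>C. \<forall>y\<in>C. x - y \<in> C \<and> x * y \<in> C)"

lemma
  assumes "subring_set C"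
  shows subring_set_1: "1 \<in> C" and subring_set_0: "0 \<in> C"
    and subring_set_diff: "x \<in> C \<Longrightarrow> y \<in> C \<Longrightarrow> x - y \<in> C"
    and subring_set_mult: "x \<in> C \<Longrightarrow> y \<in> C \<Longrightarrow> x * y \<in> C"
    and subring_set_uminus: "x \<in> C \<Longrightarrow> - x \<in> C"
    and subring_set_add: "x \<in> C \<Longrightarrow> y \<in> C \<Longrightarrow> x + y \<in> C"
proof -
  show d: "x \<in> C \<Longrightarrow> y \<in> C \<Longrightarrow> x - y \<in> C" and "x \<in> C \<Longrightarrow> y \<in> C \<Longrightarrow> x * y \<in> C" and 1: "1 \<in> C" for x y
    using assms by (auto simp: subring_set_def)
  show 0: "0 \<in> C" using d[OF 1 1] by simp
  show n: "x \<in> C \<Longrightarrow> - x \<in> C" for x using d[OF 0, of x] by simp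
  show "x \<in> C \<Longrightarrow> y \<in> C \<Longrightarrow> x + y \<in> C" using d[of x "- y"] n[of y] by simp
qed

lemma subring_set_fls_over:
  assumes C: "subring_set C"
  shows "subring_set (fls_over C)"
  unfolding subring_set_def
proof (intro conjI ballI)
  show "1 \<in> fls_over C" using subring_set_1[OF C] subring_set_0[OF C] by (auto simp: fls_over_def)
  fix f g assume "f \<in> fls_over C" "g \<in> fls_over C"
  thus "f - g \<in> fls_over C" "f * g \<in> fls_over C"
    using fls_over_times[OF subring_set_0[OF C] subring_set_add[OF C] subring_set_mult[OF C]]
    by (auto simp: fls_over_def subring_set_diff[OF C])
qed

definition mat_over :: "'a set \<Rightarrow> ('a^'n::finite^'m::finite) set" where
  "mat_over A = {M. \<forall>i j. M $ i $ j \<in> A}"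

text \<open>
  Through this fact the statements proved in the class context hold for matrices.
\<close>

lemma matrix_ring_1:
  "class.ring_1 (mat 1 :: 'a::ring_1^'n::finite^'n) (**) (+) 0 (-) uminus"
proof
  fix a b c :: "'a^'n^'n"
  show "a ** b ** c = a ** (b ** c)" by (simp only: matrix_mul_assoc)
  show "(a + b) ** c = a ** c + b ** c"
    by (simp add: vec_eq_iff matrix_matrix_mult_def sum.distrib algebra_simps)
  show "a ** (b + c) = a ** b + a ** c"
    by (rule matrix_add_ldistrib)
  show "(0::'a^'n^'n) \<noteq> mat 1"
    by (auto simp: vec_eq_iff mat_def)
qed (simp_all add: algebra_simps)

lemma matrix_mult_nth: "(A ** B) $ i $ j = (\<Sum>k\<in>UNIV. A $ i $ k * B $ k $ j)"
  by (simp add: matrix_matrix_mult_def)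

lemma matrix_add_rdistrib:
  fixes A B :: "'a::ring_1^'n::finite^'m::finite"
  shows "(A + B) ** C = A ** C + B ** C"
  by (simp add: vec_eq_iff matrix_mult_nth algebra_simps sum.distrib)

lemma matrix_diff_mult:
  fixes A B :: "'a::ring_1^'n::finite^'m::finite"
  shows "(A - B) ** C = A ** C - B ** C" and "D ** (A - B) = D ** A - D ** B"
  by (simp_all add: vec_eq_iff matrix_mult_nth algebra_simps sum_subtractf)

lemma two_sided_ideal_mat_over:
  fixes I :: "'a::ring_1 set"
  assumes I: "two_sided_ideal I"
  shows "ring_1.two_sided_ideal (**) (+) 0 (mat_over I :: ('a^'n::finite^'n) set)"
proof -
  note in_I = two_sided_ideal_0[OF I] two_sided_ideal_add[OF I]
    two_sided_ideal_mult_left[OF I] two_sided_ideal_mult_right[OF I]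
  show ?thesis
    unfolding ring_1.two_sided_ideal_def[OF matrix_ring_1] mat_over_def
    by (auto simp: matrix_mult_nth in_I intro!: sum_in)
qed

lemma subring_set_mat_over_mult:
  assumes C: "subring_set C" and "A \<in> mat_over C" "B \<in> mat_over C"
  shows "A ** B \<in> mat_over C"
  using assms(2,3) by (auto simp: mat_over_def matrix_mult_nth subring_set_0[OF C] subring_set_add[OF C]
    subring_set_mult[OF C] intro!: sum_in)

lemma mat_over_subring:
  assumes "subring_set C"
  shows "A \<in> mat_over C \<Longrightarrow> B \<in> mat_over C \<Longrightarrow> A - B \<in> mat_over C"
    and "A \<in> mat_over C \<Longrightarrow> B \<in> mat_over C \<Longrightarrow> A + B \<in> mat_over C"
    and "c \<in> C \<Longrightarrow> mat c \<in> mat_over C"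
  using subring_set_diff[OF assms] subring_set_0[OF assms] subring_set_add[OF assms] by
    (auto simp: mat_over_def mat_def)

lemma map_matrix_nth: "map_matrix f A $ i $ j = f (A $ i $ j)"
  by (simp add: map_matrix_def)

lemma scalar_mult_nth:
  fixes A :: "'a::ring_1^'n::finite^'n"
  shows "(mat c ** A) $ i $ j = c * A $ i $ j" and "(A ** mat c) $ i $ j = A $ i $ j * c"
  by (auto simp: matrix_mult_nth mat_def if_distrib[of "\<lambda>x. x * _"] if_distrib[of "\<lambda>x. _ * x"] cong: if_cong)

context ring_embedding begin

lemma map_matrix_mult: "map_matrix \<phi> (A ** B) = map_matrix \<phi> A ** map_matrix \<phi> B"
  by (simp add: vec_eq_iff map_matrix_nth matrix_mult_nth sum mult)

lemma map_matrix_add: "map_matrix \<phi> (A + B) = map_matrix \<phi> A + map_matrix \<phi> B"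
  by (simp add: vec_eq_iff map_matrix_nth add)

lemma map_matrix_diff: "map_matrix \<phi> (A - B) = map_matrix \<phi> A - map_matrix \<phi> B"
  by (simp add: vec_eq_iff map_matrix_nth diff)

lemma map_matrix_mat: "map_matrix \<phi> (mat c) = mat (\<phi> c)"
  by (simp add: vec_eq_iff map_matrix_nth mat_def zero)

end

section \<open>Scalars and constants in the Laurent series over a free algebra\<close>

lemma fconst_embedding: "ring_embedding (fconst :: complex \<Rightarrow> 'x free)"
proof
  show "fconst (x + y) = (fconst x + fconst y :: 'x free)" for x y by (simp add: fconst_def single_add)
  show "fconst (x * y) = (fconst x * fconst y :: 'x free)" for x y
    by (simp add: fconst_def mult_single plus_list_def)
  show "fconst 1 = (1 :: 'x free)"
    by (simp add: fconst_def flip: zero_list_def)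
  show "fconst x = (0 :: 'x free) \<longleftrightarrow> x = 0" for x
    unfolding fconst_def by (metis lookup_single_eq lookup_zero single_zero)
qed

interpretation fconst: ring_embedding "fconst :: complex \<Rightarrow> 'x free"
  by (rule fconst_embedding)

lemma sum_single: "(\<Sum>w\<in>Poly_Mapping.keys p. Poly_Mapping.single w (Poly_Mapping.lookup p w)) = p"
  by (rule poly_mapping_eqI) (auto simp: lookup_sum lookup_single when_def in_keys_iff sum.delta')

lemma fconst_commute: "p * fconst c = fconst c * (p :: 'x free)"
proof -
  let ?m = "\<lambda>w. Poly_Mapping.single w (Poly_Mapping.lookup p w)"
  have "(\<Sum>w\<in>Poly_Mapping.keys p. ?m w) * fconst c = fconst c * (\<Sum>w\<in>Poly_Mapping.keys p. ?m w)"
    unfolding sum_distrib_left sum_distrib_right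
    by (simp add: fconst_def mult_single plus_list_def mult.commute)
  thus ?thesis by (simp only: sum_single)
qed

lemma fconst_collect: "(fconst a * x) * (fconst b * (fconst c * y)) = fconst
  (a * (b * c)) * (x * (y :: 'x free))"
proof -
  have "(fconst a * x) * (fconst b * (fconst c * y)) = fconst a * (x * fconst (b * c)) * y"
    by (simp only: fconst.mult mult.assoc)
  also have "\<dots> = fconst (a * (b * c)) * (x * y)"
    by (simp only: fconst_commute) (simp only: fconst.mult mult.assoc)
  finally show ?thesis .
qed

lemma scalar_series_eq: "scalar_series = fls_map (fls_map fconst)"
  by (rule ext) (simp add: scalar_series_def fls_map_def)

interpretation scalar_series: ring_embedding "scalar_series :: complex laurent2 \<Rightarrow> 'x free laurent2"
  unfolding scalar_series_eq by (intro fls_map_embedding fconst_embedding)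

section \<open>Tensor products and the matrices \<open>P\<close> and \<open>Q\<close>\<close>

lemma map_matrix_id: "map_matrix (\<lambda>x. x) A = A"
  by (simp add: vec_eq_iff map_matrix_nth)

lemma sum_prod_UNIV: "(\<Sum>x\<in>UNIV. f x) = (\<Sum>i\<in>UNIV. \<Sum>j\<in>UNIV. f (i, j))"
  by (simp add: UNIV_Times_UNIV[symmetric] sum.cartesian_product' del: UNIV_Times_UNIV)

lemma tensor_one_nth: "tensor (mat 1) A $ a $ b = (if fst a = fst b then A $ snd a $ snd b else
  (0::'a::ring_1))"
  by (simp add: tensor_def mat_def)

lemma tensor_one_mult_nth:
  fixes A :: "'a::ring_1^'n::finite^'n"
  shows "(tensor (mat 1) A ** M) $ a $ b = (\<Sum>m\<in>UNIV. A $ snd a $ m * M $ (fst a, m) $ b)"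
    and "(M ** tensor (mat 1) A) $ a $ b = (\<Sum>m\<in>UNIV. M $ a $ (fst b, m) * A $ m $ snd b)"
  by (simp_all add: matrix_mult_nth sum_prod_UNIV tensor_one_nth if_distrib[of "\<lambda>x. x * _"]
    if_distrib[of "\<lambda>x. _ * x"]
      cong: if_cong, subst sum.swap, simp, subst sum.swap, simp)

lemma tensor_one_mult:
  fixes A :: "'a::ring_1^'n::finite^'n"
  shows "tensor (mat 1) A ** tensor (mat 1) B = tensor (mat 1) (A ** B)"
  unfolding vec_eq_iff tensor_one_mult_nth(1) by (simp add: tensor_one_nth matrix_mult_nth)

lemma tensor_one_add: "tensor (mat 1) (A + B) = tensor (mat 1) A + tensor (mat 1)
  (B :: 'a::ring_1^'n::finite^'n)"
  and tensor_one_diff: "tensor (mat 1) (A - B) = tensor (mat 1) A - tensor (mat 1)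
    (B :: 'a::ring_1^'n::finite^'n)"
  and tensor_one_mat: "tensor (mat 1) (mat c) = mat (c :: 'a::ring_1)"
  by (auto simp: vec_eq_iff tensor_one_nth, auto simp: mat_def prod_eq_iff)

lemma tensor_one_over: "0 \<in> A \<Longrightarrow> M \<in> mat_over A \<Longrightarrow> tensor (mat 1) M \<in> mat_over (A :: 'a::ring_1 set)"
  by (auto simp: mat_over_def tensor_one_nth)

lemma P_mat_nth: "P_mat $ a $ b = (if fst a = snd b \<and> snd a = fst b then 1 else 0)"
proof -
  let ?c = "if fst a = snd b \<and> snd a = fst b then 1 else 0 :: complex"
  have "P_mat $ a $ b = (\<Sum>i\<in>UNIV. \<Sum>j\<in>UNIV. if j = fst b then (if i = fst a then ?c else 0) else 0)"
    unfolding P_mat_def sum_component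
    by (intro sum.cong refl) (auto simp: tensor_def E_unit_def axis_def)
  thus ?thesis by simp
qed

lemma Pt_mat_nth: "Pt_mat $ a $ b = (if fst a = snd a \<and> fst b = snd b then 1 else 0)"
proof -
  let ?c = "if fst a = snd a \<and> fst b = snd b then 1 else 0 :: complex"
  have "Pt_mat $ a $ b = (\<Sum>i\<in>UNIV. \<Sum>j\<in>UNIV. if j = fst b then (if i = fst a then ?c else 0) else 0)"
    unfolding Pt_mat_def sum_component
    by (intro sum.cong refl) (auto simp: tensor_def E_unit_def axis_def)
  thus ?thesis by simp
qed

lemma tensor_mat_one_nth: "tensor A (mat 1) $ a $ b = (if snd a = snd b then A $ fst a $ fst b else
  (0::'a::ring_1))"
  by (simp add: tensor_def mat_def)

lemma tensor_mat_one_mult_nth: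
  fixes A :: "'a::ring_1^'n::finite^'n"
  shows "(tensor A (mat 1) ** M) $ a $ b = (\<Sum>m\<in>UNIV. A $ fst a $ m * M $ (m, snd a) $ b)"
    and "(M ** tensor A (mat 1)) $ a $ b = (\<Sum>m\<in>UNIV. M $ a $ (m, snd b) * A $ m $ fst b)"
  by (simp_all add: matrix_mult_nth sum_prod_UNIV tensor_mat_one_nth if_distrib[of "\<lambda>x. x * _"]
    if_distrib[of "\<lambda>x. _ * x"]
      cong: if_cong)

lemma tensor_mat_one_mult:
  fixes A :: "'a::ring_1^'n::finite^'n"
  shows "tensor A (mat 1) ** tensor B (mat 1) = tensor (A ** B) (mat 1)"
  unfolding vec_eq_iff tensor_mat_one_mult_nth(1) by (simp add: tensor_mat_one_nth matrix_mult_nth)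

lemma swap_mult_nth:
  assumes "\<phi> 0 = (0::'a::ring_1)" "\<phi> 1 = 1"
  shows "(map_matrix \<phi> P_mat ** M) $ a $ b = M $ prod.swap a $ b"
    and "(M ** map_matrix \<phi> P_mat) $ a $ b = M $ a $ prod.swap b"
proof -
  have "(map_matrix \<phi> P_mat ** M) $ a $ b = (\<Sum>c\<in>UNIV. if c = prod.swap a then M $ c $ b else 0)"
    unfolding matrix_mult_nth by (rule sum.cong) (auto simp: map_matrix_nth P_mat_nth assms prod_eq_iff)
  thus "(map_matrix \<phi> P_mat ** M) $ a $ b = M $ prod.swap a $ b" by simp
  have "(M ** map_matrix \<phi> P_mat) $ a $ b = (\<Sum>c\<in>UNIV. if c = prod.swap b then M $ a $ c else 0)"
    unfolding matrix_mult_nth by (rule sum.cong) (auto simp: map_matrix_nth P_mat_nth assms prod_eq_iff)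
  thus "(M ** map_matrix \<phi> P_mat) $ a $ b = M $ a $ prod.swap b" by simp
qed

lemma P_mult_nth:
  "(P_mat ** M) $ a $ b = M $ prod.swap a $ b" "(M ** P_mat) $ a $ b = M $ a $ prod.swap b"
  by (fact swap_mult_nth[of "\<lambda>x. x", OF refl refl, unfolded map_matrix_id])+

lemma P_P: "P_mat ** P_mat = (mat 1)"
  by (auto simp: vec_eq_iff P_mult_nth P_mat_nth mat_def prod_eq_iff)

text \<open>
  Conjugation by the flip \<open>P\<close> exchanges the two tensor factors, so \<open>S\<^sub>1\<close> is obtained from the
  second-factor form.
\<close>

lemma tensor_mult_one:
  fixes A :: "'a::ring_1^'n::finite^'n"
  assumes "\<phi> 0 = (0::'a::ring_1)" "\<phi> 1 = 1"
  shows "map_matrix \<phi> P_mat ** tensor (mat 1) A ** map_matrix \<phi> P_mat = tensor A (mat 1)"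
  by (simp add: vec_eq_iff swap_mult_nth[of \<phi>, OF assms] tensor_one_nth, simp add: tensor_def mat_def)

lemma matrix_inv_eqI:
  fixes A :: "'a::semiring_1^'n::finite^'n"
  assumes "A ** B = mat 1" "B ** A = mat 1"
  shows "matrix_inv A = B"
proof -
  have i: "A ** matrix_inv A = mat 1"
    unfolding matrix_inv_def using someI_ex[of "\<lambda>C. A ** C = mat 1 \<and> C ** A = mat 1"] assms by blast
  have "matrix_inv A = B ** A ** matrix_inv A" by (simp add: assms)
  also have "\<dots> = B" by (simp add: i matrix_mul_assoc[symmetric])
  finally show ?thesis .
qed

context
  fixes G :: "complex^'n::finite^'n"
  assumes G: "invertible G"
begin

lemma inverse_mult: "matrix_inv G ** G = mat 1" "G ** matrix_inv G = mat 1"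
  proof -
  obtain B where "G ** B = mat 1" "B ** G = mat 1" using G by (auto simp: invertible_def)
  thus "matrix_inv G ** G = mat 1" "G ** matrix_inv G = mat 1" by (simp_all add: matrix_inv_eqI)
qed

lemma inverse_mult_nth:
  "(\<Sum>m\<in>UNIV. matrix_inv G $ i $ m * G $ m $ j) = (if i = j then 1 else 0)"
  "(\<Sum>m\<in>UNIV. G $ i $ m * matrix_inv G $ m $ j) = (if i = j then 1 else 0)"
  using inverse_mult by (simp_all add: vec_eq_iff matrix_mult_nth mat_def)

lemma tensor_G_inv: "matrix_inv (tensor G (mat 1)) = tensor (matrix_inv G) (mat 1)"
  by (rule matrix_inv_eqI) (simp_all add: tensor_mat_one_mult inverse_mult tensor_one_mat)

lemma Q_mat_nth: "Q_mat G $ a $ b = G $ fst a $ snd a * matrix_inv G $ snd b $ fst b"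
proof -
  have *: "(\<Sum>i\<in>UNIV. G $ fst a $ i * (if i = snd a \<and> m = snd b then 1 else 0))
    = (if m = snd b then G $ fst a $ snd a else 0)" for m
    by (cases "m = snd b") (simp_all add: if_distrib[of "\<lambda>x. _ * x"] cong: if_cong)
  show ?thesis
    unfolding Q_mat_def tensor_G_inv tensor_mat_one_mult_nth Pt_mat_nth fst_conv snd_conv *
    by (simp add: if_distrib[of "\<lambda>x. x * _"] cong: if_cong)
qed

context
  fixes \<epsilon> :: complex
  assumes \<epsilon>: "\<epsilon> = 1 \<or> \<epsilon> = - 1" and sym: "transpose G = mat \<epsilon> ** G"
begin

lemma G_sym: "G $ i $ j = \<epsilon> * G $ j $ i"
proof -
  have "transpose G $ j $ i = (mat \<epsilon> ** G) $ j $ i" by (simp only: sym)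
  thus ?thesis by (simp only: transpose_def vec_lambda_beta scalar_mult_nth)
qed

lemma inv_sym: "matrix_inv G $ i $ j = \<epsilon> * matrix_inv G $ j $ i"
proof -
  let ?H = "matrix_inv G" and ?B = "\<chi> i j. \<epsilon> * matrix_inv G $ j $ i"
  have "(\<Sum>k\<in>UNIV. G $ i $ k * (\<epsilon> * ?H $ j $ k)) = (\<Sum>k\<in>UNIV. ?H $ j $ k * G $ k $ i)" for i j
    by (intro sum.cong refl) (subst (2) G_sym, simp)
  moreover have "(\<Sum>k\<in>UNIV. \<epsilon> * ?H $ k $ i * G $ k $ j) = (\<Sum>k\<in>UNIV. G $ j $ k * ?H $ k $ i)" for i j
    by (intro sum.cong refl) (subst (2) G_sym, simp)
  ultimately have "matrix_inv G = ?B"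
    by (intro matrix_inv_eqI) (auto simp: vec_eq_iff matrix_mult_nth inverse_mult_nth, auto simp: mat_def)
  hence "?H $ i $ j = ?B $ i $ j" by (rule arg_cong)
  thus ?thesis by (simp only: vec_lambda_beta)
qed

text \<open>
  Here and in \<open>Q_Q\<close> the entries \<open>Q\<^sub>(\<^sub>i\<^sub>k\<^sub>)\<^sub>,\<^sub>(\<^sub>j\<^sub>l\<^sub>) = g\<^sub>i\<^sub>k h\<^sub>l\<^sub>j\<close> with \<open>h = g\<inverse>\<close> show everything:
  the flip transposes \<open>g\<close> or \<open>h\<close>, which costs the sign \<open>\<epsilon>\<close>, and the square of \<open>Q\<close> contains the
  factor \<open>tr (h g) = N\<close>.
\<close>

lemma P_Q: "P_mat ** Q_mat G = mat \<epsilon> ** Q_mat G" and Q_P: "Q_mat G ** P_mat = mat \<epsilon> ** Q_mat G"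
proof -
  show "P_mat ** Q_mat G = mat \<epsilon> ** Q_mat G"
    unfolding vec_eq_iff P_mult_nth scalar_mult_nth Q_mat_nth fst_swap snd_swap
    by (intro allI, subst G_sym, simp)
  show "Q_mat G ** P_mat = mat \<epsilon> ** Q_mat G"
    unfolding vec_eq_iff P_mult_nth scalar_mult_nth Q_mat_nth fst_swap snd_swap
    by (intro allI, subst inv_sym, simp)
qed

lemma Q_Q: "Q_mat G ** Q_mat G = mat (of_nat CARD('n)) ** Q_mat G"
proof -
  have "(\<Sum>i\<in>UNIV. \<Sum>j\<in>UNIV. matrix_inv G $ j $ i * G $ i $ j) = of_nat CARD('n)"
    by (subst sum.swap) (simp add: inverse_mult_nth)
  moreover have "(Q_mat G ** Q_mat G) $ a $ b =
      (\<Sum>i\<in>UNIV. \<Sum>j\<in>UNIV. matrix_inv G $ j $ i * G $ i $ j) * (G $ fst a $ snd a * matrix_inv G $ snd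
        b $ fst b)" for a b
    unfolding matrix_mult_nth Q_mat_nth sum_prod_UNIV sum_distrib_right fst_conv snd_conv
    by (intro sum.cong refl) (simp only: mult_ac)
  ultimately show ?thesis
    by (simp add: vec_eq_iff scalar_mult_nth Q_mat_nth)
qed

end

end

lemma scalar_series_central: "central (scalar_series c :: 'x free laurent2)"
  unfolding scalar_series_eq
  by (intro fls_map_central) (auto simp: fls_map_embedding fconst.zero
    ring_embedding.zero[OF fls_map_embedding] fconst_embedding central_def fconst_commute)

lemma mat_central:
  "central c \<Longrightarrow> ring_1.central (**) (mat c :: 'a::ring_1^'n::finite^'n)"
  by (simp add: ring_1.central_def[OF matrix_ring_1] central_def vec_eq_iff scalar_mult_nth)

definition fls_const2 :: "'a::zero \<Rightarrow> 'a laurent2" where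
  "fls_const2 c = fls_const (fls_const c)"

lemma fls_const_embedding: "ring_embedding (fls_const :: 'a::ring_1 \<Rightarrow> _)"
  by standard (auto simp: fls_plus_const)

interpretation fls_const2: ring_embedding fls_const2
  unfolding fls_const2_def by (intro ring_embedding_comp[OF fls_const_embedding fls_const_embedding])

lemma scalar_series_lconst: "scalar_series (lconst c) = fls_const2 (fconst c)"
  unfolding scalar_series_eq lconst_def fls_const2_def
  by (simp add: fls_map_const fconst.zero ring_embedding.zero[OF fls_map_embedding] fconst_embedding)

lemma scalar_series_u: "scalar_series u_var = fls_X_inv" and scalar_series_v: "scalar_series v_var
  = fls_const fls_X_inv"
  unfolding scalar_series_eq u_var_def v_var_def
  by (simp_all add: fls_map_const fls_map_X_inv fconst.zero fconst.one
    ring_embedding.zero[OF fls_map_embedding] ring_embedding.one[OF fls_map_embedding] fconst_embedding)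

lemma map_fls_const2_over:
  assumes "0 \<in> K" "M \<in> mat_over K"
  shows "map_matrix fls_const2 M \<in> mat_over (fls_over (fls_over K))"
  using assms by (auto simp: mat_over_def fls_over_def map_matrix_nth fls_const2_def)

text \<open>
  The identity \<open>w (w - \<kappa>) R(w) = w (w - \<kappa>) - (w - \<kappa>) P + w Q\<close> takes place in the field of complex
  Laurent series and is transported entrywise to the free algebra.
\<close>

lemma R_free_cleared:
  fixes w :: "complex laurent2" and G :: "complex^'n::finite^'n"
  assumes w: "w \<noteq> 0" "w - lconst \<kappa> \<noteq> 0"
  shows "mat (scalar_series (w * (w - lconst \<kappa>))) ** R_free G \<kappa> w =
    mat (scalar_series (w * (w - lconst \<kappa>))) - mat (scalar_series (w - lconst \<kappa>)) ** map_matrix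
      (\<lambda>c. scalar_series (lconst c)) P_mat
    + mat (scalar_series w) ** map_matrix (\<lambda>c. scalar_series (lconst c)) (Q_mat G)"
proof -
  let ?q = "\<lambda>a b. lconst (Q_mat G $ a $ b)" and ?p = "\<lambda>a b. lconst (P_mat $ a $ b :: complex)"
  have *: "w * (w - lconst \<kappa>) * (mat 1 $ a $ b - ?p a b / w + ?q a b / (w - lconst \<kappa>))
      = w * (w - lconst \<kappa>) * mat 1 $ a $ b - (w - lconst \<kappa>) * ?p a b + w * ?q a b" for a b :: "'n \<times> 'n"
    using w by (simp add: field_simps)
  have 1: "(mat c :: 'n sfree laurent2^('n\<times>'n)^('n\<times>'n)) $ a $ b = c * scalar_series (mat 1 $ a $ b)" for c a b
    by (simp add: mat_def scalar_series.one scalar_series.zero)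
  show ?thesis
    unfolding vec_eq_iff vector_minus_component vector_add_component scalar_mult_nth map_matrix_nth R_free_def 1
      scalar_series.mult[symmetric] scalar_series.diff[symmetric] scalar_series.add[symmetric]
    unfolding R_mat_def vec_lambda_beta * by (rule allI refl)+
qed

lemma var_nonzero:
  "u_var - v_var \<noteq> 0" "u_var + v_var \<noteq> 0" "u_var - v_var - lconst \<kappa> \<noteq> 0" "u_var + v_var - lconst \<kappa> \<noteq> 0"
  "u_var + u_var \<noteq> 0" "v_var + v_var \<noteq> 0"
proof -
  have u: "fls_nth u_var (-1) = 1" "fls_nth v_var (-1) = 0" "fls_nth (lconst \<kappa>) (-1) = 0"
    by (simp_all add: u_var_def v_var_def lconst_def)
  have v: "fls_nth (fls_nth v_var 0) (-1) = 1"
    by (simp_all add: u_var_def v_var_def lconst_def)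
  have ne: "f \<noteq> 0" if "fls_nth f (-1) \<noteq> 0" for f :: "complex laurent2" using that by auto
  show "u_var - v_var \<noteq> 0" "u_var + v_var \<noteq> 0" "u_var - v_var - lconst \<kappa> \<noteq> 0" "u_var + v_var - lconst \<kappa> \<noteq>
    0" "u_var + u_var \<noteq> 0"
    by (intro ne, simp add: u)+
  have "fls_nth (fls_nth (v_var + v_var) 0) (-1) \<noteq> 0" by (simp add: v)
  thus "v_var + v_var \<noteq> 0" by auto
qed

lemma fls_X_inv_mult_nth:
  "fls_nth (fls_X_inv * f) n = fls_nth f (n + 1)" "fls_nth (f * fls_X_inv) n = fls_nth
    (f :: 'a::ring_1 fls) (n + 1)"
  by (simp_all add: fls_X_inv_times_conv_shift)

section \<open>The reflection equation for the free generators\<close>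

text \<open>
  Coefficients of \<open>S(u)\<close> with all integral exponents, to match those of Laurent series.
\<close>

definition s_coeff_int :: "'n \<Rightarrow> 'n \<Rightarrow> int \<Rightarrow> 'n sfree" where
  "s_coeff_int i j m = (if m < 0 then 0 else s_coeff i j (nat m))"

lemma in_u_nth: "fls_nth (map_matrix in_u S_series $ i $ j) m = fls_const (s_coeff_int i j m)"
  by (simp add: map_matrix_nth in_u_def S_series_def s_coeff_int_def)

lemma in_v_nth: "map_matrix in_v S_series $ i $ j = fls_const (fps_to_fls (S_series $ i $ j))"
  "fls_nth (fps_to_fls (S_series $ i $ j)) m = s_coeff_int i j m"
  by (simp_all add: map_matrix_nth in_v_def S_series_def s_coeff_int_def)

text \<open>
  Modulo \<open>K\<close> the generators are those of a Cayley series: \<open>s\<^sup>(\<^sup>1\<^sup>) = 2 X\<close> and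
  \<open>s\<^sup>(\<^sup>r\<^sup>+\<^sup>1\<^sup>) = X s\<^sup>(\<^sup>r\<^sup>) = s\<^sup>(\<^sup>r\<^sup>) X\<close>. The consequence needed is \<open>(u - X) S(u) = u + X\<close>, stated
  without the inverse of \<open>u - X\<close>.
\<close>

context
  fixes K :: "'n::finite sfree set" and X :: "'n sfree^'n^'n"
  assumes K: "two_sided_ideal K"
    and X: "X $ i $ j = fconst (1/2) * fgen (1, i, j)"
    and pow1: "r \<ge> 1 \<Longrightarrow> s_coeff i j (Suc r) - (\<Sum>m\<in>UNIV. X $ i $ m * s_coeff m j r) \<in> K"
    and pow2: "r \<ge> 1 \<Longrightarrow> s_coeff i j (Suc r) - (\<Sum>m\<in>UNIV. s_coeff i m r * X $ m $ j) \<in> K"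
begin

lemma X_double: "X $ i $ j + X $ i $ j = s_coeff i j 1"
proof -
  have "X $ i $ j + X $ i $ j = fconst (1/2 + 1/2) * fgen (1, i, j)"
    unfolding X fconst.add distrib_right ..
  also have "\<dots> = fgen (1, i, j)" by (simp add: fconst.one)
  finally show ?thesis by (simp add: s_coeff_def)
qed

text \<open>
  This is the coefficient of \<open>u\<^sup>-\<^sup>m\<close> in \<open>(u - X) S(u) = u + X\<close>. For \<open>m = 0\<close> it reads
  \<open>2 X - X - X = 0\<close>, which is where the factor \<open>2\<close> in \<open>s\<^sup>(\<^sup>1\<^sup>) = 2 X\<close> is needed.
\<close>

lemma s_coeff_int_recursion:
  "s_coeff_int i j (m + 1) - (\<Sum>t\<in>UNIV. X $ i $ t * s_coeff_int t j m)
     - ((if m = -1 then mat 1 $ i $ j else 0) + (if m = 0 then X $ i $ j else 0)) \<in> K" (is ?A)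
  "s_coeff_int i j (m + 1) - (\<Sum>t\<in>UNIV. s_coeff_int i t m * X $ t $ j)
     - ((if m = -1 then mat 1 $ i $ j else 0) + (if m = 0 then X $ i $ j else 0)) \<in> K" (is ?B)
proof -
  consider "m < -1" | "m = -1" | "m = 0" | "m \<ge> 1" by linarith
  hence "?A \<and> ?B"
  proof cases
    case 1
    thus ?thesis by (simp add: s_coeff_int_def two_sided_ideal_0[OF K])
  next
    case 2
    thus ?thesis by (simp add: s_coeff_int_def s_coeff_def mat_def two_sided_ideal_0[OF K])
  next
    case 3
    moreover have "fgen (Suc 0, i, j) = X $ i $ j + X $ i $ j"
      using X_double[of i j] by (simp add: s_coeff_def)
    ultimately show ?thesis
      by (simp add: s_coeff_int_def)
        (simp add: s_coeff_def two_sided_ideal_0[OF K] if_distrib[of "\<lambda>x. x * _"]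
          if_distrib[of "\<lambda>x. _ * x"] cong: if_cong)
  next
    case 4
    hence "nat (m + 1) = Suc (nat m)" "nat m \<ge> 1" by auto
    thus ?thesis using 4 pow1[of "nat m" i j] pow2[of "nat m" i j] by (simp add: s_coeff_int_def)
  qed
  thus ?A ?B by auto
qed

lemma if_zero_in: "p \<in> K \<Longrightarrow> (if P then p else 0) \<in> K"
  by (simp add: two_sided_ideal_0[OF K])

lemma cayley_in_u:
  "(mat fls_X_inv - map_matrix fls_const2 X) ** map_matrix in_u S_series - (mat fls_X_inv + map_matrix
    fls_const2 X) \<in> mat_over (fls_over (fls_over K))"
  "map_matrix in_u S_series ** (mat fls_X_inv - map_matrix fls_const2 X) - (mat fls_X_inv + map_matrix
    fls_const2 X) \<in> mat_over (fls_over (fls_over K))"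
proof -
  have m: "fls_nth (fls_nth (mat fls_X_inv $ i $ j :: 'n sfree laurent2) p) n = (if n = 0 then if p = - 1
    then mat 1 $ i $ j else 0 else 0)"
   for i j p n by (simp add: mat_def)
  have "fls_nth (fls_nth (((mat fls_X_inv - map_matrix fls_const2 X) ** map_matrix in_u S_series
    - (mat fls_X_inv + map_matrix fls_const2 X)) $ i $ j) p) n
     = (if n = 0 then s_coeff_int i j (p + 1) - (\<Sum>t\<in>UNIV. X $ i $ t * s_coeff_int t j p)
     - ((if p = -1 then mat 1 $ i $ j else 0) + (if p = 0 then X $ i $ j else 0)) else 0)" for i j p n
    unfolding matrix_diff_mult vector_minus_component vector_add_component scalar_mult_nth
    unfolding matrix_mult_nth fls_minus_nth fls_plus_nth m fls_nth_sum map_matrix_nth[of fls_const2]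
      fls_const2_def fls_X_inv_mult_nth fls_mult_const_nth in_u_nth
    by (simp add: fls_nth_sum)
  thus "(mat fls_X_inv - map_matrix fls_const2 X) ** map_matrix in_u S_series
    - (mat fls_X_inv + map_matrix fls_const2 X) \<in> mat_over (fls_over (fls_over K))"
    unfolding mat_over_def fls_over_def mem_Collect_eq
    by (intro allI) (simp only:, rule if_zero_in[OF s_coeff_int_recursion(1)])
  have "fls_nth (fls_nth ((map_matrix in_u S_series ** (mat fls_X_inv - map_matrix fls_const2 X)
    - (mat fls_X_inv + map_matrix fls_const2 X)) $ i $ j) p) n
     = (if n = 0 then s_coeff_int i j (p + 1) - (\<Sum>t\<in>UNIV. s_coeff_int i t p * X $ t $ j)
     - ((if p = -1 then mat 1 $ i $ j else 0) + (if p = 0 then X $ i $ j else 0)) else 0)" for i j p n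
    unfolding matrix_diff_mult vector_minus_component vector_add_component scalar_mult_nth
    unfolding matrix_mult_nth fls_minus_nth fls_plus_nth m fls_nth_sum map_matrix_nth[of fls_const2]
      fls_const2_def fls_X_inv_mult_nth fls_mult_const_nth in_u_nth
    by (simp add: fls_nth_sum)
  thus "map_matrix in_u S_series ** (mat fls_X_inv - map_matrix fls_const2 X)
    - (mat fls_X_inv + map_matrix fls_const2 X) \<in> mat_over (fls_over (fls_over K))"
    unfolding mat_over_def fls_over_def mem_Collect_eq
    by (intro allI) (simp only:, rule if_zero_in[OF s_coeff_int_recursion(2)])
qed

lemma cayley_in_v:
  "(mat (fls_const fls_X_inv) - map_matrix fls_const2 X) ** map_matrix in_v S_series
    - (mat (fls_const fls_X_inv) + map_matrix fls_const2 X) \<in> mat_over (fls_over (fls_over K))"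
  "map_matrix in_v S_series ** (mat (fls_const fls_X_inv) - map_matrix fls_const2 X)
    - (mat (fls_const fls_X_inv) + map_matrix fls_const2 X) \<in> mat_over (fls_over (fls_over K))"
proof -
  have m: "fls_nth (fls_nth (mat (fls_const fls_X_inv) $ i $ j :: 'n sfree laurent2) p) n
    = (if p = 0 then if n = - 1 then mat 1 $ i $ j else 0 else 0)"
   for i j p n by (simp add: mat_def)
  have "fls_nth (fls_nth (((mat (fls_const fls_X_inv) - map_matrix fls_const2 X) ** map_matrix in_v
    S_series - (mat (fls_const fls_X_inv) + map_matrix fls_const2 X)) $ i $ j) p) n
     = (if p = 0 then s_coeff_int i j (n + 1) - (\<Sum>t\<in>UNIV. X $ i $ t * s_coeff_int t j n)
     - ((if n = -1 then mat 1 $ i $ j else 0) + (if n = 0 then X $ i $ j else 0)) else 0)" for i j p n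
    unfolding matrix_diff_mult vector_minus_component vector_add_component scalar_mult_nth
    unfolding matrix_mult_nth fls_minus_nth fls_plus_nth m fls_nth_sum map_matrix_nth[of fls_const2]
      fls_const2_def in_v_nth(1) fls_const_mult_const
    by (simp add: fls_nth_sum in_v_nth(2) fls_X_inv_mult_nth fls_mult_const_nth del: fps_to_fls_nth)
  thus "(mat (fls_const fls_X_inv) - map_matrix fls_const2 X) ** map_matrix in_v S_series
    - (mat (fls_const fls_X_inv) + map_matrix fls_const2 X) \<in> mat_over (fls_over (fls_over K))"
    unfolding mat_over_def fls_over_def mem_Collect_eq
    by (intro allI) (simp only:, rule if_zero_in[OF s_coeff_int_recursion(1)])
  have "fls_nth (fls_nth ((map_matrix in_v S_series ** (mat (fls_const fls_X_inv) - map_matrix fls_const2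
    X) - (mat (fls_const fls_X_inv) + map_matrix fls_const2 X)) $ i $ j) p) n
     = (if p = 0 then s_coeff_int i j (n + 1) - (\<Sum>t\<in>UNIV. s_coeff_int i t n * X $ t $ j)
     - ((if n = -1 then mat 1 $ i $ j else 0) + (if n = 0 then X $ i $ j else 0)) else 0)" for i j p n
    unfolding matrix_diff_mult vector_minus_component vector_add_component scalar_mult_nth
    unfolding matrix_mult_nth fls_minus_nth fls_plus_nth m fls_nth_sum map_matrix_nth[of fls_const2]
      fls_const2_def in_v_nth(1) fls_const_mult_const
    by (simp add: fls_nth_sum in_v_nth(2) fls_X_inv_mult_nth fls_mult_const_nth del: fps_to_fls_nth)
  thus "map_matrix in_v S_series ** (mat (fls_const fls_X_inv) - map_matrix fls_const2 X)
    - (mat (fls_const fls_X_inv) + map_matrix fls_const2 X) \<in> mat_over (fls_over (fls_over K))"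
    unfolding mat_over_def fls_over_def mem_Collect_eq
    by (intro allI) (simp only:, rule if_zero_in[OF s_coeff_int_recursion(2)])
qed

text \<open>
  The abstract reflection equation is applied with the ring of matrices over Laurent series and
  the ideal of matrices whose coefficients lie in \<open>K\<close>. The three relations between \<open>s\<close>, \<open>e\<close> and
  \<open>y\<close> involve only constant series, hence they are hypotheses on matrices over the free algebra
  itself.
\<close>

lemma reflection_defect_over:
  fixes G :: "complex^'n^'n"
  defines "s0 \<equiv> map_matrix fconst P_mat" and "e0 \<equiv> map_matrix fconst (Q_mat G)" and "y0 \<equiv> tensor (mat 1) X"
  assumes G: "invertible G" and \<epsilon>: "\<epsilon> = 1 \<or> \<epsilon> = - 1" and sym: "transpose G = mat \<epsilon> ** G"
    and \<kappa>: "\<kappa> = of_nat CARD('n) / 2 - \<epsilon>"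
    and H: "s0 ** y0 ** s0 ** y0 - y0 ** (s0 ** y0 ** s0) - ((s0 - e0) ** y0 - y0 ** (s0 - e0)) \<in> mat_over K"
    and E: "e0 ** (s0 ** y0 ** s0 + y0 + mat (fconst (of_nat CARD('n) / 2))) \<in> mat_over K"
    and E': "(s0 ** y0 ** s0 + y0 + mat (fconst (of_nat CARD('n) / 2))) ** e0 \<in> mat_over K"
  shows "reflection_defect G \<kappa> \<in> mat_over (fls_over (fls_over K))"
proof -
  let ?C = "\<lambda>c. mat (scalar_series c) :: 'n sfree laurent2^('n \<times> 'n)^('n \<times> 'n)"
  let ?c = "\<lambda>M. map_matrix fls_const2 M :: 'n sfree laurent2^('n \<times> 'n)^('n \<times> 'n)"
  let ?k = "?C (lconst \<kappa>)" and ?g = "?C (lconst \<epsilon>)" and ?s = "?c s0" and ?e = "?c e0" and ?y = "?c y0"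
  let ?\<alpha> = "tensor (mat 1) (map_matrix in_u S_series)" and ?\<beta> = "tensor (mat 1) (map_matrix in_v S_series)"
  have J: "ring_1.two_sided_ideal (**) (+) 0 (mat_over (fls_over (fls_over K)) ::
    ('n sfree laurent2^('n \<times> 'n)^('n \<times> 'n)) set)"
    by (intro two_sided_ideal_mat_over two_sided_ideal_fls_over K)
  have C: "ring_1.central (**) (?C c)" for c
    by (intro mat_central scalar_series_central)
  have C_mult: "?C x ** ?C y = ?C (x * y)" for x y
    by (simp add: vec_eq_iff scalar_mult_nth scalar_series.mult) (simp add: mat_def)
  have C_add: "?C x + ?C y = ?C (x + y)" and C_diff: "?C x - ?C y = ?C (x - y)" for x y
    by (auto simp: vec_eq_iff mat_def scalar_series.add scalar_series.diff)
  have C_1: "?C 1 = mat 1" by (simp add: scalar_series.one)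
  have inv: "?C (inverse x) ** ?C x = mat 1" if "x \<noteq> 0" for x
    unfolding C_mult using that by (simp add: scalar_series.one)
  have s: "?s = map_matrix (\<lambda>c. scalar_series (lconst c)) P_mat" and e: "?e = map_matrix
    (\<lambda>c. scalar_series (lconst c)) (Q_mat G)"
    unfolding s0_def e0_def by (simp_all add: vec_eq_iff map_matrix_nth scalar_series_lconst)
  interpret l: ring_embedding "\<lambda>c. scalar_series (lconst c) :: 'n sfree laurent2"
    unfolding scalar_series_lconst by (rule ring_embedding_comp[OF fconst_embedding
      fls_const2.ring_embedding_axioms])
  have PQ: "?s ** ?s = mat 1" "?s ** ?e = ?g ** ?e" "?e ** ?s = ?g ** ?e" "?g ** ?g = mat 1"
    "?e ** ?e = (?k + ?k + ?g + ?g) ** ?e"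
  proof -
    show "?s ** ?s = mat 1" unfolding s l.map_matrix_mult[symmetric] P_P l.map_matrix_mat l.one ..
    show "?s ** ?e = ?g ** ?e" "?e ** ?s = ?g ** ?e"
      unfolding s e l.map_matrix_mult[symmetric] P_Q[OF G \<epsilon> sym] Q_P[OF G \<epsilon> sym] unfolding
        l.map_matrix_mult l.map_matrix_mat by (rule refl)+
    have "lconst \<epsilon> * lconst \<epsilon> = 1" using \<epsilon> by (auto simp: lconst_def)
    thus "?g ** ?g = mat 1" by (simp only: C_mult C_1)
    have "mat (scalar_series (lconst (of_nat CARD('n)))) = ?k + ?k + ?g + ?g"
      unfolding C_add by (simp add: lconst_def \<kappa> fls_plus_const)
    thus "?e ** ?e = (?k + ?k + ?g + ?g) ** ?e"
      unfolding e l.map_matrix_mult[symmetric] Q_Q[OF G \<epsilon> sym] unfolding l.map_matrix_mult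
        l.map_matrix_mat by simp
  qed
  have kg: "?k + ?g = ?c (mat (fconst (of_nat CARD('n) / 2)))"
    unfolding C_add fls_const2.map_matrix_mat scalar_series_lconst[symmetric]
    by (simp add: lconst_def \<kappa> fls_plus_const)
  note over = map_fls_const2_over[OF two_sided_ideal_0[OF K]]
  note c_hom = fls_const2.map_matrix_mult fls_const2.map_matrix_add fls_const2.map_matrix_diff
  have H: "?s ** ?y ** ?s ** ?y - ?y ** (?s ** ?y ** ?s) - ((?s - ?e) ** ?y - ?y ** (?s - ?e)) \<in> mat_over
    (fls_over (fls_over K))"
    using over[OF H] by (simp only: c_hom)
  have E: "?e ** (?s ** ?y ** ?s + ?y + ?k + ?g) \<in> mat_over (fls_over (fls_over K))"
    using over[OF E] by (simp only: c_hom kg add.assoc)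
  have E': "(?s ** ?y ** ?s + ?y + ?k + ?g) ** ?e \<in> mat_over (fls_over (fls_over K))"
    using over[OF E'] by (simp only: c_hom kg add.assoc)
  have y: "?y = tensor (mat 1) (map_matrix fls_const2 X)"
    by (simp add: y0_def vec_eq_iff map_matrix_nth tensor_one_nth fls_const2.zero)
  have \<alpha>: "(?C u_var - ?y) ** ?\<alpha> - (?C u_var + ?y) \<in> mat_over (fls_over (fls_over K))"
    "?\<alpha> ** (?C u_var - ?y) - (?C u_var + ?y) \<in> mat_over (fls_over (fls_over K))"
    and \<beta>: "(?C v_var - ?y) ** ?\<beta> - (?C v_var + ?y) \<in> mat_over (fls_over (fls_over K))"
      "?\<beta> ** (?C v_var - ?y) - (?C v_var + ?y) \<in> mat_over (fls_over (fls_over K))"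
    unfolding y scalar_series_u scalar_series_v
    unfolding tensor_one_mat[where 'a = "'n sfree laurent2", symmetric] tensor_one_diff[symmetric]
      tensor_one_add[symmetric] tensor_one_mult
    by (intro tensor_one_over cayley_in_u cayley_in_v
      two_sided_ideal_0[OF two_sided_ideal_fls_over[OF two_sided_ideal_fls_over[OF K]]])+
  let ?a = "u_var - v_var" and ?b = "u_var + v_var"
  have R: "?C (w * (w - lconst \<kappa>)) ** R_free G \<kappa> w = ?C w ** (?C w - ?k) - (?C w - ?k) ** ?s + ?C w ** ?e"
    if "w \<noteq> 0" "w - lconst \<kappa> \<noteq> 0" for w
    unfolding C_diff C_mult R_free_cleared[OF that] s e ..
  have ne: "?a * (?a - lconst \<kappa>) \<noteq> 0" "?b * (?b - lconst \<kappa>) \<noteq> 0" by (simp_all only: mult_eq_0_iff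
    var_nonzero simp_thms)
  have "R_free G \<kappa> ?a ** (?s ** ?\<alpha> ** ?s) ** R_free G \<kappa> ?b ** ?\<beta>
      - ?\<beta> ** R_free G \<kappa> ?b ** (?s ** ?\<alpha> ** ?s) ** R_free G \<kappa> ?a \<in> mat_over (fls_over (fls_over K))"
    by (rule ring_1.reflection_equation_in_ideal[OF matrix_ring_1 J C[of "lconst \<kappa>"] C[of "lconst \<epsilon>"] PQ H E E'
      C[of u_var] C _ C[of v_var] C _ \<alpha> \<beta> C inv[OF ne(1)] _ C inv[OF ne(2)] _],
      unfold C_add C_diff[of u_var v_var], (rule inv var_nonzero R)+)
  moreover have "?s ** ?\<alpha> ** ?s = S1"
    unfolding s S1_def by (rule tensor_mult_one) (simp_all add: l.zero l.one)
  ultimately show ?thesis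
    unfolding reflection_defect_def S2_def by simp
qed

end

text \<open>
  The hypotheses in terms of the entries of \<open>X\<close>: \<open>comm\<close> is the relation
  \<open>[X\<^sub>1, X\<^sub>2] = [P - Q, X\<^sub>2]\<close>, and \<open>inv_left\<close>, \<open>inv_right\<close> express
  \<open>Q (X\<^sub>1 + X\<^sub>2 + N/2) = 0 = (X\<^sub>1 + X\<^sub>2 + N/2) Q\<close>, with the factors \<open>g\<^sub>i\<^sub>k\<close> and \<open>h\<^sub>l\<^sub>j\<close> of the
  entries of \<open>Q\<close> that are common to all summands left out.
\<close>

lemma reflection_defect_over_entries:
  fixes K :: "'n::finite sfree set" and X :: "'n sfree^'n^'n" and G :: "complex^'n^'n"
  defines "g \<equiv> \<lambda>i j. fconst (G $ i $ j)" and "h \<equiv> \<lambda>i j. fconst (matrix_inv G $ i $ j)"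
  assumes K: "two_sided_ideal K"
    and X: "\<And>i j. X $ i $ j = fconst (1/2) * fgen (1, i, j)"
    and pow1: "\<And>r i j. r \<ge> 1 \<Longrightarrow> s_coeff i j (Suc r) - (\<Sum>m\<in>UNIV. X $ i $ m * s_coeff m j r) \<in> K"
    and pow2: "\<And>r i j. r \<ge> 1 \<Longrightarrow> s_coeff i j (Suc r) - (\<Sum>m\<in>UNIV. s_coeff i m r * X $ m $ j) \<in> K"
    and G: "invertible G" and \<epsilon>: "\<epsilon> = 1 \<or> \<epsilon> = - 1" and sym: "transpose G = mat \<epsilon> ** G"
    and \<kappa>: "\<kappa> = of_nat CARD('n) / 2 - \<epsilon>"
    and comm: "\<And>i j k l. X $ i $ j * X $ k $ l - X $ k $ l * X $ i $ j
       - (((if k = j then X $ i $ l else 0) - (\<Sum>m\<in>UNIV. g i k * h m j * X $ m $ l))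
       - ((if i = l then X $ k $ j else 0) - (\<Sum>m\<in>UNIV. X $ k $ m * (g i m * h l j)))) \<in> K"
    and inv_left: "\<And>j l. (\<Sum>m\<in>UNIV. h l m * X $ m $ j) + (\<Sum>m\<in>UNIV. h m j * X $ m $ l)
       + h l j * fconst (of_nat CARD('n) / 2) \<in> K"
    and inv_right: "\<And>i k. (\<Sum>m\<in>UNIV. X $ i $ m * g m k) + (\<Sum>m\<in>UNIV. X $ k $ m * g i m)
       + fconst (of_nat CARD('n) / 2) * g i k \<in> K"
  shows "reflection_defect G \<kappa> \<in> mat_over (fls_over (fls_over K))"
proof (rule reflection_defect_over[OF K X pow1 pow2 G \<epsilon> sym \<kappa>])
  let ?s = "map_matrix fconst P_mat :: 'n sfree^('n\<times>'n)^('n\<times>'n)" and ?e = "map_matrix fconst (Q_mat G) ::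
    'n sfree^('n\<times>'n)^('n\<times>'n)" and ?y = "tensor (mat 1) X"
  have sw: "(?s ** M) $ a $ b = M $ prod.swap a $ b" "(M ** ?s) $ a $ b = M $ a $ prod.swap b" for M ::
    "'n sfree^('n\<times>'n)^('n\<times>'n)" and a b
    by (rule swap_mult_nth, simp_all add: fconst.zero fconst.one)+
  have e: "?e $ a $ b = g (fst a) (snd a) * h (snd b) (fst b)" for a b
    by (simp add: map_matrix_nth Q_mat_nth[OF G] fconst.mult g_def h_def)
  have x: "?s ** ?y ** ?s = tensor X (mat 1)"
    by (rule tensor_mult_one) (simp_all add: fconst.zero fconst.one)
  note K_in = two_sided_ideal_mult_left[OF K] two_sided_ideal_mult_right[OF K]
  show "?s ** ?y ** ?s ** ?y - ?y ** (?s ** ?y ** ?s) - ((?s - ?e) ** ?y - ?y ** (?s - ?e)) \<in> mat_over K"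
    unfolding x mat_over_def mem_Collect_eq
  proof (intro allI)
    fix a b :: "'n \<times> 'n"
    obtain i k j l where ab: "a = (i, k)" "b = (j, l)" by (cases a, cases b)
    have "(tensor X (mat 1) ** ?y - ?y ** tensor X (mat 1) - ((?s - ?e) ** ?y - ?y ** (?s - ?e))) $ a $ b
      = X $ i $ j * X $ k $ l - X $ k $ l * X $ i $ j
       - (((if k = j then X $ i $ l else 0) - (\<Sum>m\<in>UNIV. g i k * h m j * X $ m $ l))
       - ((if i = l then X $ k $ j else 0) - (\<Sum>m\<in>UNIV. X $ k $ m * (g i m * h l j))))"
      unfolding matrix_diff_mult vector_minus_component sw
      unfolding tensor_one_mult_nth e tensor_mat_one_nth ab
      by (simp add: tensor_one_nth if_distrib[of "\<lambda>x. x * _"] if_distrib[of "\<lambda>x. _ * x"] cong: if_cong)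
    thus "(tensor X (mat 1) ** ?y - ?y ** tensor X (mat 1) - ((?s - ?e) ** ?y - ?y ** (?s - ?e))) $ a $ b \<in> K"
      using comm by simp
  qed
  show "?e ** (?s ** ?y ** ?s + ?y + mat (fconst (of_nat CARD('n) / 2))) \<in> mat_over K"
    unfolding x mat_over_def mem_Collect_eq
  proof (intro allI)
    fix a b :: "'n \<times> 'n"
    obtain i k j l where ab: "a = (i, k)" "b = (j, l)" by (cases a, cases b)
    have "(?e ** (tensor X (mat 1) + ?y + mat (fconst (of_nat CARD('n) / 2)))) $ a $ b
      = g i k * ((\<Sum>m\<in>UNIV. h l m * X $ m $ j) + (\<Sum>m\<in>UNIV. h m j * X $ m $ l)
       + h l j * fconst (of_nat CARD('n) / 2))"
      unfolding matrix_add_ldistrib vector_add_component tensor_one_mult_nth tensor_mat_one_mult_nth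
        scalar_mult_nth e ab
      by (simp add: algebra_simps sum_distrib_left)
    thus "(?e ** (tensor X (mat 1) + ?y + mat (fconst (of_nat CARD('n) / 2)))) $ a $ b \<in> K"
      by (simp only: K_in inv_left)
  qed
  show "(?s ** ?y ** ?s + ?y + mat (fconst (of_nat CARD('n) / 2))) ** ?e \<in> mat_over K"
    unfolding x mat_over_def mem_Collect_eq
  proof (intro allI)
    fix a b :: "'n \<times> 'n"
    obtain i k j l where ab: "a = (i, k)" "b = (j, l)" by (cases a, cases b)
    have "((tensor X (mat 1) + ?y + mat (fconst (of_nat CARD('n) / 2))) ** ?e) $ a $ b
      = ((\<Sum>m\<in>UNIV. X $ i $ m * g m k) + (\<Sum>m\<in>UNIV. X $ k $ m * g i m)
       + fconst (of_nat CARD('n) / 2) * g i k) * h l j"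
      unfolding matrix_add_rdistrib vector_add_component tensor_one_mult_nth tensor_mat_one_mult_nth
        scalar_mult_nth e ab
      by (simp add: distrib_right sum_distrib_right mult.assoc)
    thus "((tensor X (mat 1) + ?y + mat (fconst (of_nat CARD('n) / 2))) ** ?e) $ a $ b \<in> K"
      by (simp only: K_in inv_right)
  qed
qed

section \<open>Free algebras and their substitutions\<close>

lemma carrier_free: "carrier (free_alg X) = {p. \<forall>w \<in> Poly_Mapping.keys p. set w \<subseteq> X}"
  by (simp add: free_alg_def)

lemma free_alg_ops:
  "p \<otimes>\<^bsub>free_alg X\<^esub> q = p * q" "p \<oplus>\<^bsub>free_alg X\<^esub> q = p + q" "\<one>\<^bsub>free_alg X\<^esub> = 1" "\<zero>\<^bsub>free_alg X\<^esub> = 0"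
  "c \<odot>\<^bsub>free_alg X\<^esub> p = fconst c * p"
  by (simp_all add: free_alg_def)

lemma subring_free: "subring_set (carrier (free_alg X))"
proof -
  have "p * q \<in> carrier (free_alg X)" if "p \<in> carrier (free_alg X)" "q \<in> carrier (free_alg X)" for p q
    unfolding carrier_free
  proof (intro CollectI ballI)
    fix w assume "w \<in> Poly_Mapping.keys (p * q)"
    then obtain a b where "w = a @ b" "a \<in> Poly_Mapping.keys p" "b \<in> Poly_Mapping.keys q"
      using keys_mult[of p q] unfolding plus_list_def by blast
    thus "set w \<subseteq> X" using that by (auto simp: carrier_free)
  qed
  moreover have "p - q \<in> carrier (free_alg X)" if "p \<in> carrier (free_alg X)" "q \<in> carrier (free_alg X)" for p q
  proof -
    have "w \<in> Poly_Mapping.keys p \<or> w \<in> Poly_Mapping.keys q" if "w \<in> Poly_Mapping.keys (p - q)" for w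
      using that by (auto simp: in_keys_iff lookup_minus)
    thus ?thesis using that unfolding carrier_free by blast
  qed
  moreover have "1 \<in> carrier (free_alg X)"
    by (simp add: carrier_free zero_list_def)
  ultimately show ?thesis unfolding subring_set_def by blast
qed

lemmas free_closed = subring_set_1[OF subring_free] subring_set_0[OF subring_free]
  subring_set_diff[OF subring_free]
  subring_set_mult[OF subring_free] subring_set_uminus[OF subring_free] subring_set_add[OF subring_free]

lemma fconst_closed: "fconst c \<in> carrier (free_alg X)"
  by (simp add: carrier_free fconst_def)

lemma fgen_closed: "x \<in> X \<Longrightarrow> fgen x \<in> carrier (free_alg X)"
  by (simp add: carrier_free fgen_def)

lemma ring_free: "ring (free_alg X)"
proof (intro ringI abelian_groupI monoidI)
  show "\<exists>q\<in>carrier (free_alg X). q \<oplus>\<^bsub>free_alg X\<^esub> p = \<zero>\<^bsub>free_alg X\<^esub>" if "p \<in> carrier (free_alg X)" for p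
    using that by (intro bexI[of _ "- p"]) (auto simp: free_alg_ops free_closed)
qed (auto simp: free_alg_ops free_closed algebra_simps)

lemma minus_free:
  assumes "p \<in> carrier (free_alg X)" "q \<in> carrier (free_alg X)"
  shows "p \<ominus>\<^bsub>free_alg X\<^esub> q = p - q"
proof -
  interpret ring "free_alg X" by (rule ring_free)
  have "\<ominus>\<^bsub>free_alg X\<^esub> q = - q"
    by (rule minus_equality) (auto simp: free_alg_ops assms free_closed)
  thus ?thesis by (simp add: a_minus_def free_alg_ops)
qed

lemma ideal_free_closed:
  assumes I: "ideal I (free_alg X)"
  shows "I \<subseteq> carrier (free_alg X)" "0 \<in> I"
    "p \<in> I \<Longrightarrow> q \<in> I \<Longrightarrow> p + q \<in> I" "p \<in> I \<Longrightarrow> q \<in> I \<Longrightarrow> p - q \<in> I" "p \<in> I \<Longrightarrow> - p \<in> I"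
    "p \<in> I \<Longrightarrow> r \<in> carrier (free_alg X) \<Longrightarrow> r * p \<in> I"
    "p \<in> I \<Longrightarrow> r \<in> carrier (free_alg X) \<Longrightarrow> p * r \<in> I"
proof -
  interpret ideal I "free_alg X" by fact
  show "I \<subseteq> carrier (free_alg X)" using Icarr by auto
  show "0 \<in> I" using additive_subgroup.zero_closed[OF is_additive_subgroup] by (simp add: free_alg_ops)
  show add: "p \<in> I \<Longrightarrow> q \<in> I \<Longrightarrow> p + q \<in> I" for p q using
    additive_subgroup.a_closed[OF is_additive_subgroup, of p q] by (simp add: free_alg_ops)
  show l: "p \<in> I \<Longrightarrow> r \<in> carrier (free_alg X) \<Longrightarrow> r * p \<in> I" for p r using I_l_closed[of p r] by
    (simp add: free_alg_ops)
  show "p \<in> I \<Longrightarrow> r \<in> carrier (free_alg X) \<Longrightarrow> p * r \<in> I" using I_r_closed[of p r] by (simp add: free_alg_ops)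
  show n: "p \<in> I \<Longrightarrow> - p \<in> I" for p using l[of p "- 1"] by (simp add: free_closed)
  show "p \<in> I \<Longrightarrow> q \<in> I \<Longrightarrow> p - q \<in> I" using add[of p "- q"] n[of q] by simp
qed

definition free_subst :: "('x \<Rightarrow> 'y free) \<Rightarrow> 'x free \<Rightarrow> 'y free" where
  "free_subst f p = (\<Sum>w\<in>Poly_Mapping.keys p. fconst (Poly_Mapping.lookup p w) * prod_list (map f w))"

lemma free_subst_single: "free_subst f (Poly_Mapping.single w c) = fconst c * prod_list (map f w)"
  by (simp add: free_subst_def fconst.zero)

lemma free_subst_0: "free_subst f 0 = 0" by (simp add: free_subst_def)

lemma free_subst_add: "free_subst f (p + q) = free_subst f p + free_subst f q"
  unfolding free_subst_def
  by (rule setsum_keys_plus_distrib) (simp_all add: fconst.zero fconst.add distrib_right)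

lemma free_subst_sum: "free_subst f (sum p A) = (\<Sum>a\<in>A. free_subst f (p a))"
  by (induction A rule: infinite_finite_induct) (auto simp: free_subst_0 free_subst_add)

lemma free_subst_mult: "free_subst f (p * q) = free_subst f p * free_subst f q"
proof -
  let ?m = "\<lambda>p w. Poly_Mapping.single w (Poly_Mapping.lookup p w)"
  have 1: "free_subst f (?m p w * ?m q v) = free_subst f (?m p w) * free_subst f (?m q v)" for w v
    by (simp add: mult_single free_subst_single plus_list_def fconst.mult mult.assoc)
       (simp add: mult.assoc[symmetric] fconst_commute[of "prod_list (map f w)"])
  have "free_subst f ((\<Sum>w\<in>Poly_Mapping.keys p. ?m p w) * (\<Sum>w\<in>Poly_Mapping.keys q. ?m q w))
     = free_subst f (\<Sum>w\<in>Poly_Mapping.keys p. ?m p w) * free_subst f (\<Sum>w\<in>Poly_Mapping.keys q. ?m q w)"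
    unfolding sum_distrib_left sum_distrib_right free_subst_sum 1 ..
  thus ?thesis by (simp only: sum_single)
qed

lemma free_subst_fconst: "free_subst f (fconst c) = fconst c"
  unfolding fconst_def[of c] by (subst free_subst_single) (simp add: fconst_def)

lemma free_subst_1: "free_subst f 1 = 1"
  using free_subst_fconst[of f 1] by (simp add: fconst.one)

lemma free_subst_fgen: "free_subst f (fgen x) = f x"
  unfolding fgen_def by (subst free_subst_single) (simp add: fconst.one)

lemma free_subst_uminus: "free_subst f (- p) = - free_subst f p"
  using free_subst_add[of f p "- p"] by (simp add: free_subst_0 eq_neg_iff_add_eq_0 add.commute)

lemma free_subst_diff: "free_subst f (p - q) = free_subst f p - free_subst f q"
  using free_subst_add[of f p "- q"] by (simp add: free_subst_uminus)

lemmas free_subst_hom = free_subst_0 free_subst_1 free_subst_add free_subst_diff free_subst_uminus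
  free_subst_mult free_subst_sum free_subst_fconst free_subst_fgen

lemma free_subst_closed:
  assumes "\<And>x. f x \<in> carrier (free_alg Y)"
  shows "free_subst f p \<in> carrier (free_alg Y)"
proof -
  have "prod_list (map f w) \<in> carrier (free_alg Y)" for w
    by (induction w) (auto simp: free_closed assms)
  thus ?thesis unfolding free_subst_def by (intro sum_in) (auto simp: free_closed fconst_closed)
qed

section \<open>Algebras given by generators and relations\<close>

context
  fixes X :: "'x set" and R :: "'x free set"
  assumes R: "R \<subseteq> carrier (free_alg X)"
begin

abbreviation (input) "pres_ideal \<equiv> Idl\<^bsub>free_alg X\<^esub> R"

definition pres_class :: "'x free \<Rightarrow> 'x free set" where
  "pres_class p = pres_ideal +>\<^bsub>free_alg X\<^esub> p"

lemma ideal_pres_ideal: "ideal pres_ideal (free_alg X)"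
  by (rule ring.genideal_ideal[OF ring_free R])

lemma rels_in_pres_ideal: "r \<in> R \<Longrightarrow> r \<in> pres_ideal"
  using ring.genideal_self[OF ring_free R] by blast

lemma pres_class_eq_iff:
  assumes "p \<in> carrier (free_alg X)" "q \<in> carrier (free_alg X)"
  shows "pres_class p = pres_class q \<longleftrightarrow> p - q \<in> pres_ideal"
  using ring.quotient_eq_iff_same_a_r_cos[OF ring_free ideal_pres_ideal assms]
  by (simp add: pres_class_def minus_free assms)

lemma ring_presented: "ring (presented_alg X R)"
proof -
  interpret Q: ring "free_alg X Quot pres_ideal" by (rule ideal.quotient_is_ring[OF ideal_pres_ideal])
  note defs = presented_alg_def quot_alg_def
  show ?thesis
  proof (intro ringI abelian_groupI monoidI)
    show "\<exists>y\<in>carrier (presented_alg X R). y \<oplus>\<^bsub>presented_alg X R\<^esub> x = \<zero>\<^bsub>presented_alg X R\<^esub>" if "x \<in> carrier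
      (presented_alg X R)" for x
      using that Q.l_neg[of x] Q.a_inv_closed[of x] by (auto simp: defs simp del: Q.a_inv_closed)
  qed (simp_all add: defs Q.a_ac Q.m_assoc Q.l_distr Q.r_distr)
qed

lemma carrier_presented: "carrier (presented_alg X R) = pres_class ` carrier (free_alg X)"
  by (auto simp: presented_alg_def quot_alg_def FactRing_def A_RCOSETS_def' pres_class_def)

lemma pres_class_closed: "p \<in> carrier (free_alg X) \<Longrightarrow> pres_class p \<in> carrier (presented_alg X R)"
  by (simp add: carrier_presented)

lemma pres_class_hom:
  assumes p: "p \<in> carrier (free_alg X)" and q: "q \<in> carrier (free_alg X)"
  shows "pres_class p \<otimes>\<^bsub>presented_alg X R\<^esub> pres_class q = pres_class (p * q)"
    and "pres_class p \<oplus>\<^bsub>presented_alg X R\<^esub> pres_class q = pres_class (p + q)"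
proof -
  interpret ideal pres_ideal "free_alg X" by (rule ideal_pres_ideal)
  show "pres_class p \<otimes>\<^bsub>presented_alg X R\<^esub> pres_class q = pres_class (p * q)"
    using ring_hom_mult[OF rcos_ring_hom p q] by (simp add: presented_alg_def quot_alg_def pres_class_def
      free_alg_ops)
  show "pres_class p \<oplus>\<^bsub>presented_alg X R\<^esub> pres_class q = pres_class (p + q)"
    using ring_hom_add[OF rcos_ring_hom p q] by (simp add: presented_alg_def quot_alg_def pres_class_def
      free_alg_ops)
qed

lemma pres_class_smult:
  assumes p: "p \<in> carrier (free_alg X)"
  shows "c \<odot>\<^bsub>presented_alg X R\<^esub> pres_class p = pres_class (fconst c * p)"
proof -
  interpret ideal pres_ideal "free_alg X" by (rule ideal_pres_ideal)
  have "pres_ideal +>\<^bsub>free_alg X\<^esub> (fconst c * x) = pres_class (fconst c * p)" if x: "x \<in> pres_class p" for x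
  proof -
    obtain i where i: "i \<in> pres_ideal" "x = i + p"
      using x by (auto simp: pres_class_def a_r_coset_def' free_alg_ops)
    have "fconst c * i \<in> pres_ideal" using ideal_free_closed(6)[OF ideal_pres_ideal i(1) fconst_closed] .
    moreover have "i \<in> carrier (free_alg X)" using ideal_free_closed(1)[OF ideal_pres_ideal] i(1) by auto
    moreover have "fconst c * (i + p) - fconst c * p = fconst c * i" by (simp add: distrib_left)
    ultimately have "pres_class (fconst c * (i + p)) = pres_class (fconst c * p)"
      using p by (simp add: pres_class_eq_iff free_closed fconst_closed)
    thus ?thesis by (simp only: i(2) pres_class_def)
  qed
  moreover have "p \<in> pres_class p"
    using a_rcos_self[OF p] by (simp add: pres_class_def)
  ultimately show "c \<odot>\<^bsub>presented_alg X R\<^esub> pres_class p = pres_class (fconst c * p)"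
    by (auto simp: presented_alg_def quot_alg_def free_alg_ops)
qed

lemma pres_class_1: "pres_class 1 = \<one>\<^bsub>presented_alg X R\<^esub>" and pres_class_0: "pres_class 0
  = \<zero>\<^bsub>presented_alg X R\<^esub>"
proof -
  interpret ideal pres_ideal "free_alg X" by (rule ideal_pres_ideal)
  show "pres_class 1 = \<one>\<^bsub>presented_alg X R\<^esub>"
    by (simp add: presented_alg_def quot_alg_def pres_class_def FactRing_def free_alg_ops)
  have "pres_ideal +>\<^bsub>free_alg X\<^esub> 0 = pres_ideal" using a_coset_add_zero[OF a_subset] by
    (simp add: free_alg_ops)
  thus "pres_class 0 = \<zero>\<^bsub>presented_alg X R\<^esub>"
    by (simp add: presented_alg_def quot_alg_def pres_class_def FactRing_def)
qed

lemma pres_class_sum: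
  assumes "finite A" "\<And>a. a \<in> A \<Longrightarrow> p a \<in> carrier (free_alg X)"
  shows "pres_class (sum p A) = (\<Oplus>\<^bsub>presented_alg X R\<^esub>a\<in>A. pres_class (p a))"
proof -
  interpret pres: ring "presented_alg X R" by (rule ring_presented)
  show ?thesis
    using assms
  proof (induction rule: finite_induct)
    case empty
    thus ?case by (simp add: pres_class_0)
  next
    case (insert a A)
    hence "sum p A \<in> carrier (free_alg X)" by (intro sum_in) (auto simp: free_closed)
    hence 1: "pres_class (p a + sum p A) = pres_class (p a) \<oplus>\<^bsub>presented_alg X R\<^esub> pres_class (sum p A)"
      using insert.prems by (intro pres_class_hom(2)[symmetric]) auto
    have IH: "pres_class (sum p A) = (\<Oplus>\<^bsub>presented_alg X R\<^esub>a\<in>A. pres_class (p a))"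
      using insert.prems by (intro insert.IH) auto
    have "(\<Oplus>\<^bsub>presented_alg X R\<^esub>a\<in>insert a A. pres_class (p a)) = pres_class (p a) \<oplus>\<^bsub>presented_alg X R\<^esub>
      (\<Oplus>\<^bsub>presented_alg X R\<^esub>a\<in>A. pres_class (p a))"
      using insert by (intro pres.finsum_insert) (auto simp: pres_class_closed)
    thus ?case unfolding sum.insert[OF insert.hyps] 1 IH by (rule sym)
  qed
qed

text \<open>
  A homomorphism that annihilates the relations annihilates the ideal generated by them. The
  relations are assumed to lie in the free algebra, since otherwise no ideal of it contains them
  and the generated ideal, an intersection over the empty family, would be the whole type.
\<close>

lemma presented_alg_universal:
  assumes A: "ring A" and \<phi>: "\<phi> \<in> alg_hom (free_alg X) A" and "\<And>r. r \<in> R \<Longrightarrow> \<phi> r = \<zero>\<^bsub>A\<^esub>"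
  shows "\<exists>h\<in>alg_hom (presented_alg X R) A. \<forall>p\<in>carrier (free_alg X). h (pres_class p) = \<phi> p"
proof -
  have "\<phi> \<in> ring_hom (free_alg X) A" using \<phi> by (simp add: alg_hom_def)
  then interpret ring_hom_ring "free_alg X" A \<phi>
    by (rule ring_hom_ringI2[OF ring_free A])
  have "R \<subseteq> a_kernel (free_alg X) A \<phi>"
    unfolding a_kernel_def' using assms(3) R by blast
  hence "pres_ideal \<subseteq> a_kernel (free_alg X) A \<phi>"
    by (rule ring.genideal_minimal[OF ring_free kernel_is_ideal])
  hence ker: "\<phi> i = \<zero>\<^bsub>A\<^esub>" if "i \<in> pres_ideal" for i using that unfolding a_kernel_def' by blast
  define h where "h C = (SOME y. \<exists>p\<in>carrier (free_alg X). C = pres_class p \<and> y = \<phi> p)" for C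
  have h: "h (pres_class p) = \<phi> p" if p: "p \<in> carrier (free_alg X)" for p
  proof -
    have "\<exists>q\<in>carrier (free_alg X). pres_class p = pres_class q \<and> h (pres_class p) = \<phi> q"
      unfolding h_def by (rule someI_ex) (use p in blast)
    then obtain q where q: "q \<in> carrier (free_alg X)" "pres_class p = pres_class q" "h (pres_class p) = \<phi>
      q" by blast
    have d: "q - p \<in> pres_ideal" using q p pres_class_eq_iff[of q p] by simp
    have "\<phi> q = \<phi> ((q - p) \<oplus>\<^bsub>free_alg X\<^esub> p)" by (simp add: free_alg_ops)
    also have "\<dots> = \<phi> p" using p q(1) ker[OF d] by (subst hom_add) (auto simp: free_closed)
    finally show ?thesis using q by simp
  qed
  have "h \<in> alg_hom (presented_alg X R) A"
    unfolding alg_hom_def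
  proof (intro CollectI conjI ring_hom_memI ballI allI; (unfold carrier_presented)?)
    fix x c assume "x \<in> pres_class ` carrier (free_alg X)"
    then obtain p where p: "x = pres_class p" "p \<in> carrier (free_alg X)" by auto
    show "h x \<in> carrier A" using p by (simp add: h)
    show "h (c \<odot>\<^bsub>presented_alg X R\<^esub> x) = c \<odot>\<^bsub>A\<^esub> h x"
      using p \<phi> by (simp add: h pres_class_smult free_closed fconst_closed alg_hom_def free_alg_ops)
    fix y assume "y \<in> pres_class ` carrier (free_alg X)"
    then obtain q where q: "y = pres_class q" "q \<in> carrier (free_alg X)" by auto
    show "h (x \<otimes>\<^bsub>presented_alg X R\<^esub> y) = h x \<otimes>\<^bsub>A\<^esub> h y" "h (x \<oplus>\<^bsub>presented_alg X R\<^esub> y) = h x \<oplus>\<^bsub>A\<^esub> h y"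
      using p q hom_mult[of p q] hom_add[of p q] by (simp_all add: h pres_class_hom free_closed free_alg_ops)
  next
    show "h \<one>\<^bsub>presented_alg X R\<^esub> = \<one>\<^bsub>A\<^esub>"
      unfolding pres_class_1[symmetric] using hom_one by (simp add: h free_closed free_alg_ops)
  qed
  thus ?thesis using h by blast
qed

end

section \<open>The Lie algebra and the relations of its enveloping algebra\<close>

lemma mscale_nth: "mscale c x $ i $ j = c * x $ i $ j"
  by (simp add: mscale_def map_matrix_nth)

lemma vector_space_mscale: "Modules.module (mscale :: complex \<Rightarrow> complex^'n::finite^'n \<Rightarrow> _)"
  by standard (simp_all add: vec_eq_iff mscale_nth algebra_simps)

lemma F_elem_nth:
  fixes G :: "complex^'n::finite^'n"
  shows "F_elem G i j $ a $ b = (if a = i \<and> b = j then 1 else 0) - matrix_inv G $ a $ j * G $ i $ b"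
proof -
  have E: "E_unit i j $ a $ b = (if a = i \<and> b = j then 1 else 0)" for i j a b :: 'n
    by (auto simp: E_unit_def axis_def)
  have "(\<Sum>k\<in>UNIV. \<Sum>l\<in>UNIV. mscale (G $ i $ k * matrix_inv G $ l $ j) (E_unit l k)) $ a $ b
    = (\<Sum>k\<in>UNIV. \<Sum>l\<in>UNIV. if l = a then (if k = b then G $ i $ b * matrix_inv G $ a $ j else 0) else 0)"
    unfolding sum_component by (intro sum.cong refl) (auto simp: mscale_nth E)
  thus ?thesis by (simp add: F_elem_def E)
qed

lemma g_lie_F: "F_elem G i j \<in> g_lie G"
  and g_lie_add: "x \<in> g_lie G \<Longrightarrow> y \<in> g_lie G \<Longrightarrow> x + y \<in> g_lie G"
  and g_lie_diff: "x \<in> g_lie G \<Longrightarrow> y \<in> g_lie G \<Longrightarrow> x - y \<in> g_lie G"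
  and g_lie_scale: "x \<in> g_lie G \<Longrightarrow> mscale c x \<in> g_lie G"
  and g_lie_0: "0 \<in> g_lie G"
proof -
  interpret Modules.module "mscale :: complex \<Rightarrow> complex^'n^'n \<Rightarrow> _" by (rule vector_space_mscale)
  show "F_elem G i j \<in> g_lie G" unfolding g_lie_def by (rule span_base) blast
  show "x \<in> g_lie G \<Longrightarrow> y \<in> g_lie G \<Longrightarrow> x + y \<in> g_lie G" unfolding g_lie_def by (rule span_add)
  show "x \<in> g_lie G \<Longrightarrow> y \<in> g_lie G \<Longrightarrow> x - y \<in> g_lie G" unfolding g_lie_def by (rule span_diff)
  show "x \<in> g_lie G \<Longrightarrow> mscale c x \<in> g_lie G" unfolding g_lie_def by (rule span_scale)
  show "0 \<in> g_lie G" unfolding g_lie_def by (rule span_zero)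
qed

lemma g_lie_sum: "(\<And>i. i \<in> A \<Longrightarrow> f i \<in> g_lie G) \<Longrightarrow> sum f A \<in> g_lie G"
  by (rule sum_in) (auto intro: g_lie_0 g_lie_add)

lemma g_lie_induct [consumes 1, case_names zero add scale F]:
  assumes "x \<in> g_lie G" and "P 0" and "\<And>x y. P x \<Longrightarrow> P y \<Longrightarrow> P (x + y)" and "\<And>c x. P x \<Longrightarrow> P (mscale c x)"
    and "\<And>i j. P (F_elem G i j)"
  shows "P x"
proof -
  interpret Modules.module "mscale :: complex \<Rightarrow> complex^'n^'n \<Rightarrow> _" by (rule vector_space_mscale)
  have "subspace {x. P x}" using assms(2-4) by (auto simp: subspace_def)
  thus ?thesis using span_induct[of x "{F_elem G i j | i j. True}" P] assms(1,5) unfolding g_lie_def by blast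
qed

context
  fixes G :: "complex^'n::finite^'n" and \<epsilon> :: complex
  assumes G: "invertible G" and \<epsilon>: "\<epsilon> = 1 \<or> \<epsilon> = - 1" and sym: "transpose G = mat \<epsilon> ** G"
begin

text \<open>
  Entrywise \<open>F\<^sub>i\<^sub>j = E\<^sub>i\<^sub>j - h E\<^sub>j\<^sub>i g\<close> with \<open>h = g\<inverse>\<close>, so the product of two such matrices has
  four terms, collected in \<open>S1\<close>. The sums \<open>S2\<close> and \<open>S3\<close> come from the entries of \<open>[Q, F\<^sub>2]\<close>; their
  second terms are compared with \<open>S1\<close> by means of the symmetry of \<open>g\<close> and \<open>h\<close>.
\<close>

lemma F_elem_bracket:
  "F_elem G i j ** F_elem G k l - F_elem G k l ** F_elem G i j
    = (mscale (if k = j then 1 else 0) (F_elem G i l)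
      - (\<Sum>m\<in>UNIV. mscale (G $ i $ k * matrix_inv G $ m $ j) (F_elem G m l)))
    - (mscale (if i = l then 1 else 0) (F_elem G k j)
      - (\<Sum>m\<in>UNIV. mscale (G $ i $ m * matrix_inv G $ l $ j) (F_elem G k m)))"
proof -
  note inv = inverse_mult_nth[OF G]
  have S1: "(\<Sum>c\<in>UNIV. F_elem G i j $ a $ c * F_elem G k l $ c $ b) =
     (if k = j then (if a = i \<and> b = l then 1 else 0) else 0) - (if a = i then matrix_inv
       G $ j $ l * G $ k $ b else 0)
     - (if b = l then matrix_inv G $ a $ j * G $ i $ k else 0) + (if i = l then matrix_inv
       G $ a $ j * G $ k $ b else 0)" for i j k l a b
  proof -
    have "(\<Sum>c\<in>UNIV. F_elem G i j $ a $ c * F_elem G k l $ c $ b) =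
      (\<Sum>c\<in>UNIV. (if c = j then (if a = i \<and> c = k \<and> b = l then 1 else 0) else 0)
        - (if c = j then (if a = i then matrix_inv G $ c $ l * G $ k $ b else 0) else 0)
        - (if c = k then (if b = l then matrix_inv G $ a $ j * G $ i $ c else 0) else 0)
        + matrix_inv G $ a $ j * G $ k $ b * (G $ i $ c * matrix_inv G $ c $ l))"
      by (intro sum.cong refl) (auto simp: F_elem_nth algebra_simps)
    also have "\<dots> = (if k = j then (if a = i \<and> b = l then 1 else 0) else 0) - (if a = i then matrix_inv
      G $ j $ l * G $ k $ b else 0)
     - (if b = l then matrix_inv G $ a $ j * G $ i $ k else 0) + (if i = l then matrix_inv
       G $ a $ j * G $ k $ b else 0)"
      by (simp add: sum.distrib sum_subtractf inv flip: sum_distrib_left)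
    finally show ?thesis .
  qed
  have S2: "(\<Sum>m\<in>UNIV. G $ i $ k * matrix_inv G $ m $ j * F_elem G m l $ a $ b) =
     (if b = l then G $ i $ k * matrix_inv G $ a $ j else 0)
       - (if b = j then \<epsilon> * (G $ i $ k * matrix_inv G $ a $ l) else 0)" for a b
  proof -
    have "(\<Sum>m\<in>UNIV. matrix_inv G $ m $ j * G $ m $ b) = (\<Sum>m\<in>UNIV. \<epsilon> * (matrix_inv G $ j $ m * G $ m $ b))"
      by (intro sum.cong refl) (subst inv_sym[OF G \<epsilon> sym], simp)
    hence 1: "(\<Sum>m\<in>UNIV. matrix_inv G $ m $ j * G $ m $ b) = (if b = j then \<epsilon> else 0)"
      by (simp add: inv flip: sum_distrib_left)
    have "(\<Sum>m\<in>UNIV. G $ i $ k * matrix_inv G $ m $ j * F_elem G m l $ a $ b) =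
      (\<Sum>m\<in>UNIV. (if m = a then (if b = l then G $ i $ k * matrix_inv G $ m $ j else 0) else 0)
         - G $ i $ k * matrix_inv G $ a $ l * (matrix_inv G $ m $ j * G $ m $ b))"
      by (intro sum.cong refl) (auto simp: F_elem_nth algebra_simps)
    thus ?thesis
      by (simp add: sum_subtractf 1 flip: sum_distrib_left)
  qed
  have S3: "(\<Sum>m\<in>UNIV. G $ i $ m * matrix_inv G $ l $ j * F_elem G k m $ a $ b) =
     (if a = k then G $ i $ b * matrix_inv G $ l $ j else 0)
       - (if a = i then \<epsilon> * (matrix_inv G $ l $ j * G $ k $ b) else 0)" for a b
  proof -
    have "(\<Sum>m\<in>UNIV. G $ i $ m * matrix_inv G $ a $ m) = (\<Sum>m\<in>UNIV. \<epsilon> * (G $ i $ m * matrix_inv G $ m $ a))"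
      by (intro sum.cong refl) (subst inv_sym[OF G \<epsilon> sym], simp)
    hence 1: "(\<Sum>m\<in>UNIV. G $ i $ m * matrix_inv G $ a $ m) = (if a = i then \<epsilon> else 0)"
      by (auto simp: inv simp flip: sum_distrib_left)
    have "(\<Sum>m\<in>UNIV. G $ i $ m * matrix_inv G $ l $ j * F_elem G k m $ a $ b) =
      (\<Sum>m\<in>UNIV. (if m = b then (if a = k then G $ i $ m * matrix_inv G $ l $ j else 0) else 0)
         - matrix_inv G $ l $ j * G $ k $ b * (G $ i $ m * matrix_inv G $ a $ m))"
      by (intro sum.cong refl) (auto simp: F_elem_nth algebra_simps)
    thus ?thesis
      by (simp add: sum_subtractf 1 flip: sum_distrib_left)
  qed
  have if_mult: "(if c then 1 else 0) * x = (if c then x else 0)"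
    and if_diff: "(if c then x - y else 0) = (if c then x else 0) - (if c then y else 0)" for c and x y ::
      complex
    by auto
  have G_H: "G $ k $ i = \<epsilon> * G $ i $ k" "matrix_inv G $ j $ l = \<epsilon> * matrix_inv G $ l $ j"
    by (rule G_sym[OF G \<epsilon> sym] inv_sym[OF G \<epsilon> sym])+
  show ?thesis
    unfolding vec_eq_iff vector_minus_component sum_component matrix_mult_nth mscale_nth S1 S2 S3
    unfolding F_elem_nth if_mult if_diff G_H
    by (simp add: algebra_simps)
qed

text \<open>
  The span of the \<open>F\<^sub>i\<^sub>j\<close> is closed under brackets because the brackets of the \<open>F\<^sub>i\<^sub>j\<close> are
  combinations of the \<open>F\<^sub>i\<^sub>j\<close> and the bracket is bilinear. This is needed for the defining
  relations of the enveloping algebra to be elements of the free algebra.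
\<close>

lemma g_lie_bracket: "x \<in> g_lie G \<Longrightarrow> y \<in> g_lie G \<Longrightarrow> x ** y - y ** x \<in> g_lie G"
proof (induction x rule: g_lie_induct)
  case zero
  thus ?case by (simp add: vec_eq_iff matrix_mult_nth g_lie_0)
next
  case (add x x')
  have "(x + x') ** y - y ** (x + x') = (x ** y - y ** x) + (x' ** y - y ** x')"
    by (simp add: matrix_add_rdistrib matrix_add_ldistrib algebra_simps)
  thus ?case using add g_lie_add by metis
next
  case (scale c x)
  have "mscale c x ** y - y ** mscale c x = mscale c (x ** y - y ** x)"
    by (simp add: vec_eq_iff matrix_mult_nth mscale_nth algebra_simps sum_distrib_left)
  thus ?case using scale g_lie_scale by metis
next
  case (F i j)
  thus ?case
  proof (induction y rule: g_lie_induct)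
    case zero
    thus ?case by (simp add: vec_eq_iff matrix_mult_nth g_lie_0)
  next
    case (add y y')
    have "F_elem G i j ** (y + y') - (y + y') ** F_elem G i j = (F_elem G i j ** y - y ** F_elem G i j)
      + (F_elem G i j ** y' - y' ** F_elem G i j)"
      by (simp add: matrix_add_rdistrib matrix_add_ldistrib algebra_simps)
    thus ?case using add g_lie_add by metis
  next
    case (scale c y)
    have "F_elem G i j ** mscale c y - mscale c y ** F_elem G i j = mscale c
      (F_elem G i j ** y - y ** F_elem G i j)"
      by (simp add: vec_eq_iff matrix_mult_nth mscale_nth algebra_simps sum_distrib_left)
    thus ?case using scale g_lie_scale by metis
  next
    case (F k l)
    show ?case unfolding F_elem_bracket
      by (intro g_lie_diff g_lie_sum g_lie_scale g_lie_F)
  qed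
qed

lemma uea_rels_closed: "uea_rels (g_lie G) \<subseteq> carrier (free_alg (g_lie G))"
  unfolding uea_rels_def
  by (auto intro!: free_closed fgen_closed fconst_closed g_lie_add g_lie_scale g_lie_bracket)

abbreviation (input) "uea_ideal \<equiv> pres_ideal (g_lie G) (uea_rels (g_lie G))"

lemmas uea_ideal_closed = ideal_free_closed[OF ideal_pres_ideal[OF uea_rels_closed]]

lemma
  shows fgen_add: "x \<in> g_lie G \<Longrightarrow> y \<in> g_lie G \<Longrightarrow> fgen (x + y) - (fgen x + fgen y) \<in> uea_ideal"
    and fgen_scale: "x \<in> g_lie G \<Longrightarrow> fgen (mscale c x) - fconst c * fgen x \<in> uea_ideal"
    and fgen_bracket: "x \<in> g_lie G \<Longrightarrow> y \<in> g_lie G \<Longrightarrow> fgen x * fgen y - fgen y * fgen x - fgen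
      (x ** y - y ** x) \<in> uea_ideal"
  by (rule rels_in_pres_ideal[OF uea_rels_closed]; unfold uea_rels_def; blast)+

lemma fgen_0: "fgen (0 :: complex^'n^'n) \<in> uea_ideal"
  using uea_ideal_closed(5)[OF fgen_add[OF g_lie_0 g_lie_0]] by simp

lemma fgen_sum:
  assumes "\<And>a. a \<in> A \<Longrightarrow> x a \<in> g_lie G"
  shows "fgen (\<Sum>a\<in>A. mscale (c a) (x a)) - (\<Sum>a\<in>A. fconst (c a) * fgen (x a)) \<in> uea_ideal"
  using assms
proof (induction A rule: infinite_finite_induct)
  case (insert a A)
  let ?s = "\<Sum>a\<in>A. mscale (c a) (x a)" and ?t = "\<Sum>a\<in>A. fconst (c a) * fgen (x a)"
  have "fgen (mscale (c a) (x a) + ?s) - (fconst (c a) * fgen (x a) + ?t)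
    = (fgen (mscale (c a) (x a) + ?s) - (fgen (mscale (c a) (x a)) + fgen ?s))
    + (fgen (mscale (c a) (x a)) - fconst (c a) * fgen (x a)) + (fgen ?s - ?t)"
    by simp
  also have "\<dots> \<in> uea_ideal"
    using insert by (intro uea_ideal_closed(3) fgen_add fgen_scale g_lie_sum g_lie_scale insert.IH) auto
  finally show ?case using insert by simp
qed (simp_all add: fgen_0)

lemma fgen_diff:
  assumes "x \<in> g_lie G" "y \<in> g_lie G"
  shows "fgen (x - y) - (fgen x - fgen y) \<in> uea_ideal"
  using uea_ideal_closed(5)[OF fgen_add[OF g_lie_diff[OF assms] assms(2)]] by (simp add: algebra_simps)

text \<open>
  A letter of the free algebra depends on its index only up to the linearity relations, so the
  linear relations between the matrices \<open>F\<^sub>i\<^sub>j\<close> have to be transferred to letters one sum at a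
  time.
\<close>

lemma fgen_F_comm:
  "fgen (F_elem G i j) * fgen (F_elem G k l) - fgen (F_elem G k l) * fgen (F_elem G i j)
    - (((if k = j then fgen (F_elem G i l) else 0)
      - (\<Sum>m\<in>UNIV. fconst (G $ i $ k * matrix_inv G $ m $ j) * fgen (F_elem G m l)))
     - ((if i = l then fgen (F_elem G k j) else 0)
       - (\<Sum>m\<in>UNIV. fconst (G $ i $ m * matrix_inv G $ l $ j) * fgen (F_elem G k m)))) \<in> uea_ideal"
  (is "?c - ((?p - ?q) - (?r - ?t)) \<in> uea_ideal")
proof -
  let ?P = "mscale (if k = j then 1 else 0) (F_elem G i l)" and ?Q = "\<Sum>m\<in>UNIV. mscale
    (G $ i $ k * matrix_inv G $ m $ j) (F_elem G m l)"
  let ?R = "mscale (if i = l then 1 else 0) (F_elem G k j)" and ?T = "\<Sum>m\<in>UNIV. mscale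
    (G $ i $ m * matrix_inv G $ l $ j) (F_elem G k m)"
  have in_g: "?P \<in> g_lie G" "?Q \<in> g_lie G" "?R \<in> g_lie G" "?T \<in> g_lie G"
    by (intro g_lie_sum g_lie_scale g_lie_F)+
  have 1: "?c - fgen ((?P - ?Q) - (?R - ?T)) \<in> uea_ideal"
    using fgen_bracket[OF g_lie_F g_lie_F, of i j k l] unfolding F_elem_bracket .
  have p: "fgen ?P - ?p \<in> uea_ideal"
    using fgen_scale[OF g_lie_F, of "if k = j then 1 else 0" i l] by (simp add: fconst.one fconst.zero
      split: if_splits)
  have r: "fgen ?R - ?r \<in> uea_ideal"
    using fgen_scale[OF g_lie_F, of "if i = l then 1 else 0" k j] by (simp add: fconst.one fconst.zero
      split: if_splits)
  have q: "fgen ?Q - ?q \<in> uea_ideal" and t: "fgen ?T - ?t \<in> uea_ideal" by (rule fgen_sum[OF g_lie_F])+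
  have "?c - ((?p - ?q) - (?r - ?t)) = (?c - fgen ((?P - ?Q) - (?R - ?T)))
     + (fgen ((?P - ?Q) - (?R - ?T)) - (fgen (?P - ?Q) - fgen (?R - ?T)))
     + (fgen (?P - ?Q) - (fgen ?P - fgen ?Q)) - (fgen (?R - ?T) - (fgen ?R - fgen ?T))
     + (fgen ?P - ?p) - (fgen ?Q - ?q) - ((fgen ?R - ?r) - (fgen ?T - ?t))"
    by (simp add: algebra_simps)
  also have "\<dots> \<in> uea_ideal"
    by (intro uea_ideal_closed(3) uea_ideal_closed(4) 1 p q r t fgen_diff in_g g_lie_diff)
  finally show ?thesis .
qed

text \<open>
  In matrix form this and the next lemma say that \<open>F\<close> changes its sign under the transposition
  \<open>A \<mapsto> g A\<^sup>t g\<inverse>\<close>.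
\<close>

lemma fgen_F_inv_left:
  "(\<Sum>m\<in>UNIV. fconst (matrix_inv G $ l $ m) * fgen (F_elem G m j))
    + (\<Sum>m\<in>UNIV. fconst (matrix_inv G $ m $ j) * fgen (F_elem G m l)) \<in> uea_ideal"
  (is "?p + ?q \<in> uea_ideal")
proof -
  let ?P = "\<Sum>m\<in>UNIV. mscale (matrix_inv G $ l $ m) (F_elem G m j)" and ?Q = "\<Sum>m\<in>UNIV. mscale
    (matrix_inv G $ m $ j) (F_elem G m l)"
  have "?P + ?Q = 0"
  proof (unfold vec_eq_iff, intro allI)
    fix a b :: 'n
    note inv = inverse_mult_nth[OF G]
    have "(\<Sum>m\<in>UNIV. matrix_inv G $ m $ j * G $ m $ b) = (\<Sum>m\<in>UNIV. \<epsilon> * (matrix_inv G $ j $ m * G $ m $ b))"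
      by (intro sum.cong refl) (subst inv_sym[OF G \<epsilon> sym], simp)
    hence 1: "(\<Sum>m\<in>UNIV. matrix_inv G $ m $ j * G $ m $ b) = (if b = j then \<epsilon> else 0)"
      by (simp add: inv flip: sum_distrib_left)
    have "?P $ a $ b = (\<Sum>m\<in>UNIV. (if m = a then (if b = j then matrix_inv G $ l $ m else 0) else 0)
      - matrix_inv G $ a $ j * (matrix_inv G $ l $ m * G $ m $ b))"
      unfolding sum_component mscale_nth by (intro sum.cong refl) (auto simp: F_elem_nth algebra_simps)
    hence P: "?P $ a $ b = (if b = j then matrix_inv G $ l $ a else 0) - (if b = l then matrix_inv
      G $ a $ j else 0)"
      by (simp add: sum_subtractf inv flip: sum_distrib_left)
    have "?Q $ a $ b = (\<Sum>m\<in>UNIV. (if m = a then (if b = l then matrix_inv G $ m $ j else 0) else 0)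
      - matrix_inv G $ a $ l * (matrix_inv G $ m $ j * G $ m $ b))"
      unfolding sum_component mscale_nth by (intro sum.cong refl) (auto simp: F_elem_nth algebra_simps)
    hence Q: "?Q $ a $ b = (if b = l then matrix_inv G $ a $ j else 0) - (if b = j then \<epsilon> * matrix_inv
      G $ a $ l else 0)"
      by (simp add: sum_subtractf 1 mult.commute[of \<epsilon>] flip: sum_distrib_left)
    show "(?P + ?Q) $ a $ b = 0 $ a $ b"
      using P Q inv_sym[OF G \<epsilon> sym, of l a] by simp
  qed
  hence "fgen (?P + ?Q) \<in> uea_ideal" by (simp only: fgen_0)
  moreover have "fgen (?P + ?Q) - (fgen ?P + fgen ?Q) \<in> uea_ideal" "fgen ?P - ?p \<in> uea_ideal" "fgen ?Q
    - ?q \<in> uea_ideal"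
    by (intro fgen_add g_lie_sum g_lie_scale g_lie_F fgen_sum)+
  ultimately have "fgen (?P + ?Q) - (fgen (?P + ?Q) - (fgen ?P + fgen ?Q)) - (fgen ?P - ?p)
    - (fgen ?Q - ?q) \<in> uea_ideal"
    by (simp only: uea_ideal_closed(4))
  thus ?thesis by (simp add: algebra_simps)
qed

lemma fgen_F_inv_right:
  "(\<Sum>m\<in>UNIV. fconst (G $ m $ k) * fgen (F_elem G i m)) + (\<Sum>m\<in>UNIV. fconst (G $ i $ m) * fgen
    (F_elem G k m)) \<in> uea_ideal"
  (is "?p + ?q \<in> uea_ideal")
proof -
  let ?P = "\<Sum>m\<in>UNIV. mscale (G $ m $ k) (F_elem G i m)" and ?Q = "\<Sum>m\<in>UNIV. mscale (G $ i $ m) (F_elem G k m)"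
  have "?P + ?Q = 0"
  proof (unfold vec_eq_iff, intro allI)
    fix a b :: 'n
    note inv = inverse_mult_nth[OF G]
    have "(\<Sum>m\<in>UNIV. G $ i $ m * matrix_inv G $ a $ m) = (\<Sum>m\<in>UNIV. \<epsilon> * (G $ i $ m * matrix_inv G $ m $ a))"
      by (intro sum.cong refl) (subst inv_sym[OF G \<epsilon> sym], simp)
    hence 1: "(\<Sum>m\<in>UNIV. G $ i $ m * matrix_inv G $ a $ m) = (if a = i then \<epsilon> else 0)"
      by (auto simp: inv simp flip: sum_distrib_left)
    have "?P $ a $ b = (\<Sum>m\<in>UNIV. (if m = b then (if a = i then G $ m $ k else 0) else 0)
      - G $ i $ b * (matrix_inv G $ a $ m * G $ m $ k))"
      unfolding sum_component mscale_nth by (intro sum.cong refl) (auto simp: F_elem_nth algebra_simps)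
    hence P: "?P $ a $ b = (if a = i then G $ b $ k else 0) - (if a = k then G $ i $ b else 0)"
      by (simp add: sum_subtractf inv flip: sum_distrib_left)
    have "?Q $ a $ b = (\<Sum>m\<in>UNIV. (if m = b then (if a = k then G $ i $ m else 0) else 0)
      - G $ k $ b * (G $ i $ m * matrix_inv G $ a $ m))"
      unfolding sum_component mscale_nth by (intro sum.cong refl) (auto simp: F_elem_nth algebra_simps)
    hence Q: "?Q $ a $ b = (if a = k then G $ i $ b else 0) - (if a = i then \<epsilon> * G $ k $ b else 0)"
      by (simp add: sum_subtractf 1 mult.commute[of \<epsilon>] flip: sum_distrib_left)
    show "(?P + ?Q) $ a $ b = 0 $ a $ b"
      using P Q G_sym[OF G \<epsilon> sym, of b k] by simp
  qed
  hence "fgen (?P + ?Q) \<in> uea_ideal" by (simp only: fgen_0)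
  moreover have "fgen (?P + ?Q) - (fgen ?P + fgen ?Q) \<in> uea_ideal" "fgen ?P - ?p \<in> uea_ideal" "fgen ?Q
    - ?q \<in> uea_ideal"
    by (intro fgen_add g_lie_sum g_lie_scale g_lie_F fgen_sum)+
  ultimately have "fgen (?P + ?Q) - (fgen (?P + ?Q) - (fgen ?P + fgen ?Q)) - (fgen ?P - ?p)
    - (fgen ?Q - ?q) \<in> uea_ideal"
    by (simp only: uea_ideal_closed(4))
  thus ?thesis by (simp add: algebra_simps)
qed

end

section \<open>The substitution that defines the homomorphism\<close>

fun mat_pow :: "'a::semiring_1^'n::finite^'n \<Rightarrow> nat \<Rightarrow> 'a^'n^'n" where
  "mat_pow A 0 = mat 1"
| "mat_pow A (Suc r) = mat_pow A r ** A"

lemma mat_pow_add: "mat_pow A (p + q) = mat_pow A p ** mat_pow (A :: 'a::ring_1^'n::finite^'n) q"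
  by (induction q) (simp_all add: matrix_mul_assoc)

lemma mat_pow_Suc': "mat_pow A (Suc r) = A ** mat_pow (A :: 'a::ring_1^'n::finite^'n) r"
  using mat_pow_add[of A 1 r] by simp

text \<open>
  The matrix \<open>F - N/4\<close> before passing to the quotient.
\<close>

definition F_shift_free :: "complex^'n::finite^'n \<Rightarrow> (complex^'n^'n) free^'n^'n" where
  "F_shift_free G = (\<chi> i j. fgen (F_elem G i j)) - mat (fconst (of_nat CARD('n) / 4))"

text \<open>
  The image \<open>2 (F - N/4)\<^sup>r\<close> of \<open>s\<^sup>(\<^sup>r\<^sup>)\<close>. All values, also the one at \<open>r = 0\<close>, lie in the free
  algebra on the Lie algebra, so the substitution maps the whole type there and its kernel is an
  ideal of the whole type.
\<close>

definition cayley_image :: "complex^'n::finite^'n \<Rightarrow> nat \<times> 'n \<times> 'n \<Rightarrow> (complex^'n^'n) free" where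
  "cayley_image G = (\<lambda>(r, i, j). fconst 2 * mat_pow (F_shift_free G) r $ i $ j)"

lemma mat_pow_over:
  assumes C: "subring_set C" and "A \<in> mat_over C"
  shows "mat_pow A r \<in> mat_over C"
  by (induction r) (auto intro: mat_over_subring[OF C] subring_set_1[OF C] subring_set_mat_over_mult[OF C]
    assms)

lemma F_shift_free_over: "F_shift_free G \<in> mat_over (carrier (free_alg (g_lie G)))"
  unfolding F_shift_free_def
  by (intro mat_over_subring subring_free fconst_closed) (auto simp: mat_over_def intro!: fgen_closed g_lie_F)

lemma mat_pow_F_closed: "mat_pow (F_shift_free G) r $ i $ j \<in> carrier (free_alg (g_lie G))"
  using mat_pow_over[OF subring_free F_shift_free_over, of G r] by (simp add: mat_over_def)

lemma cayley_image_closed: "cayley_image G x \<in> carrier (free_alg (g_lie G))"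
  by (cases x) (auto simp: cayley_image_def intro!: free_closed fconst_closed mat_pow_F_closed)

lemma free_subst_s_coeff:
  "free_subst (cayley_image G) (s_coeff i j r) = fconst (if r = 0 then 1 else 2) * mat_pow
    (F_shift_free G) r $ i $ j"
  by (simp add: s_coeff_def free_subst_hom cayley_image_def mat_def fconst.one)

lemma s_coeff_closed: "s_coeff i j r \<in> carrier (free_alg s_symbols)"
  by (simp add: s_coeff_def free_closed fgen_closed s_symbols_def)

lemma scalar_series_over: "scalar_series c \<in> fls_over (fls_over (carrier (free_alg X)))"
  unfolding scalar_series_eq
  by (simp add: fls_over_def fls_map_nth fconst.zero ring_embedding.zero[OF fls_map_embedding]
    fconst_embedding fconst_closed)

text \<open>
  The letters of index \<open>r = 0\<close> do not occur: the coefficients of all matrices involved lie in the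
  subring generated by the letters with \<open>r \<ge> 1\<close>.
\<close>

lemma refl_rels_closed: "refl_rels G \<kappa> \<subseteq> carrier (free_alg s_symbols)"
proof -
  let ?C = "carrier (free_alg s_symbols)" and ?C2 = "fls_over (fls_over (carrier (free_alg s_symbols)))"
  note C2 = subring_set_fls_over[OF subring_set_fls_over[OF subring_free]]
  have R: "R_free G \<kappa> w \<in> mat_over ?C2" for w
    unfolding R_free_def by (simp add: mat_over_def map_matrix_nth scalar_series_over)
  have u: "map_matrix in_u S_series $ i $ j \<in> ?C2" for i j
    unfolding fls_over_def mem_Collect_eq in_u_nth
    by (simp add: s_coeff_int_def s_coeff_closed free_closed)
  have v: "map_matrix in_v S_series $ i $ j \<in> ?C2" for i j
    unfolding fls_over_def mem_Collect_eq in_v_nth(1) fls_const_nth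
    by (simp add: in_v_nth(2) s_coeff_int_def s_coeff_closed free_closed del: fps_to_fls_nth)
  from u v have S: "S1 \<in> mat_over ?C2" "S2 \<in> mat_over ?C2"
    unfolding S1_def S2_def
    by (auto simp: mat_over_def tensor_one_nth tensor_mat_one_nth subring_set_0[OF C2])
  have "reflection_defect G \<kappa> \<in> mat_over ?C2"
    unfolding reflection_defect_def
    by (intro mat_over_subring subring_set_mat_over_mult C2 R S)
  moreover have "fps_nth (unitarity_defect $ i $ j) r \<in> ?C" for i j r
  proof -
    have "fps_nth (S_series $ i $ j) r \<in> ?C" "fps_nth (S_series_neg $ i $ j) r \<in> ?C" for i j r
      by (auto simp: S_series_def S_series_neg_def s_coeff_closed minus_one_power_iff free_closed)
    hence "fps_nth ((S_series ** S_series_neg) $ i $ j) r \<in> ?C"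
      by (auto simp: matrix_mult_nth fps_sum_nth fps_mult_nth intro!: sum_in free_closed)
    thus ?thesis by (auto simp: unitarity_defect_def mat_def intro!: free_closed)
  qed
  ultimately show ?thesis
    by (auto simp: refl_rels_def mat_over_def fls_over_def)
qed

section \<open>The relations of the reflection algebra lie in the kernel\<close>

context
  fixes G :: "complex^'n::finite^'n" and \<epsilon> :: complex
  assumes G: "invertible G" and \<epsilon>: "\<epsilon> = 1 \<or> \<epsilon> = - 1" and sym: "transpose G = mat \<epsilon> ** G"
begin

lemma fgen_F_shift:
  "F_shift_free G $ i $ j = fgen (F_elem G i j) - (if i = j then fconst (of_nat CARD('n) / 4) else 0)"
  by (simp add: F_shift_free_def mat_def)

text \<open>
  The scalar shift cancels on the left-hand side, and on the right-hand side because \<open>P - Q\<close>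
  commutes with scalars.
\<close>

lemma F_shift_comm:
  fixes X defines "X \<equiv> F_shift_free G"
  shows "X $ i $ j * X $ k $ l - X $ k $ l * X $ i $ j
    - (((if k = j then X $ i $ l else 0) - (\<Sum>m\<in>UNIV. fconst (G $ i $ k) * fconst
      (matrix_inv G $ m $ j) * X $ m $ l))
     - ((if i = l then X $ k $ j else 0) - (\<Sum>m\<in>UNIV. X $ k $ m * (fconst (G $ i $ m) * fconst
       (matrix_inv G $ l $ j))))) \<in> uea_ideal G"
proof -
  define N :: complex where "N = of_nat CARD('n) / 4"
  let ?x = "\<lambda>i j. fgen (F_elem G i j) :: (complex^'n^'n) free" and ?d = "\<lambda>i j. if i = j then fconst N else
    0 :: (complex^'n^'n) free"
  have X: "X $ i $ j = ?x i j - ?d i j" for i j unfolding X_def N_def by (rule fgen_F_shift)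
  have d: "p * ?d i j = ?d i j * p" for p i j by (simp add: fconst_commute)
  have 1: "X $ i $ j * X $ k $ l - X $ k $ l * X $ i $ j = ?x i j * ?x k l - ?x k l * ?x i j"
    unfolding X by (simp add: left_diff_distrib right_diff_distrib fconst_commute)
  have 2: "(\<Sum>m\<in>UNIV. fconst (G $ i $ k) * fconst (matrix_inv G $ m $ j) * X $ m $ l)
    = (\<Sum>m\<in>UNIV. fconst (G $ i $ k * matrix_inv G $ m $ j) * ?x m l) - fconst
      (G $ i $ k * matrix_inv G $ l $ j * N)"
    unfolding X by (simp add: right_diff_distrib sum_subtractf fconst.mult mult.assoc
      if_distrib[of "\<lambda>x. _ * x"] cong: if_cong)
  have 3: "(\<Sum>m\<in>UNIV. X $ k $ m * (fconst (G $ i $ m) * fconst (matrix_inv G $ l $ j)))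
    = (\<Sum>m\<in>UNIV. fconst (G $ i $ m * matrix_inv G $ l $ j) * ?x k m) - fconst
      (G $ i $ k * matrix_inv G $ l $ j * N)"
    unfolding X fconst.mult[symmetric] unfolding fconst_commute
    by (simp add: right_diff_distrib sum_subtractf fconst.mult mult.assoc if_distrib[of "\<lambda>x. _ * x"] cong:
      if_cong)
  have "X $ i $ j * X $ k $ l - X $ k $ l * X $ i $ j
    - (((if k = j then X $ i $ l else 0) - (\<Sum>m\<in>UNIV. fconst (G $ i $ k) * fconst
      (matrix_inv G $ m $ j) * X $ m $ l))
     - ((if i = l then X $ k $ j else 0) - (\<Sum>m\<in>UNIV. X $ k $ m * (fconst (G $ i $ m) * fconst
       (matrix_inv G $ l $ j)))))
    = ?x i j * ?x k l - ?x k l * ?x i j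
    - (((if k = j then ?x i l else 0) - (\<Sum>m\<in>UNIV. fconst (G $ i $ k * matrix_inv G $ m $ j) * ?x m l))
     - ((if i = l then ?x k j else 0) - (\<Sum>m\<in>UNIV. fconst (G $ i $ m * matrix_inv G $ l $ j) * ?x k m)))"
    unfolding 1 2 3 unfolding X by simp
  thus ?thesis using fgen_F_comm[OF G \<epsilon> sym, of i j k l] by simp
qed

text \<open>
  The two shifts by \<open>N/4\<close> add up to the term with \<open>N/2\<close>.
\<close>

lemma F_shift_inv_left:
  fixes X defines "X \<equiv> F_shift_free G"
  shows "(\<Sum>m\<in>UNIV. fconst (matrix_inv G $ l $ m) * X $ m $ j)
    + (\<Sum>m\<in>UNIV. fconst (matrix_inv G $ m $ j) * X $ m $ l)
    + fconst (matrix_inv G $ l $ j) * fconst (of_nat CARD('n) / 2) \<in> uea_ideal G"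
proof -
  define N :: complex where "N = of_nat CARD('n) / 4"
  let ?h = "matrix_inv G $ l $ j"
  have 1: "fconst ?h * fconst (of_nat CARD('n) / 2) = fconst (?h * N) + fconst (?h * N)"
    unfolding fconst.mult[symmetric] fconst.add[symmetric] by (simp add: N_def field_simps)
  have 2: "(\<Sum>m\<in>UNIV. fconst (matrix_inv G $ l $ m) * X $ m $ j)
    = (\<Sum>m\<in>UNIV. fconst (matrix_inv G $ l $ m) * fgen (F_elem G m j)) - fconst (?h * N)"
    "(\<Sum>m\<in>UNIV. fconst (matrix_inv G $ m $ j) * X $ m $ l) = (\<Sum>m\<in>UNIV. fconst (matrix_inv G $ m $ j) * fgen
      (F_elem G m l)) - fconst (?h * N)"
    unfolding X_def fgen_F_shift N_def[symmetric]
    by (simp_all add: right_diff_distrib sum_subtractf fconst.mult mult.assoc if_distrib[of "\<lambda>x. _ * x"]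
      cong: if_cong)
  show ?thesis
    using fgen_F_inv_left[OF G \<epsilon> sym, of l j] unfolding 1 2 by simp
qed

lemma F_shift_inv_right:
  fixes X defines "X \<equiv> F_shift_free G"
  shows "(\<Sum>m\<in>UNIV. X $ i $ m * fconst (G $ m $ k)) + (\<Sum>m\<in>UNIV. X $ k $ m * fconst (G $ i $ m))
    + fconst (of_nat CARD('n) / 2) * fconst (G $ i $ k) \<in> uea_ideal G"
proof -
  define N :: complex where "N = of_nat CARD('n) / 4"
  let ?h = "G $ i $ k"
  have 1: "fconst (of_nat CARD('n) / 2) * fconst ?h = fconst (?h * N) + fconst (?h * N)"
    unfolding fconst.mult[symmetric] fconst.add[symmetric] by (simp add: N_def field_simps)
  have 2: "(\<Sum>m\<in>UNIV. X $ i $ m * fconst (G $ m $ k)) = (\<Sum>m\<in>UNIV. fconst (G $ m $ k) * fgen (F_elem G i m))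
    - fconst (?h * N)"
    "(\<Sum>m\<in>UNIV. X $ k $ m * fconst (G $ i $ m)) = (\<Sum>m\<in>UNIV. fconst (G $ i $ m) * fgen (F_elem G k m))
      - fconst (?h * N)"
    unfolding X_def fgen_F_shift fconst_commute N_def[symmetric]
    by (simp_all add: right_diff_distrib sum_subtractf fconst.mult mult.assoc if_distrib[of "\<lambda>x. _ * x"]
      cong: if_cong)
  show ?thesis
    using fgen_F_inv_right[OF G \<epsilon> sym, of k i] unfolding 1 2 by simp
qed

definition cayley_kernel :: "'n sfree set" where
  "cayley_kernel = {p. free_subst (cayley_image G) p \<in> uea_ideal G}"

lemma cayley_kernel_ideal: "two_sided_ideal cayley_kernel"
  unfolding two_sided_ideal_def cayley_kernel_def
  using uea_ideal_closed[OF G \<epsilon> sym] by (simp add: free_subst_hom free_subst_closed cayley_image_closed)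

lemma reflection_in_kernel:
  assumes \<kappa>: "\<kappa> = of_nat CARD('n) / 2 - \<epsilon>"
  shows "reflection_defect G \<kappa> \<in> mat_over (fls_over (fls_over cayley_kernel))"
proof -
  let ?\<theta> = "free_subst (cayley_image G)" and ?X = "F_shift_free G"
  define Y :: "'n sfree^'n^'n" where "Y = (\<chi> i j. fconst (1/2) * fgen (1, i, j))"
  have Y: "?\<theta> (Y $ i $ j) = ?X $ i $ j" for i j
  proof -
    have "fconst (1/2) * (fconst 2 * p) = p" for p :: "(complex^'n^'n) free"
      by (simp add: mult.assoc[symmetric] fconst.mult[symmetric] fconst.one)
    thus ?thesis by (simp add: Y_def free_subst_hom cayley_image_def)
  qed
  note hom = cayley_kernel_def mem_Collect_eq free_subst_hom Y free_subst_s_coeff if_distrib[of "free_subst _"]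
  have pow1: "s_coeff i j (Suc r) - (\<Sum>m\<in>UNIV. Y $ i $ m * s_coeff m j r) \<in> cayley_kernel"
    if "r \<ge> 1" for r i j
  proof -
    have "?\<theta> (s_coeff i j (Suc r) - (\<Sum>m\<in>UNIV. Y $ i $ m * s_coeff m j r)) =
       fconst 2 * (mat_pow ?X (Suc r) $ i $ j - (?X ** mat_pow ?X r) $ i $ j)"
      using that unfolding hom matrix_mult_nth[of ?X]
      by (simp add: right_diff_distrib sum_distrib_left mult.assoc[symmetric]
        fconst_commute[of "?X $ _ $ _"] del: mat_pow.simps)
    thus ?thesis using uea_ideal_closed(2)[OF G \<epsilon> sym] unfolding mat_pow_Suc' cayley_kernel_def by simp
  qed
  have pow2: "s_coeff i j (Suc r) - (\<Sum>m\<in>UNIV. s_coeff i m r * Y $ m $ j) \<in> cayley_kernel"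
    if "r \<ge> 1" for r i j
  proof -
    have "?\<theta> (s_coeff i j (Suc r) - (\<Sum>m\<in>UNIV. s_coeff i m r * Y $ m $ j)) =
       fconst 2 * (mat_pow ?X (Suc r) $ i $ j - (mat_pow ?X r ** ?X) $ i $ j)"
      using that unfolding hom matrix_mult_nth[of "mat_pow ?X r" ?X]
      by (simp add: right_diff_distrib sum_distrib_left mult.assoc del: mat_pow.simps)
    thus ?thesis using uea_ideal_closed(2)[OF G \<epsilon> sym] unfolding cayley_kernel_def by simp
  qed
  have comm: "Y $ i $ j * Y $ k $ l - Y $ k $ l * Y $ i $ j
       - (((if k = j then Y $ i $ l else 0) - (\<Sum>m\<in>UNIV. fconst (G $ i $ k) * fconst
         (matrix_inv G $ m $ j) * Y $ m $ l))
       - ((if i = l then Y $ k $ j else 0) - (\<Sum>m\<in>UNIV. Y $ k $ m * (fconst (G $ i $ m) * fconst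
         (matrix_inv G $ l $ j))))) \<in> cayley_kernel" for i j k l
    unfolding hom by (rule F_shift_comm)
  have inv_left: "(\<Sum>m\<in>UNIV. fconst (matrix_inv G $ l $ m) * Y $ m $ j)
    + (\<Sum>m\<in>UNIV. fconst (matrix_inv G $ m $ j) * Y $ m $ l)
       + fconst (matrix_inv G $ l $ j) * fconst (of_nat CARD('n) / 2) \<in> cayley_kernel" for j l
    unfolding hom by (rule F_shift_inv_left)
  have inv_right: "(\<Sum>m\<in>UNIV. Y $ i $ m * fconst (G $ m $ k)) + (\<Sum>m\<in>UNIV. Y $ k $ m * fconst (G $ i $ m))
       + fconst (of_nat CARD('n) / 2) * fconst (G $ i $ k) \<in> cayley_kernel" for i k
    unfolding hom by (rule F_shift_inv_right)
  show ?thesis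
    by (rule reflection_defect_over_entries[OF cayley_kernel_ideal _ pow1 pow2 G \<epsilon> sym \<kappa> comm inv_left
      inv_right])
       (simp_all add: Y_def)
qed

text \<open>
  The coefficient of \<open>u\<^sup>-\<^sup>r\<close> in \<open>S(u) S(- u)\<close> is \<open>X\<^sup>r\<close> times the alternating sum called \<open>coeff\<close>,
  which is the coefficient of \<open>t\<^sup>r\<close> in \<open>(1 + t)/(1 - t) \<cdot> (1 - t)/(1 + t) = 1\<close>.
\<close>

lemma unitarity_in_kernel: "fps_nth (unitarity_defect $ i $ j) r \<in> cayley_kernel"
proof -
  let ?\<theta> = "free_subst (cayley_image G)" and ?X = "F_shift_free G"
  define c :: "nat \<Rightarrow> complex" where "c r = (if r = 0 then 1 else 2)" for r
  have alt: "2 * (\<Sum>q\<le>r. (- 1) ^ q) = 1 + (- 1 :: complex) ^ r" for r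
    by (induction r) (auto simp: algebra_simps)
  have "(\<Sum>p\<le>r. c p * ((-1) ^ (r - p) * c (r - p))) =
    (\<Sum>p\<le>r. (if p = r then (if p = 0 then 1 else 0) else 0) - 2 * (if p = 0 then (-1) ^ r else 0)
      - 2 * (if p = r then 1 else 0) + 4 * (-1) ^ (r - p))"
    by (intro sum.cong refl) (auto simp: c_def)
  also have "\<dots> = (if r = 0 then 1 else 0) - 2 * (-1) ^ r - 2 + 4 * (\<Sum>p\<le>r. (-1) ^ (r - p))"
    by (simp add: sum.distrib sum_subtractf flip: sum_distrib_left)
  also have "(\<Sum>p\<le>r. (-1) ^ (r - p)) = (\<Sum>q\<le>r. (- 1 :: complex) ^ q)"
    by (rule sum.reindex_bij_witness[of _ "\<lambda>q. r - q" "\<lambda>q. r - q"]) auto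
  also have "4 * \<dots> = 2 * (1 + (- 1) ^ r)" unfolding alt[symmetric] by simp
  finally have coeff: "(\<Sum>p\<le>r. c p * ((-1) ^ (r - p) * c (r - p))) = (if r = 0 then 1 else 0)"
    by (simp add: algebra_simps)
  have sgn: "(- 1) ^ q = fconst ((- 1) ^ q)" for q
    by (cases "even q") (auto simp: fconst.one fconst.uminus)
  have "?\<theta> (fps_nth ((S_series ** S_series_neg) $ i $ j) r) =
    (\<Sum>k\<in>UNIV. \<Sum>p\<le>r. fconst (c p * ((-1) ^ (r - p) * c (r - p))) * (mat_pow ?X p $ i $ k * mat_pow ?X
      (r - p) $ k $ j))"
    unfolding matrix_mult_nth fps_sum_nth fps_mult_nth S_series_def S_series_neg_def vec_lambda_beta
      fps_nth_Abs_fps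
      free_subst_sum free_subst_mult sgn free_subst_fconst free_subst_s_coeff atLeast0AtMost c_def[symmetric]
    by (intro sum.cong refl) (rule fconst_collect)
  also have "\<dots> = (\<Sum>p\<le>r. fconst (c p * ((-1) ^ (r - p) * c (r - p))) * (mat_pow ?X p ** mat_pow ?X
    (r - p)) $ i $ j)"
    unfolding matrix_mult_nth sum_distrib_left by (rule sum.swap)
  also have "\<dots> = fconst (\<Sum>p\<le>r. c p * ((-1) ^ (r - p) * c (r - p))) * mat_pow ?X r $ i $ j"
    unfolding fconst.sum sum_distrib_right by (intro sum.cong refl) (simp flip: mat_pow_add)
  also have "\<dots> = ?\<theta> (fps_nth (mat 1 $ i $ j) r)"
    unfolding coeff by (auto simp: fconst.one fconst.zero mat_def free_subst_hom)
  finally show ?thesis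
    using uea_ideal_closed(2)[OF G \<epsilon> sym] by (simp add: cayley_kernel_def unitarity_defect_def free_subst_hom)
qed

lemma refl_rels_in_kernel:
  assumes "\<kappa> = of_nat CARD('n) / 2 - \<epsilon>" and "p \<in> refl_rels G \<kappa>"
  shows "free_subst (cayley_image G) p \<in> uea_ideal G"
  using assms(2) reflection_in_kernel[OF assms(1)] unitarity_in_kernel
  by (auto simp: refl_rels_def mat_over_def fls_over_def cayley_kernel_def)

end

section \<open>The Cayley series over the enveloping algebra\<close>

text \<open>
  Computations in matrices over \<open>U(L)\<close> are done on representatives: every such matrix is the image
  of a matrix over the free algebra on \<open>L\<close>, for which the usual matrix calculus is available.
\<close>

context
  fixes L :: "(complex^'n::finite^'n) set"
  assumes L: "uea_rels L \<subseteq> carrier (free_alg L)"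
begin

definition uea_mat :: "(complex^'n^'n) free^'n^'n \<Rightarrow> 'n \<Rightarrow> 'n \<Rightarrow> (complex^'n^'n) free set" where
  "uea_mat A = (\<lambda>i j. pres_class L (uea_rels L) (A $ i $ j))"

lemma ring_uea: "ring (uea L)"
  unfolding uea_def by (rule ring_presented[OF L])

lemma uea_mat_nth_closed:
  "A \<in> mat_over (carrier (free_alg L)) \<Longrightarrow> A $ i $ j \<in> carrier (free_alg L)"
  by (simp add: mat_over_def)

lemma uea_mat_carrier:
  "carrier (mat_alg (uea L)) = uea_mat ` mat_over (carrier (free_alg L))"
proof (intro equalityI subsetI)
  fix x :: "'n \<Rightarrow> 'n \<Rightarrow> (complex^'n^'n) free set" assume "x \<in> carrier (mat_alg (uea L))"
  hence "\<forall>i j. x i j \<in> pres_class L (uea_rels L) ` carrier (free_alg L)"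
    unfolding mat_alg_def uea_def by (simp add: carrier_presented[OF L])
  hence "\<forall>i j. \<exists>p\<in>carrier (free_alg L). x i j = pres_class L (uea_rels L) p"
    by (simp add: image_iff)
  then obtain p where p: "\<And>i j. p i j \<in> carrier (free_alg L)" "\<And>i j. x i j = pres_class L (uea_rels L) (p i j)"
    by metis
  hence "x = uea_mat (\<chi> i j. p i j)" "(\<chi> i j. p i j) \<in> mat_over (carrier (free_alg L))"
    by (simp_all add: fun_eq_iff uea_mat_def mat_over_def)
  thus "x \<in> uea_mat ` mat_over (carrier (free_alg L))" by blast
qed (auto simp: mat_alg_def uea_mat_def uea_def mat_over_def pres_class_closed[OF L])

lemma
  assumes A: "A \<in> mat_over (carrier (free_alg L))" and B: "B \<in> mat_over (carrier (free_alg L))"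
  shows uea_mat_mult: "uea_mat A \<otimes>\<^bsub>mat_alg (uea L)\<^esub> uea_mat B = uea_mat (A ** B)"
    and uea_mat_add: "uea_mat A \<oplus>\<^bsub>mat_alg (uea L)\<^esub> uea_mat B = uea_mat (A + B)"
    and uea_mat_smult: "c \<odot>\<^bsub>mat_alg (uea L)\<^esub> uea_mat A = uea_mat (mat (fconst c) ** A)"
proof -
  note closed = uea_mat_nth_closed[OF A] uea_mat_nth_closed[OF B]
  have "(\<Oplus>\<^bsub>presented_alg L (uea_rels L)\<^esub>k\<in>UNIV. pres_class L (uea_rels L) (A $ i $ k)
    \<otimes>\<^bsub>presented_alg L (uea_rels L)\<^esub> pres_class L (uea_rels L) (B $ k $ j))
      = pres_class L (uea_rels L) ((A ** B) $ i $ j)" for i j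
    unfolding matrix_mult_nth pres_class_hom(1)[OF L closed]
    by (rule pres_class_sum[OF L, symmetric]) (simp_all add: closed free_closed)
  thus "uea_mat A \<otimes>\<^bsub>mat_alg (uea L)\<^esub> uea_mat B = uea_mat (A ** B)"
    by (simp add: uea_mat_def mat_alg_def uea_def)
  show "uea_mat A \<oplus>\<^bsub>mat_alg (uea L)\<^esub> uea_mat B = uea_mat (A + B)"
    using pres_class_hom(2)[OF L closed] by (simp add: uea_mat_def mat_alg_def uea_def)
  show "c \<odot>\<^bsub>mat_alg (uea L)\<^esub> uea_mat A = uea_mat (mat (fconst c) ** A)"
    using pres_class_smult[OF L closed(1)] by (simp add: uea_mat_def mat_alg_def uea_def scalar_mult_nth)
qed

lemma uea_mat_1: "uea_mat (mat 1) = \<one>\<^bsub>mat_alg (uea L)\<^esub>"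
  and uea_mat_0: "uea_mat 0 = \<zero>\<^bsub>mat_alg (uea L)\<^esub>"
  by (simp_all add: fun_eq_iff uea_mat_def mat_alg_def uea_def mat_def pres_class_0[OF L] pres_class_1[OF L])

lemma uea_mat_eq_iff:
  assumes "A \<in> mat_over (carrier (free_alg L))" "B \<in> mat_over (carrier (free_alg L))"
  shows "uea_mat A = uea_mat B \<longleftrightarrow> A - B \<in> mat_over (pres_ideal L (uea_rels L))"
  using pres_class_eq_iff[OF L uea_mat_nth_closed[OF assms(1)] uea_mat_nth_closed[OF assms(2)]]
  by (simp add: uea_mat_def fun_eq_iff mat_over_def)

lemma abelian_group_mat_uea: "abelian_group (mat_alg (uea L) :: ('n \<Rightarrow> 'n \<Rightarrow> (complex^'n^'n) free set) calg)"
proof -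
  interpret U: ring "uea L" by (rule ring_uea)
  show ?thesis
  proof (rule abelian_groupI)
    fix x :: "'n \<Rightarrow> 'n \<Rightarrow> (complex^'n^'n) free set" assume x: "x \<in> carrier (mat_alg (uea L))"
    show "\<exists>y\<in>carrier (mat_alg (uea L)). y \<oplus>\<^bsub>mat_alg (uea L)\<^esub> x = \<zero>\<^bsub>mat_alg (uea L)\<^esub>"
      using x by (intro bexI[of _ "\<lambda>i j. \<ominus>\<^bsub>uea L\<^esub> x i j"]) (auto simp: mat_alg_def U.l_neg)
  qed (simp_all add: mat_alg_def U.a_ac)
qed

lemma uea_mat_uminus:
  assumes A: "A \<in> mat_over (carrier (free_alg L))"
  shows "\<ominus>\<^bsub>mat_alg (uea L)\<^esub> uea_mat A = uea_mat (- A)"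
proof (rule abelian_group.minus_equality[OF abelian_group_mat_uea])
  have n: "- A \<in> mat_over (carrier (free_alg L))" using A by (simp add: mat_over_def free_closed)
  show "uea_mat (- A) \<oplus>\<^bsub>mat_alg (uea L)\<^esub> uea_mat A = \<zero>\<^bsub>mat_alg (uea L)\<^esub>"
    unfolding uea_mat_add[OF n A] by (simp add: uea_mat_0)
  show "uea_mat A \<in> carrier (mat_alg (uea L))" "uea_mat (- A) \<in> carrier (mat_alg (uea L))"
    unfolding uea_mat_carrier using A n by auto
qed

lemma uea_mat_sum:
  assumes "finite K" "\<And>k. A k \<in> mat_over (carrier (free_alg L))"
  shows "(\<Oplus>\<^bsub>mat_alg (uea L)\<^esub>k\<in>K. uea_mat (A k)) = uea_mat (\<Sum>k\<in>K. A k)"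
proof -
  interpret M: abelian_group "mat_alg (uea L) :: ('n \<Rightarrow> 'n \<Rightarrow> (complex^'n^'n) free set) calg" by
    (rule abelian_group_mat_uea)
  show ?thesis
    using assms(1)
  proof (induction K rule: finite_induct)
    case empty
    show ?case by (simp add: uea_mat_0)
  next
    case (insert k K)
    have s: "(\<Sum>k\<in>K. A k) \<in> mat_over (carrier (free_alg L))"
      using assms(2) by (auto simp: mat_over_def intro!: sum_in free_closed)
    have "(\<Oplus>\<^bsub>mat_alg (uea L)\<^esub>k\<in>insert k K. uea_mat (A k)) = uea_mat (A k) \<oplus>\<^bsub>mat_alg (uea L)\<^esub>
      (\<Oplus>\<^bsub>mat_alg (uea L)\<^esub>k\<in>K. uea_mat (A k))"
      using insert.hyps assms(2) by (intro M.finsum_insert) (auto simp: uea_mat_carrier)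
    also have "\<dots> = uea_mat (A k + (\<Sum>k\<in>K. A k))"
      unfolding insert.IH by (rule uea_mat_add[OF assms(2) s])
    finally show ?case using insert.hyps by simp
  qed
qed

lemma uea_mat_pow:
  assumes A: "A \<in> mat_over (carrier (free_alg L))"
  shows "uea_mat A [^]\<^bsub>mat_alg (uea L)\<^esub> r = uea_mat (mat_pow A r)"
  by (induction r) (simp_all add: nat_pow_def uea_mat_1 uea_mat_mult[OF mat_pow_over[OF subring_free A] A])

lemma uea_series_mult:
  assumes "\<And>r. s r \<in> mat_over (carrier (free_alg L))" "\<And>r. t r \<in> mat_over (carrier (free_alg L))"
  shows "(\<lambda>r. uea_mat (s r)) \<otimes>\<^bsub>series_alg (mat_alg (uea L))\<^esub> (\<lambda>r. uea_mat (t r))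
    = (\<lambda>r. uea_mat (\<Sum>k\<le>r. s k ** t (r - k)))"
proof -
  have "(\<Oplus>\<^bsub>mat_alg (uea L)\<^esub>k\<in>{..r}. uea_mat (s k) \<otimes>\<^bsub>mat_alg (uea L)\<^esub> uea_mat (t (r - k))) = uea_mat
    (\<Sum>k\<le>r. s k ** t (r - k))" for r
    unfolding uea_mat_mult[OF assms]
    by (rule uea_mat_sum) (auto intro: subring_set_mat_over_mult[OF subring_free] assms)
  thus ?thesis by (simp add: series_alg_def)
qed

definition one_plus_free :: "(complex^'n^'n) free^'n^'n \<Rightarrow> nat \<Rightarrow> (complex^'n^'n) free^'n^'n" where
  "one_plus_free A r = (if r = 0 then mat 1 else if r = 1 then A else 0)"

lemma one_plus_uea_mat: "one_plus (mat_alg (uea L)) (uea_mat A) = (\<lambda>r. uea_mat (one_plus_free A r))"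
  by (auto simp: one_plus_def one_plus_free_def uea_mat_1 uea_mat_0)

lemma one_plus_free_over:
  "A \<in> mat_over (carrier (free_alg L)) \<Longrightarrow> one_plus_free A r \<in> mat_over (carrier (free_alg L))"
  by (auto simp: one_plus_free_def mat_over_def mat_def free_closed)

lemma one_plus_free_conv:
  "(\<Sum>k\<le>r. one_plus_free A k ** t (r - k)) = t r + (if r = 0 then 0 else A ** t (r - 1))" (is ?A)
  "(\<Sum>k\<le>r. t k ** one_plus_free A (r - k)) = t r + (if r = 0 then 0 else t (r - 1) ** A)" (is ?B)
proof -
  have z: "0 ** M = 0" "M ** 0 = 0" for M :: "(complex^'n^'n) free^'n^'n"
    by (simp_all add: vec_eq_iff matrix_mult_nth)
  have if_z: "(if c then X else 0) ** M = (if c then X ** M else 0)" "M ** (if c then X else 0)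
    = (if c then M ** X else 0)"
    for c and X M :: "(complex^'n^'n) free^'n^'n" by (simp_all add: z)
  have rev: "(\<Sum>k\<le>r. t k ** one_plus_free A (r - k)) = (\<Sum>k\<le>r. t (r - k) ** one_plus_free A k)"
    by (rule sum.reindex_bij_witness[of _ "\<lambda>q. r - q" "\<lambda>q. r - q"]) auto
  show ?A ?B unfolding rev
    by (cases r; simp add: one_plus_free_def sum.atMost_Suc_shift if_z del: sum.atMost_Suc)+
qed

text \<open>
  The inverse of \<open>1 - A u\<inverse>\<close> is the geometric series \<open>\<Sum> A\<^sup>r u\<^sup>-\<^sup>r\<close>, and multiplication by
  \<open>1 + A u\<inverse>\<close> doubles all its coefficients but the first.
\<close>

lemma cayley_uea_mat:
  assumes A: "A \<in> mat_over (carrier (free_alg L))"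
  shows "one_plus (mat_alg (uea L)) (\<ominus>\<^bsub>mat_alg (uea L)\<^esub> uea_mat A) \<in> Units (series_alg (mat_alg (uea L)))"
    and "cayley (mat_alg (uea L)) (uea_mat A) =
      (\<lambda>r. if r = 0 then \<one>\<^bsub>mat_alg (uea L)\<^esub> else 2 \<odot>\<^bsub>mat_alg (uea L)\<^esub> (uea_mat A [^]\<^bsub>mat_alg (uea L)\<^esub> r))"
proof -
  let ?M = "mat_alg (uea L) :: ('n \<Rightarrow> 'n \<Rightarrow> (complex^'n^'n) free set) calg" and ?C = "mat_over
    (carrier (free_alg L)) :: ((complex^'n^'n) free^'n^'n) set"
  let ?P = "mat_pow A" and ?geo = "\<lambda>r. uea_mat (mat_pow A r)"
  have P: "?P r \<in> ?C" for r by (rule mat_pow_over[OF subring_free A])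
  have nA: "- A \<in> ?C" using A by (simp add: mat_over_def free_closed)
  let ?op = "one_plus ?M (\<ominus>\<^bsub>?M\<^esub> uea_mat A)"
  have op: "?op = (\<lambda>r. uea_mat (one_plus_free (- A) r))"
    unfolding uea_mat_uminus[OF A] one_plus_uea_mat ..
  have carr: "(\<lambda>r. uea_mat (t r)) \<in> carrier (series_alg ?M)" if "\<And>r. t r \<in> ?C" for t
    using that by (simp add: series_alg_def uea_mat_carrier)
  have one: "\<one>\<^bsub>series_alg ?M\<^esub> = (\<lambda>r. uea_mat (if r = 0 then mat 1 else 0))"
    by (auto simp: series_alg_def uea_mat_1 uea_mat_0)
  have minus_mult: "- A ** M = - (A ** M)" "M ** - A = - (M ** A)" for M
    by (simp_all add: vec_eq_iff matrix_mult_nth sum_negf)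
  have inv_right: "?op \<otimes>\<^bsub>series_alg ?M\<^esub> ?geo = \<one>\<^bsub>series_alg ?M\<^esub>"
    unfolding op uea_series_mult[OF one_plus_free_over[OF nA] P] one one_plus_free_conv
    by (intro ext arg_cong[of _ _ uea_mat]) (auto simp: minus_mult mat_pow_Suc'[symmetric] simp del:
      mat_pow.simps(2) dest!: gr0_implies_Suc)
  have inv_left: "?geo \<otimes>\<^bsub>series_alg ?M\<^esub> ?op = \<one>\<^bsub>series_alg ?M\<^esub>"
    unfolding op uea_series_mult[OF P one_plus_free_over[OF nA]] one one_plus_free_conv
    by (intro ext arg_cong[of _ _ uea_mat]) (auto simp: minus_mult mat_pow.simps(2)[symmetric] simp del:
      mat_pow.simps(2) dest!: gr0_implies_Suc)
  show "?op \<in> Units (series_alg ?M)"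
    unfolding Units_def using inv_left inv_right carr[of ?P, OF P]
      carr[of "one_plus_free (- A)", OF one_plus_free_over[OF nA]] unfolding op by blast
  (* A right inverse satisfies y_(r+1) = A y_r and y_0 = 1; so it is the geometric series. *)
  have unique: "y = ?geo" if y: "y \<in> carrier (series_alg ?M)" "?op \<otimes>\<^bsub>series_alg ?M\<^esub> y = \<one>\<^bsub>series_alg ?M\<^esub>" for y
  proof -
    have "\<forall>r. \<exists>B\<in>?C. y r = uea_mat B" using y(1) uea_mat_carrier by (auto simp: series_alg_def)
    then obtain t where t: "\<And>r. t r \<in> ?C" and yt: "y = (\<lambda>r. uea_mat (t r))" by metis
    have eq: "uea_mat (t r + (if r = 0 then 0 else - A ** t (r - 1))) = uea_mat (if r = 0 then mat 1 else
      0)" for r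
      using y(2) unfolding yt op uea_series_mult[OF one_plus_free_over[OF nA] t] one one_plus_free_conv by
        (rule fun_cong)
    have "uea_mat (t r) = ?geo r" for r
    proof (induction r)
      case 0
      show ?case using eq[of 0] by simp
    next
      case (Suc r)
      have At: "A ** t r \<in> ?C" by (rule subring_set_mat_over_mult[OF subring_free A t])
      have 0: "(0 :: (complex^'n^'n) free^'n^'n) \<in> ?C" by (simp add: mat_over_def free_closed)
      have "uea_mat (t (Suc r) - A ** t r) = uea_mat 0"
        using eq[of "Suc r"] by (simp add: minus_mult)
      hence "t (Suc r) - A ** t r \<in> mat_over (pres_ideal L (uea_rels L))"
        using uea_mat_eq_iff[OF mat_over_subring(1)[OF subring_free t At] 0] by simp
      hence "uea_mat (t (Suc r)) = uea_mat (A ** t r)"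
        using uea_mat_eq_iff[OF t At] by simp
      also have "\<dots> = uea_mat A \<otimes>\<^bsub>?M\<^esub> uea_mat (t r)" by (rule uea_mat_mult[OF A t, symmetric])
      also have "\<dots> = ?geo (Suc r)" unfolding Suc.IH mat_pow_Suc' by (rule uea_mat_mult[OF A P])
      finally show ?case .
    qed
    thus ?thesis using yt by auto
  qed
  have "inv\<^bsub>series_alg ?M\<^esub> ?op = ?geo"
    unfolding m_inv_def
  proof (rule the_equality)
    show "?geo \<in> carrier (series_alg ?M) \<and> ?op \<otimes>\<^bsub>series_alg ?M\<^esub> ?geo = \<one>\<^bsub>series_alg ?M\<^esub>
        \<and> ?geo \<otimes>\<^bsub>series_alg ?M\<^esub> ?op = \<one>\<^bsub>series_alg ?M\<^esub>"
      by (intro conjI carr P inv_left inv_right)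
  qed (use unique in blast)
  hence "cayley ?M (uea_mat A) = (\<lambda>r. uea_mat (?P r + (if r = 0 then 0 else A ** ?P (r - 1))))"
    unfolding cayley_def using uea_series_mult[OF one_plus_free_over[OF A] P]
    by (simp only: one_plus_uea_mat one_plus_free_conv)
  also have "\<dots> = (\<lambda>r. if r = 0 then \<one>\<^bsub>?M\<^esub> else 2 \<odot>\<^bsub>?M\<^esub> (uea_mat A [^]\<^bsub>?M\<^esub> r))"
  proof
    fix r
    have "fconst 2 = 1 + (1 :: (complex^'n^'n) free)"
      unfolding fconst.one[symmetric] fconst.add[symmetric] by simp
    hence "?P r + A ** ?P (r - 1) = mat (fconst 2) ** ?P r" if "r > 0"
      using mat_pow_Suc'[of A "r - 1"] that by (simp add: vec_eq_iff scalar_mult_nth distrib_right mult_2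
        del: mat_pow.simps)
    thus "uea_mat (?P r + (if r = 0 then 0 else A ** ?P (r - 1))) = (if r = 0 then \<one>\<^bsub>?M\<^esub> else 2 \<odot>\<^bsub>?M\<^esub>
      (uea_mat A [^]\<^bsub>?M\<^esub> r))"
      unfolding uea_mat_pow[OF A] uea_mat_smult[OF P P] by (simp add: uea_mat_1)
  qed
  finally show "cayley ?M (uea_mat A) = (\<lambda>r. if r = 0 then \<one>\<^bsub>?M\<^esub> else 2 \<odot>\<^bsub>?M\<^esub> (uea_mat A [^]\<^bsub>?M\<^esub> r))" .
qed

end

section \<open>The homomorphism\<close>

theorem theorem3p3:
  fixes G :: "complex^'n::finite^'n" and \<kappa> :: complex
  assumes nonsingular: "invertible G"
    and cases:
      "(transpose G = G \<and> \<kappa> = of_nat CARD('n) / 2 - 1) \<or>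
       (transpose G = - G \<and> even CARD('n) \<and> \<kappa> = of_nat CARD('n) / 2 + 1)"
  shows
    "one_plus (mat_alg (Ug G)) (\<ominus>\<^bsub>mat_alg (Ug G)\<^esub> F_shift G)
        \<in> Units (series_alg (mat_alg (Ug G))) \<and>
     cayley (mat_alg (Ug G)) (F_shift G) =
        (\<lambda>r. if r = 0 then \<one>\<^bsub>mat_alg (Ug G)\<^esub>
             else 2 \<odot>\<^bsub>mat_alg (Ug G)\<^esub> (F_shift G [^]\<^bsub>mat_alg (Ug G)\<^esub> r)) \<and>
     (\<exists>h \<in> alg_hom (refl_alg G \<kappa>) (Ug G).
        \<forall>r\<ge>1. \<forall>i j. h (refl_gen G \<kappa> r i j) = cayley (mat_alg (Ug G)) (F_shift G) r i j)"
proof -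
  define \<epsilon> :: complex where "\<epsilon> = (if transpose G = G \<and> \<kappa> = of_nat CARD('n) / 2 - 1 then 1 else - 1)"
  have \<epsilon>: "\<epsilon> = 1 \<or> \<epsilon> = - 1" by (simp add: \<epsilon>_def)
  have "mat (- 1) ** G = - G" by (simp add: vec_eq_iff scalar_mult_nth)
  hence sym: "transpose G = mat \<epsilon> ** G" and \<kappa>: "\<kappa> = of_nat CARD('n) / 2 - \<epsilon>"
    using cases by (auto simp: \<epsilon>_def)
  let ?L = "g_lie G" and ?cls = "pres_class (g_lie G) (uea_rels (g_lie G))"
  note L = uea_rels_closed[OF nonsingular \<epsilon> sym]
  have F: "F_shift G = uea_mat ?L (F_shift_free G)"
  proof -
    let ?f = "\<chi> i j. fgen (F_elem G i j)" and ?c = "mat (fconst (of_nat CARD('n) / 4)) :: (complex^'n^'n)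
      free^'n^'n"
    have f: "?f \<in> mat_over (carrier (free_alg ?L))" by (auto simp: mat_over_def intro!: fgen_closed g_lie_F)
    have c: "?c \<in> mat_over (carrier (free_alg ?L))" and 1: "mat 1 \<in> mat_over (carrier (free_alg ?L))"
      by (intro mat_over_subring(3) subring_free fconst_closed subring_set_1)+
    have nc: "- ?c \<in> mat_over (carrier (free_alg ?L))" using c by (simp add: mat_over_def free_closed)
    have "F_mat G = uea_mat ?L ?f"
      by (simp add: fun_eq_iff F_mat_def uea_incl_def presented_gen_def uea_mat_def[OF L] pres_class_def[OF L])
    thus ?thesis
      unfolding F_shift_def a_minus_def uea_mat_1[OF L, symmetric] uea_mat_smult[OF L 1 1]
      by (simp add: uea_mat_uminus[OF L c] uea_mat_add[OF L f nc] F_shift_free_def)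
  qed
  note cayley = cayley_uea_mat[OF L F_shift_free_over, folded F]
  have "\<exists>h\<in>alg_hom (refl_alg G \<kappa>) (Ug G). \<forall>p\<in>carrier (free_alg s_symbols).
      h (pres_class s_symbols (refl_rels G \<kappa>) p) = ?cls (free_subst (cayley_image G) p)"
    unfolding refl_alg_def
  proof (rule presented_alg_universal[OF refl_rels_closed ring_uea[OF L]])
    show "(\<lambda>p. ?cls (free_subst (cayley_image G) p)) \<in> alg_hom (free_alg s_symbols) (Ug G)"
      unfolding alg_hom_def uea_def
      by (auto intro!: ring_hom_memI simp: free_alg_ops free_subst_hom pres_class_hom[OF L]
        pres_class_smult[OF L] pres_class_closed[OF L]
        pres_class_1[OF L] free_subst_closed cayley_image_closed)
    fix p assume "p \<in> refl_rels G \<kappa>"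
    hence "free_subst (cayley_image G) p \<in> uea_ideal G" by (rule refl_rels_in_kernel[OF nonsingular \<epsilon> sym \<kappa>])
    hence "?cls (free_subst (cayley_image G) p) = ?cls 0"
      by (subst pres_class_eq_iff[OF L]) (auto simp: free_subst_closed cayley_image_closed free_closed)
    thus "?cls (free_subst (cayley_image G) p) = \<zero>\<^bsub>Ug G\<^esub>"
      unfolding uea_def pres_class_0[OF L] .
  qed
  then obtain h where h: "h \<in> alg_hom (refl_alg G \<kappa>) (Ug G)"
    "\<And>p. p \<in> carrier (free_alg s_symbols) \<Longrightarrow> h (pres_class s_symbols (refl_rels G \<kappa>) p) = ?cls
      (free_subst (cayley_image G) p)"
    by blast
  have "h (refl_gen G \<kappa> r i j) = cayley (mat_alg (Ug G)) (F_shift G) r i j" if "r \<ge> 1" for r i j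
  proof -
    have P: "mat_pow (F_shift_free G) r \<in> mat_over (carrier (free_alg ?L))"
      by (rule mat_pow_over[OF subring_free F_shift_free_over])
    have "refl_gen G \<kappa> r i j = pres_class s_symbols (refl_rels G \<kappa>) (fgen (r, i, j))"
      by (simp add: refl_gen_def presented_gen_def pres_class_def[OF refl_rels_closed])
    hence "h (refl_gen G \<kappa> r i j) = ?cls (fconst 2 * mat_pow (F_shift_free G) r $ i $ j)"
      using h(2)[OF fgen_closed, of "(r, i, j)"] that by (simp add: s_symbols_def free_subst_fgen
        cayley_image_def)
    also have "\<dots> = uea_mat ?L (mat (fconst 2) ** mat_pow (F_shift_free G) r) i j"
      by (simp add: uea_mat_def[OF L] scalar_mult_nth)
    also have "\<dots> = cayley (mat_alg (Ug G)) (F_shift G) r i j"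
      unfolding cayley(2) using that
      by (simp add: F uea_mat_pow[OF L F_shift_free_over] uea_mat_smult[OF L P P])
    finally show ?thesis .
  qed
  thus ?thesis using cayley h(1) by blast
qed

end
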